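(* Let $p$ be an odd prime, $n\ge 2$, $K$ a field of characteristic $p$, and let $E$ be the Lyndon-Hochschild-Serre spectral sequence with coefficients in $K$ of the split extension $1\to M\to \mathrm{Heis}(p^n)\to Q\to 1$. With the elements $\lambda_1,\gamma_2,\mu_j\in E_2$ defined in the context, the second differential satisfies: (i) for $2\leq i\leq p$, $d_2(\mu_{2i})=-(i-1)\lambda_1\mu_{2i-2}\gamma_2$; (ii) for $2\leq i\leq p-1$, $d_2(\mu_{2i+1})=-i\,\lambda_1\mu_{2i-1}\gamma_2$.
   Context: $G=\mathrm{Heis}(p^n)=Q\ltimes M$ with $M=C_{p^n}\times C_{p^n}=\langle a,b\rangle$, $Q=C_{p^n}=\langle\sigma\rangle$, $a^\sigma=ab$, $b^\sigma=b$. Write $H^\bullet(M)=H^\bullet(M;K)=\Lambda(x_1,y_1)\otimes K[x_2,y_2]$ with $x_1=a^*$, $y_1=b^*$ the dual classes in degree 1 and $x_2=\beta_n(x_1)$, $y_2=\beta_n(y_1)$ ($\beta_n$ the $n$-th Bockstein). The action of $Q$ is $\sigma x_i=x_i$, $\sigma y_i=x_i+y_i$ for $i=1,2$. Using the minimal $KQ$-resolution ($KQ$ in each degree, with differentials alternately $\sigma-1$ and $\sum_{i=0}^{p^n-1}\sigma^i$) and the fact that $\sum_{i=0}^{p^n-1}\sigma^i$ acts as zero on $H^\bullet(M)$ (as $n\ge2$), one identifies $E_2^{r,s}=H^r(Q;H^s(M))$ with $H^s(M)^Q$ if $r$ is even, and with $H^s(M)/(\sigma-1)H^s(M)$ if $r$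 is odd; $\bar\varphi$ denotes the class of $\varphi$. The product of $\bar\varphi\in E_2^{r,s}$ and $\bar\varphi'\in E_2^{r',s'}$ is given by $(-1)^{r's}\bar\varphi\bar\varphi'=\overline{\varphi\smile\varphi'}$ if $r$ or $r'$ is even, and $(-1)^{r's}\bar\varphi\bar\varphi'=\sum_{0\le i<j<p^n}\overline{\sigma^i\varphi\smile\sigma^j\varphi'}$ if both are odd. The notation is: $\lambda_1=x_1\in E_2^{0,1}$; $\gamma_2=\bar 1\in E_2^{2,0}$; $\mu_{2i}=\overline{y_1y_2^{i-1}}\in E_2^{1,2i-1}$ for $1\le i\le p$; $\mu_{2i+1}=\overline{y_2^i}\in E_2^{1,2i}$ for $1\le i\le p-1$. *)

theory Defs
  imports
    "HOL-Algebra.Elementary_Groups"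
    "HOL-Algebra.Coset"
    "HOL-Computational_Algebra.Primes"
    "HOL-Number_Theory.Cong"
    "HOL-Library.Function_Algebras"
    "HOL-Library.Set_Algebras"
begin

section \<open>Homogeneous cochains and group cohomology\<close>

text \<open>
  Throughout, \<open>G\<close> is a group, \<open>M\<close> a normal subgroup and \<open>K\<close> (the type \<open>'k\<close>) is a trivial
  coefficient module.  For a subset \<open>X\<close> of \<open>G\<close> stable under left multiplication by \<open>M\<close>,
  \<open>cochains G M X s\<close> is \<open>Hom\<^bsub>KM\<^esub>(F\<^sub>s, K)\<close> where \<open>F\<^sub>s\<close> has \<open>K\<close>-basis \<open>X\<^bsup>s+1\<^esup>\<close> with the diagonal
  action (the homogeneous bar complex).  Two cases matter: \<open>X = M\<close> gives the standard cochain
  complex of \<open>M\<close>; \<open>X = carrier G\<close> gives \<open>Hom\<^bsub>KM\<^esub>(F, K)\<close> for the bar resolution \<open>F\<close> of \<open>G\<close>, which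
  has the same cohomology (by restriction to \<open>M\<close>) and carries an action of \<open>G/M\<close>.
  A tuple is a list, and cochains vanish off the tuples of the right length with entries in \<open>X\<close>.
  Sums of functions are pointwise, and \<open>A + B\<close> for sets is elementwise, so that a coset of \<open>B\<close>
  is a set \<open>w +o B\<close>.
\<close>

definition restr :: "'g set \<Rightarrow> ('g list \<Rightarrow> 'k::zero) \<Rightarrow> 'g list \<Rightarrow> 'k" where
  "restr X f = (\<lambda>xs. if set xs \<subseteq> X then f xs else 0)"

definition cochains ::
  "('g, 'b) monoid_scheme \<Rightarrow> 'g set \<Rightarrow> 'g set \<Rightarrow> nat \<Rightarrow> ('g list \<Rightarrow> 'k::zero) set" where
  "cochains G M X s =
     {f. (\<forall>xs. f xs \<noteq> 0 \<longrightarrow> length xs = Suc s \<and> set xs \<subseteq> X) \<and>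
         (\<forall>m\<in>M. \<forall>xs. set xs \<subseteq> X \<longrightarrow> f (map (\<lambda>x. m \<otimes>\<^bsub>G\<^esub> x) xs) = f xs)}"

text \<open>\<open>(\<delta>f)(x\<^sub>0,\<dots>,x\<^bsub>s+1\<^esub>) = \<Sum>\<^sub>i (-1)\<^sup>i f(x\<^sub>0,\<dots>,omit x\<^sub>i,\<dots>,x\<^bsub>s+1\<^esub>)\<close>\<close>
definition cobd :: "'g set \<Rightarrow> ('g list \<Rightarrow> 'k::comm_ring_1) \<Rightarrow> 'g list \<Rightarrow> 'k" where
  "cobd X f = restr X (\<lambda>xs. \<Sum>i<length xs. (-1) ^ i * f (take i xs @ drop (Suc i) xs))"

definition cocycles ::
  "('g, 'b) monoid_scheme \<Rightarrow> 'g set \<Rightarrow> 'g set \<Rightarrow> nat \<Rightarrow> ('g list \<Rightarrow> 'k::comm_ring_1) set" where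
  "cocycles G M X s = {f \<in> cochains G M X s. cobd X f = 0}"

fun coboundaries ::
  "('g, 'b) monoid_scheme \<Rightarrow> 'g set \<Rightarrow> 'g set \<Rightarrow> nat \<Rightarrow> ('g list \<Rightarrow> 'k::comm_ring_1) set" where
  "coboundaries G M X 0 = {0}"
| "coboundaries G M X (Suc s) = cobd X ` cochains G M X s"

text \<open>\<open>H\<^sup>s(M;K)\<close>, as a set of cosets of the coboundaries.\<close>
definition cohom ::
  "('g, 'b) monoid_scheme \<Rightarrow> 'g set \<Rightarrow> nat \<Rightarrow> ('g list \<Rightarrow> 'k::comm_ring_1) set set" where
  "cohom G M s = (\<lambda>f. f +o coboundaries G M M s) ` cocycles G M M s"

text \<open>\<open>(f \<smile> f')(x\<^sub>0,\<dots>,x\<^bsub>s+s'\<^esub>) = f(x\<^sub>0,\<dots>,x\<^sub>s) f'(x\<^sub>s,\<dots>,x\<^bsub>s+s'\<^esub>)\<close> for \<open>f\<close> of degree \<open>s\<close>\<close>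
definition cup :: "nat \<Rightarrow> ('g list \<Rightarrow> 'k::comm_ring_1) \<Rightarrow> ('g list \<Rightarrow> 'k) \<Rightarrow> 'g list \<Rightarrow> 'k" where
  "cup s f f' = (\<lambda>xs. f (take (Suc s) xs) * f' (drop s xs))"

definition cohom_cup ::
  "('g, 'b) monoid_scheme \<Rightarrow> 'g set \<Rightarrow> nat \<Rightarrow> nat \<Rightarrow>
   ('g list \<Rightarrow> 'k::comm_ring_1) set \<Rightarrow> ('g list \<Rightarrow> 'k) set \<Rightarrow> ('g list \<Rightarrow> 'k) set" where
  "cohom_cup G M s s' u v = {cup s f f' | f f'. f \<in> u \<and> f' \<in> v} + coboundaries G M M (s + s')"

definition cohom_one :: "('g, 'b) monoid_scheme \<Rightarrow> 'g set \<Rightarrow> ('g list \<Rightarrow> 'k::comm_ring_1) set" where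
  "cohom_one G M =
     restr M (\<lambda>xs. if length xs = Suc 0 then 1 else 0) +o coboundaries G M M 0"

text \<open>\<open>u\<^sup>i\<close> for \<open>u \<in> H\<^sup>s(M;K)\<close>\<close>
fun cohom_power ::
  "('g, 'b) monoid_scheme \<Rightarrow> 'g set \<Rightarrow> nat \<Rightarrow> ('g list \<Rightarrow> 'k::comm_ring_1) set \<Rightarrow> nat \<Rightarrow>
   ('g list \<Rightarrow> 'k) set" where
  "cohom_power G M s u 0 = cohom_one G M"
| "cohom_power G M s u (Suc i) = cohom_cup G M (i * s) s (cohom_power G M s u i) u"

text \<open>The class in \<open>H\<^sup>1(M;K) = Hom(M,K)\<close> of a homomorphism \<open>\<theta>\<close>: homogeneously,
  \<open>(x\<^sub>0,x\<^sub>1) \<mapsto> \<theta>(x\<^sub>0\<^bsup>-1\<^esup>x\<^sub>1)\<close>.\<close>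
definition hom_class ::
  "('g, 'b) monoid_scheme \<Rightarrow> 'g set \<Rightarrow> ('g \<Rightarrow> 'k::comm_ring_1) \<Rightarrow> ('g list \<Rightarrow> 'k) set" where
  "hom_class G M \<theta> =
     restr M (\<lambda>xs. if length xs = 2 then \<theta> (inv\<^bsub>G\<^esub> (xs ! 0) \<otimes>\<^bsub>G\<^esub> xs ! 1) else 0)
     +o coboundaries G M M 1"

text \<open>
  The \<open>n\<close>-th order Bockstein \<open>\<beta>\<^sub>n\<close> on classes of degree \<open>s\<close> coming from the prime field: lift a
  representative to an integral cochain \<open>f\<close> with \<open>p\<^sup>n\<close> dividing \<open>\<delta>f\<close>; the value is represented by the
  reduction of \<open>\<delta>f / p\<^sup>n\<close>.  All admissible lifts are collected, so in general the result is a union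
  of classes, namely a coset of the usual indeterminacy of \<open>\<beta>\<^sub>n\<close>.  The indeterminacy vanishes on
  \<open>H\<^sup>1\<close> when \<open>M\<close> is a sum of copies of \<open>C\<^bsub>p^n\<^esub>\<close>.
\<close>
definition bockstein ::
  "('g, 'b) monoid_scheme \<Rightarrow> 'g set \<Rightarrow> nat \<Rightarrow> nat \<Rightarrow> nat \<Rightarrow>
   ('g list \<Rightarrow> 'k::comm_ring_1) set \<Rightarrow> ('g list \<Rightarrow> 'k) set" where
  "bockstein G M p n s u =
     {(\<lambda>xs. of_int (cobd M f xs div int (p ^ n))) | f :: 'g list \<Rightarrow> int.
        f \<in> cochains G M M s \<and> (\<lambda>xs. of_int (f xs)) \<in> u \<and> (\<forall>xs. int (p ^ n) dvd cobd M f xs)}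
     + coboundaries G M M (Suc s)"


section \<open>The Lyndon-Hochschild-Serre spectral sequence with cyclic quotient\<close>

text \<open>
  Let \<open>Q = G/M\<close> be finite cyclic, generated by the coset of \<open>g\<close>, and let \<open>F\<close> be the bar resolution
  of \<open>G\<close>.  The spectral sequence is that of the double complex
  \<open>C\<^bsup>r,s\<^esup> = Hom\<^bsub>KQ\<^esub>(P\<^sub>r, Hom\<^bsub>KM\<^esub>(F\<^sub>s, K))\<close> filtered by \<open>r\<close>, where \<open>P\<close> is the minimal \<open>KQ\<close>-resolution
  (\<open>P\<^sub>r = KQ\<close>, differentials alternately \<open>\<sigma>-1\<close> and the norm \<open>\<Sum>\<^sub>i \<sigma>\<^sup>i\<close>).  Evaluation at
  \<open>1 \<in> KQ\<close> identifies \<open>C\<^bsup>r,s\<^esup>\<close> with \<open>Hom\<^bsub>KM\<^esub>(F\<^sub>s, K) = cochains G M (carrier G) s\<close>.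
\<close>

text \<open>\<open>(h f)(x\<^sub>0,\<dots>) = f(h\<^bsup>-1\<^esup>x\<^sub>0,\<dots>)\<close>; elements of \<open>M\<close> act trivially on \<open>M\<close>-invariant cochains.\<close>
definition act :: "('g, 'b) monoid_scheme \<Rightarrow> 'g \<Rightarrow> ('g list \<Rightarrow> 'k::zero) \<Rightarrow> 'g list \<Rightarrow> 'k" where
  "act G h f = restr (carrier G) (\<lambda>xs. f (map (\<lambda>x. inv\<^bsub>G\<^esub> h \<otimes>\<^bsub>G\<^esub> x) xs))"

definition hdiff ::
  "('g, 'b) monoid_scheme \<Rightarrow> 'g set \<Rightarrow> 'g \<Rightarrow> nat \<Rightarrow> ('g list \<Rightarrow> 'k::comm_ring_1) \<Rightarrow> 'g list \<Rightarrow> 'k" where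
  "hdiff G M g r f =
     (if even r then act G g f - f
      else (\<Sum>i<order (G Mod M). act G (g [^]\<^bsub>G\<^esub> i) f))"

text \<open>Total cochains of degree \<open>k\<close>: families with \<open>r\<close>-th component in \<open>C\<^bsup>r,k-r\<^esup>\<close>; the total
  differential is \<open>d\<^sub>h + (-1)\<^sup>r d\<^sub>v\<close> on \<open>C\<^bsup>r,s\<^esup>\<close>.\<close>
definition tot ::
  "('g, 'b) monoid_scheme \<Rightarrow> 'g set \<Rightarrow> nat \<Rightarrow> (nat \<Rightarrow> 'g list \<Rightarrow> 'k::comm_ring_1) set" where
  "tot G M k = {w. (\<forall>r\<le>k. w r \<in> cochains G M (carrier G) (k - r)) \<and> (\<forall>r>k. w r = 0)}"

definition tdiff ::
  "('g, 'b) monoid_scheme \<Rightarrow> 'g set \<Rightarrow> 'g \<Rightarrow> (nat \<Rightarrow> 'g list \<Rightarrow> 'k::comm_ring_1) \<Rightarrow>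
   nat \<Rightarrow> 'g list \<Rightarrow> 'k" where
  "tdiff G M g w =
     (\<lambda>r. (case r of 0 \<Rightarrow> 0 | Suc t \<Rightarrow> hdiff G M g t (w t))
          + (\<lambda>xs. (-1) ^ r * cobd (carrier G) (w r) xs))"

text \<open>Total cochains of degree \<open>k\<close> in filtration \<open>a\<close> whose differential has filtration \<open>b\<close>.\<close>
definition filt_cocycles ::
  "('g, 'b) monoid_scheme \<Rightarrow> 'g set \<Rightarrow> 'g \<Rightarrow> nat \<Rightarrow> nat \<Rightarrow> nat \<Rightarrow>
   (nat \<Rightarrow> 'g list \<Rightarrow> 'k::comm_ring_1) set" where
  "filt_cocycles G M g a b k =
     {w \<in> tot G M k. (\<forall>r<a. w r = 0) \<and> (\<forall>r<b. tdiff G M g w r = 0)}"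

text \<open>
  \<open>E\<^sub>t\<^bsup>r,s\<^esup> = Z\<^sub>t / B\<^sub>t\<close> for \<open>t \<ge> 1\<close>, with total degree \<open>k = r + s\<close>,
  \<open>Z\<^sub>t = {w \<in> F\<^sup>r. Dw \<in> F\<^bsup>r+t\<^esup>}\<close> and
  \<open>B\<^sub>t = {w \<in> F\<^bsup>r+1\<^esup>. Dw \<in> F\<^bsup>r+t\<^esup>} + D {w \<in> F\<^bsup>r-t+1\<^esup>. Dw \<in> F\<^sup>r}\<close>.
  Truncated subtraction is harmless since \<open>F\<^sup>0\<close> is the whole complex.
\<close>
definition lhs_Z ::
  "('g, 'b) monoid_scheme \<Rightarrow> 'g set \<Rightarrow> 'g \<Rightarrow> nat \<Rightarrow> nat \<Rightarrow> nat \<Rightarrow>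
   (nat \<Rightarrow> 'g list \<Rightarrow> 'k::comm_ring_1) set" where
  "lhs_Z G M g t r k = filt_cocycles G M g r (r + t) k"

definition lhs_B ::
  "('g, 'b) monoid_scheme \<Rightarrow> 'g set \<Rightarrow> 'g \<Rightarrow> nat \<Rightarrow> nat \<Rightarrow> nat \<Rightarrow>
   (nat \<Rightarrow> 'g list \<Rightarrow> 'k::comm_ring_1) set" where
  "lhs_B G M g t r k =
     filt_cocycles G M g (Suc r) (r + t) k +
     (case k of 0 \<Rightarrow> {0} | Suc j \<Rightarrow> tdiff G M g ` filt_cocycles G M g (Suc r - t) r j)"

definition lhs_page ::
  "('g, 'b) monoid_scheme \<Rightarrow> 'g set \<Rightarrow> 'g \<Rightarrow> nat \<Rightarrow> nat \<Rightarrow> nat \<Rightarrow>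
   (nat \<Rightarrow> 'g list \<Rightarrow> 'k::comm_ring_1) set set" where
  "lhs_page G M g t r s = (\<lambda>w. w +o lhs_B G M g t r (r + s)) ` lhs_Z G M g t r (r + s)"

text \<open>\<open>d\<^sub>t : E\<^sub>t\<^bsup>r,s\<^esup> \<rightarrow> E\<^sub>t\<^bsup>r+t,s-t+1\<^esup>\<close>, induced by the total differential\<close>
definition lhs_diff ::
  "('g, 'b) monoid_scheme \<Rightarrow> 'g set \<Rightarrow> 'g \<Rightarrow> nat \<Rightarrow> nat \<Rightarrow> nat \<Rightarrow>
   (nat \<Rightarrow> 'g list \<Rightarrow> 'k::comm_ring_1) set \<Rightarrow> (nat \<Rightarrow> 'g list \<Rightarrow> 'k) set" where
  "lhs_diff G M g t r s U = tdiff G M g ` U + lhs_B G M g t (r + t) (Suc (r + s))"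

text \<open>Scalar multiplication on \<open>E\<^sub>t\<^bsup>r,s\<^esup>\<close>; adding \<open>B\<^sub>t\<close> matters for the scalar \<open>0\<close>.\<close>
definition lhs_scale ::
  "('g, 'b) monoid_scheme \<Rightarrow> 'g set \<Rightarrow> 'g \<Rightarrow> nat \<Rightarrow> nat \<Rightarrow> nat \<Rightarrow> 'k::comm_ring_1 \<Rightarrow>
   (nat \<Rightarrow> 'g list \<Rightarrow> 'k) set \<Rightarrow> (nat \<Rightarrow> 'g list \<Rightarrow> 'k) set" where
  "lhs_scale G M g t r s c U = (\<lambda>w i xs. c * w i xs) ` U + lhs_B G M g t r (r + s)"

text \<open>
  For \<open>u \<in> H\<^sup>s(M;K)\<close> (\<open>Q\<close>-invariant if \<open>r\<close> is even), the element \<open>\<open>u-bar\<close> \<in> E\<^sub>2\<^bsup>r,s\<^esup>\<close> under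
  \<open>E\<^sub>2\<^bsup>r,s\<^esup> = H\<^sup>r(Q; H\<^sup>s(M;K))\<close>: it consists of the elements of \<open>Z\<^sub>2\<close> whose leading component
  \<open>w r \<in> Hom\<^bsub>KM\<^esub>(F\<^sub>s, K)\<close> restricts on \<open>M\<close> to a representative of \<open>u\<close>, up to \<open>B\<^sub>2\<close>.
\<close>
definition E2_bar ::
  "('g, 'b) monoid_scheme \<Rightarrow> 'g set \<Rightarrow> 'g \<Rightarrow> nat \<Rightarrow> nat \<Rightarrow>
   ('g list \<Rightarrow> 'k::comm_ring_1) set \<Rightarrow> (nat \<Rightarrow> 'g list \<Rightarrow> 'k) set" where
  "E2_bar G M g r s u =
     {w \<in> lhs_Z G M g 2 r (r + s). restr M (w r) \<in> u} + lhs_B G M g 2 r (r + s)"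

text \<open>The action of \<open>h \<in> G\<close> on the cochains of \<open>M\<close>: \<open>(h f)(x\<^sub>0,\<dots>) = f(h\<^bsup>-1\<^esup>x\<^sub>0h,\<dots>)\<close>\<close>
definition conj_act ::
  "('g, 'b) monoid_scheme \<Rightarrow> 'g set \<Rightarrow> 'g \<Rightarrow> ('g list \<Rightarrow> 'k::zero) \<Rightarrow> 'g list \<Rightarrow> 'k" where
  "conj_act G M h f =
     restr M (\<lambda>xs. f (map (\<lambda>x. inv\<^bsub>G\<^esub> h \<otimes>\<^bsub>G\<^esub> x \<otimes>\<^bsub>G\<^esub> h) xs))"

text \<open>The class \<open>u \<smile> v\<close>, respectively \<open>\<Sum>\<^bsub>i<j\<^esub> \<sigma>\<^sup>iu \<smile> \<sigma>\<^sup>jv\<close> for \<open>r, r'\<close> both odd, with the sign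
  \<open>(-1)\<^bsup>r's\<^esup>\<close>\<close>
definition E2_cup ::
  "('g, 'b) monoid_scheme \<Rightarrow> 'g set \<Rightarrow> 'g \<Rightarrow> nat \<Rightarrow> nat \<Rightarrow> nat \<Rightarrow> nat \<Rightarrow>
   ('g list \<Rightarrow> 'k::comm_ring_1) set \<Rightarrow> ('g list \<Rightarrow> 'k) set \<Rightarrow> ('g list \<Rightarrow> 'k) set" where
  "E2_cup G M g r s r' s' u v =
     {(\<lambda>xs. (-1) ^ (r' * s) *
         (if even r \<or> even r' then cup s f f' xs
          else (\<Sum>j<order (G Mod M). \<Sum>i<j.
                  cup s (conj_act G M (g [^]\<^bsub>G\<^esub> i) f) (conj_act G M (g [^]\<^bsub>G\<^esub> j) f') xs)))
      | f f'. f \<in> u \<and> f' \<in> v}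
     + coboundaries G M M (s + s')"

text \<open>The product \<open>E\<^sub>2\<^bsup>r,s\<^esup> \<times> E\<^sub>2\<^bsup>r',s'\<^esup> \<rightarrow> E\<^sub>2\<^bsup>r+r',s+s'\<^esup>\<close>; valid when the norm acts as zero on
  \<open>H(M;K)\<close>, as it does for the Heisenberg group below with \<open>n \<ge> 2\<close>.\<close>
definition E2_mult ::
  "('g, 'b) monoid_scheme \<Rightarrow> 'g set \<Rightarrow> 'g \<Rightarrow> nat \<Rightarrow> nat \<Rightarrow> nat \<Rightarrow> nat \<Rightarrow>
   (nat \<Rightarrow> 'g list \<Rightarrow> 'k::comm_ring_1) set \<Rightarrow> (nat \<Rightarrow> 'g list \<Rightarrow> 'k) set \<Rightarrow>
   (nat \<Rightarrow> 'g list \<Rightarrow> 'k) set" where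
  "E2_mult G M g r s r' s' U V =
     (THE W. \<exists>u \<in> cohom G M s. \<exists>v \<in> cohom G M s'.
        U = E2_bar G M g r s u \<and> V = E2_bar G M g r' s' v \<and>
        W = E2_bar G M g (r + r') (s + s') (E2_cup G M g r s r' s' u v))"


section \<open>The Heisenberg group \<open>Heis(p\<^sup>n) = Q \<ltimes> M\<close>\<close>

text \<open>Semidirect product for a right action \<open>(m, t) \<mapsto> m\<^sup>t\<close>; the pair \<open>(t, m)\<close> is the product
  \<open>t m\<close>, so \<open>(s m)(t m') = s t m\<^sup>t m'\<close>.\<close>
definition semidirect ::
  "('q, 'c) monoid_scheme \<Rightarrow> ('m, 'd) monoid_scheme \<Rightarrow> ('m \<Rightarrow> 'q \<Rightarrow> 'm) \<Rightarrow> ('q \<times> 'm) monoid" where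
  "semidirect Q M rho =
     \<lparr>carrier = carrier Q \<times> carrier M,
      monoid.mult = (\<lambda>(s, m) (t, m'). (s \<otimes>\<^bsub>Q\<^esub> t, rho m t \<otimes>\<^bsub>M\<^esub> m')),
      one = (\<one>\<^bsub>Q\<^esub>, \<one>\<^bsub>M\<^esub>)\<rparr>"

type_synonym heis_elt = "int \<times> int \<times> int"

text \<open>\<open>(t, j, k)\<close> is \<open>\<sigma>\<^sup>t a\<^sup>j b\<^sup>k\<close>, and \<open>(a\<^sup>j b\<^sup>k)\<^bsup>\<sigma>^t\<^esup> = a\<^sup>j b\<^bsup>k + t j\<^esup>\<close>.\<close>
definition Heis :: "nat \<Rightarrow> heis_elt monoid" where
  "Heis q = semidirect (integer_mod_group q) (integer_mod_group q \<times>\<times> integer_mod_group q)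
     (\<lambda>(j, k) t. (j, (k + t * j) mod int q))"

definition heis_M :: "nat \<Rightarrow> heis_elt set" where
  "heis_M q = {0} \<times> carrier (integer_mod_group q \<times>\<times> integer_mod_group q)"

definition heis_sigma :: heis_elt where "heis_sigma = (1, 0, 0)"
definition heis_a :: heis_elt where "heis_a = (0, 1, 0)"
definition heis_b :: heis_elt where "heis_b = (0, 0, 1)"

lemma Heis_mult:
  "(s, j, k) \<otimes>\<^bsub>Heis q\<^esub> (t, j', k') =
     ((s + t) mod int q, (j + j') mod int q, (k + k' + t * j) mod int q)"
  by (simp add: Heis_def semidirect_def mod_simps ac_simps)

lemma carrier_Heis:
  "q > 0 \<Longrightarrow> carrier (Heis q) = {0..<int q} \<times> {0..<int q} \<times> {0..<int q}"
  by (simp add: Heis_def semidirect_def carrier_integer_mod_group)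

lemma one_Heis: "\<one>\<^bsub>Heis q\<^esub> = (0, 0, 0)"
  by (simp add: Heis_def semidirect_def)

lemma group_Heis:
  assumes "q > 0"
  shows "group (Heis q)"
proof (rule groupI)
  fix x assume "x \<in> carrier (Heis q)"
  obtain t j k where x: "x = (t, j, k)" by (cases x)
  have "[(t * j - k) mod int q + k + t * ((- j) mod int q) = t * j - k + k + t * (- j)] (mod int q)"
    by (intro cong_add cong_mult cong_refl) (simp_all add: cong_def)
  then have "((t * j - k) mod int q + k + t * ((- j) mod int q)) mod int q = 0"
    by (simp add: cong_def)
  then show "\<exists>y\<in>carrier (Heis q). y \<otimes>\<^bsub>Heis q\<^esub> x = \<one>\<^bsub>Heis q\<^esub>"
    using assms
    by (intro bexI[of _ "((- t) mod int q, (- j) mod int q, (t * j - k) mod int q)"])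
       (simp_all add: x Heis_mult one_Heis carrier_Heis mod_add_left_eq)
next
  fix x y z
  have "[(k + k' + t' * j) mod int q + k'' + t'' * ((j + j') mod int q) =
         k + (k' + k'' + t'' * j') mod int q + ((t' + t'') mod int q) * j] (mod int q)"
    for j k t' j' k' t'' k''
  proof -
    have "[(k + k' + t' * j) mod int q + k'' + t'' * ((j + j') mod int q) =
           (k + k' + t' * j) + k'' + t'' * (j + j')] (mod int q)"
      by (intro cong_add cong_mult cong_refl) (simp_all add: cong_def)
    also have "(k + k' + t' * j) + k'' + t'' * (j + j') =
               k + (k' + k'' + t'' * j') + (t' + t'') * j"
      by (simp add: algebra_simps)
    also have "[\<dots> = k + (k' + k'' + t'' * j') mod int q + ((t' + t'') mod int q) * j] (mod int q)"
      by (intro cong_add cong_mult cong_refl) (simp_all add: cong_def)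
    finally show ?thesis .
  qed
  then show "x \<otimes>\<^bsub>Heis q\<^esub> y \<otimes>\<^bsub>Heis q\<^esub> z = x \<otimes>\<^bsub>Heis q\<^esub> (y \<otimes>\<^bsub>Heis q\<^esub> z)"
    by (cases x; cases y; cases z)
       (simp add: Heis_mult cong_def mod_add_left_eq mod_add_right_eq add.assoc)
qed (use assms in \<open>auto simp: Heis_mult one_Heis carrier_Heis\<close>)

lemma heis_relations:
  assumes "q > 1"
  shows "heis_a \<otimes>\<^bsub>Heis q\<^esub> heis_sigma = heis_sigma \<otimes>\<^bsub>Heis q\<^esub> (heis_a \<otimes>\<^bsub>Heis q\<^esub> heis_b)"
    and "heis_b \<otimes>\<^bsub>Heis q\<^esub> heis_sigma = heis_sigma \<otimes>\<^bsub>Heis q\<^esub> heis_b"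
  using assms by (simp_all add: heis_a_def heis_b_def heis_sigma_def Heis_mult)

text \<open>\<open>x\<^sub>1 = a\<^sup>*\<close>, \<open>y\<^sub>1 = b\<^sup>*\<close> and \<open>y\<^sub>2 = \<beta>\<^sub>n(y\<^sub>1)\<close>\<close>
definition heis_x1 :: "nat \<Rightarrow> nat \<Rightarrow> (heis_elt list \<Rightarrow> 'k::field) set" where
  "heis_x1 p n = hom_class (Heis (p ^ n)) (heis_M (p ^ n)) (\<lambda>(t, j, k). of_int j)"

definition heis_y1 :: "nat \<Rightarrow> nat \<Rightarrow> (heis_elt list \<Rightarrow> 'k::field) set" where
  "heis_y1 p n = hom_class (Heis (p ^ n)) (heis_M (p ^ n)) (\<lambda>(t, j, k). of_int k)"

definition heis_y2 :: "nat \<Rightarrow> nat \<Rightarrow> (heis_elt list \<Rightarrow> 'k::field) set" where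
  "heis_y2 p n = bockstein (Heis (p ^ n)) (heis_M (p ^ n)) p n 1 (heis_y1 p n)"

text \<open>\<open>y\<^sub>2\<^sup>i\<close> and \<open>y\<^sub>1 y\<^sub>2\<^sup>i\<close>\<close>
definition heis_y2_pow :: "nat \<Rightarrow> nat \<Rightarrow> nat \<Rightarrow> (heis_elt list \<Rightarrow> 'k::field) set" where
  "heis_y2_pow p n i = cohom_power (Heis (p ^ n)) (heis_M (p ^ n)) 2 (heis_y2 p n) i"

definition heis_y1_y2_pow :: "nat \<Rightarrow> nat \<Rightarrow> nat \<Rightarrow> (heis_elt list \<Rightarrow> 'k::field) set" where
  "heis_y1_y2_pow p n i =
     cohom_cup (Heis (p ^ n)) (heis_M (p ^ n)) 1 (2 * i) (heis_y1 p n) (heis_y2_pow p n i)"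

abbreviation heis_bar ::
  "nat \<Rightarrow> nat \<Rightarrow> nat \<Rightarrow> nat \<Rightarrow> (heis_elt list \<Rightarrow> 'k::field) set \<Rightarrow>
   (nat \<Rightarrow> heis_elt list \<Rightarrow> 'k) set" where
  "heis_bar p n r s u \<equiv> E2_bar (Heis (p ^ n)) (heis_M (p ^ n)) heis_sigma r s u"

abbreviation heis_d2 ::
  "nat \<Rightarrow> nat \<Rightarrow> nat \<Rightarrow> nat \<Rightarrow> (nat \<Rightarrow> heis_elt list \<Rightarrow> 'k::field) set \<Rightarrow>
   (nat \<Rightarrow> heis_elt list \<Rightarrow> 'k) set" where
  "heis_d2 p n r s U \<equiv> lhs_diff (Heis (p ^ n)) (heis_M (p ^ n)) heis_sigma 2 r s U"

abbreviation heis_scale ::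
  "nat \<Rightarrow> nat \<Rightarrow> nat \<Rightarrow> nat \<Rightarrow> 'k::field \<Rightarrow> (nat \<Rightarrow> heis_elt list \<Rightarrow> 'k) set \<Rightarrow>
   (nat \<Rightarrow> heis_elt list \<Rightarrow> 'k) set" where
  "heis_scale p n r s c U \<equiv> lhs_scale (Heis (p ^ n)) (heis_M (p ^ n)) heis_sigma 2 r s c U"

abbreviation heis_mult ::
  "nat \<Rightarrow> nat \<Rightarrow> nat \<Rightarrow> nat \<Rightarrow> nat \<Rightarrow> nat \<Rightarrow>
   (nat \<Rightarrow> heis_elt list \<Rightarrow> 'k::field) set \<Rightarrow> (nat \<Rightarrow> heis_elt list \<Rightarrow> 'k) set \<Rightarrow>
   (nat \<Rightarrow> heis_elt list \<Rightarrow> 'k) set" where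
  "heis_mult p n r s r' s' U V \<equiv>
     E2_mult (Heis (p ^ n)) (heis_M (p ^ n)) heis_sigma r s r' s' U V"

definition lambda1 :: "nat \<Rightarrow> nat \<Rightarrow> (nat \<Rightarrow> heis_elt list \<Rightarrow> 'k::field) set" where
  "lambda1 p n = heis_bar p n 0 1 (heis_x1 p n)"

definition gamma2 :: "nat \<Rightarrow> nat \<Rightarrow> (nat \<Rightarrow> heis_elt list \<Rightarrow> 'k::field) set" where
  "gamma2 p n = heis_bar p n 2 0 (cohom_one (Heis (p ^ n)) (heis_M (p ^ n)))"

text \<open>\<open>\<mu>\<^sub>j \<in> E\<^sub>2\<^bsup>1,j-1\<^esup>\<close> for \<open>2 \<le> j \<le> 2p\<close>: the bar class of \<open>y\<^sub>1 y\<^sub>2\<^bsup>i-1\<^esup>\<close> if \<open>j = 2i\<close>, and of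
  \<open>y\<^sub>2\<^sup>i\<close> if \<open>j = 2i+1\<close>.\<close>
definition mu :: "nat \<Rightarrow> nat \<Rightarrow> nat \<Rightarrow> (nat \<Rightarrow> heis_elt list \<Rightarrow> 'k::field) set" where
  "mu p n j = heis_bar p n 1 (j - 1)
     (if even j then heis_y1_y2_pow p n (j div 2 - 1) else heis_y2_pow p n (j div 2))"

end

theory Submission
  imports Defs
begin

text \<open>
  An element of \<open>Heis(q)\<close>, \<open>q = p\<^sup>n\<close>, is \<open>a\<^sup>J b\<^sup>L \<sigma>\<^sup>t\<close>; in the coordinates \<open>(J, L)\<close> the subgroup \<open>M\<close> acts by
  translation and \<open>\<sigma>\<^sup>-\<^sup>1\<close> by \<open>(J, L) \<mapsto> (J, L + J)\<close>.  So everything can be written with explicit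
  cochains on \<open>G\<close>: the 1-cocycles \<open>x\<close>, \<open>y\<close> given by \<open>J\<close>, \<open>L\<close>, the carry cocycles \<open>X\<close>, \<open>Y\<close> representing
  their Bocksteins, and 1-cochains \<open>e\<^sub>j\<close> with \<open>\<sigma>\<^sup>jy = y + jx\<close>, \<open>\<sigma>\<^sup>jY = Y + jX - \<delta>e\<^sub>j\<close>,
  \<open>\<sigma>e\<^sub>j = e\<^bsub>j+1\<^esub> - e\<^sub>1\<close>, \<open>e\<^sub>0 = 0\<close> and, crucially, \<open>e\<^sub>q = x\<close>.

  The differential \<open>d\<^sub>2\<close> sends the class of a cocycle \<open>f\<close> whose norm is \<open>-\<delta>h\<close> to the class of \<open>(\<sigma> - 1)h\<close>.
  For \<open>f = u\<^sub>0 Y\<^sup>m\<close> with \<open>u\<^sub>j = y + jx\<close> or \<open>u\<^sub>j = 1\<close>, the sum over \<open>j < q\<close> of \<open>u\<^sub>j (Y + jX)\<^sup>m\<close> vanishes because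
  \<open>n \<ge> 2\<close>, so \<open>h\<close> is \<open>\<plusminus>\<Sum>\<^sub>j u\<^sub>j E\<^sub>j\<close>, where \<open>E\<^sub>j\<close> is the standard homotopy between \<open>(Y + jX - \<delta>e\<^sub>j)\<^sup>m\<close> and
  \<open>(Y + jX)\<^sup>m\<close>.  Up to coboundaries \<open>(\<sigma> - 1)h\<close> telescopes to \<open>\<plusminus>u\<^sub>0 E\<^sub>q\<close>, and
  \<open>E\<^sub>q = \<Sum>\<^sub>k Y\<^sup>k x Y\<^bsup>m-1-k\<^esup>\<close> gives \<open>m x u\<^sub>0 Y\<^bsup>m-1\<^esup>\<close>.
\<close>

section \<open>Alternating face sums of functions on lists\<close>

text \<open>The coboundary formula before restriction to tuples over a set. Without the restriction,
  identities such as \<open>face_sum_face_sum\<close> follow by recursion on the list.\<close>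

definition face_sum :: "('g list \<Rightarrow> 'k::comm_ring_1) \<Rightarrow> 'g list \<Rightarrow> 'k" where
  "face_sum f xs = (\<Sum>i<length xs. (-1) ^ i * f (take i xs @ drop (Suc i) xs))"

lemma cobd_face_sum: "cobd X f = restr X (face_sum f)"
  by (simp add: cobd_def face_sum_def [abs_def])

lemma face_sum_Nil [simp]: "face_sum f [] = 0"
  by (simp add: face_sum_def)

text \<open>The face with index 0 drops the head. Every other face keeps it and has its index
  shifted by one, which gives the minus sign.\<close>

lemma face_sum_Cons: "face_sum f (x # xs) = f xs - face_sum (\<lambda>ys. f (x # ys)) xs"
  unfolding face_sum_def by (simp del: sum.lessThan_Suc add: sum.lessThan_Suc_shift sum_negf)

lemma face_sum_diff: "face_sum (\<lambda>xs. f xs - h xs) xs = face_sum f xs - face_sum h xs"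
  by (simp add: face_sum_def right_diff_distrib sum_subtractf)

lemma face_sum_add: "face_sum (\<lambda>xs. f xs + h xs) xs = face_sum f xs + face_sum h xs"
  by (simp add: face_sum_def distrib_left sum.distrib)

lemma face_sum_mult: "face_sum (\<lambda>xs. c * f xs) xs = c * face_sum f xs"
  by (simp add: face_sum_def sum_distrib_left mult_ac)

lemma face_sum_cong:
  assumes "\<And>ys. set ys \<subseteq> set xs \<Longrightarrow> Suc (length ys) = length xs \<Longrightarrow> f ys = h ys"
  shows "face_sum f xs = face_sum h xs"
  unfolding face_sum_def
proof (rule sum.cong)
  fix i assume "i \<in> {..<length xs}"
  then have "f (take i xs @ drop (Suc i) xs) = h (take i xs @ drop (Suc i) xs)"
    using set_take_subset[of i xs] set_drop_subset[of "Suc i" xs] by (intro assms) auto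
  then show "(-1) ^ i * f (take i xs @ drop (Suc i) xs) = (-1) ^ i * h (take i xs @ drop (Suc i) xs)"
    by simp
qed simp

text \<open>Expanding with \<open>face_sum_Cons\<close>, the two copies of
  \<open>face_sum f xs\<close> cancel, and what remains is the claim for
  \<open>\<lambda>ys. f (x # ys)\<close> on the tail.\<close>

lemma face_sum_face_sum: "face_sum (face_sum f) xs = 0"
proof (induction xs arbitrary: f)
  case (Cons x xs)
  then show ?case by (simp add: face_sum_Cons face_sum_diff)
qed simp

lemma face_sum_map: "face_sum (\<lambda>ys. f (map \<phi> ys)) xs = face_sum f (map \<phi> xs)"
  by (simp add: face_sum_def take_map drop_map)

lemma face_sum_of_int: "face_sum (\<lambda>ys. of_int (f ys)) xs = of_int (face_sum f xs)"
  by (simp add: face_sum_def)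

text \<open>The Leibniz rule. The two terms that omit a vertex at the junction of the factors cancel
  on the right. Fixing the first entry lowers the degree of the left factor, so the induction ends
  in degree 0.\<close>

lemma face_sum_cup:
  assumes "length xs \<ge> s + 2"
  shows "face_sum (cup s f f') xs = cup (Suc s) (face_sum f) f' xs + (-1) ^ s * cup s f (face_sum f') xs"
  using assms
proof (induction s arbitrary: f xs)
  case 0
  then obtain x y zs where xs: "xs = x # y # zs"
    by (auto simp: numeral_2_eq_2 Suc_le_length_iff)
  have "face_sum (\<lambda>ys. f [x] * f' (x # ys)) (y # zs) = f [x] * face_sum (\<lambda>ys. f' (x # ys)) (y # zs)"
    by (rule face_sum_mult)
  then show ?case
    by (simp add: xs cup_def face_sum_Cons[of _ x] face_sum_Cons[of _ y "[]"] algebra_simps)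
next
  case (Suc s)
  then obtain x ys where xs: "xs = x # ys" and len: "length ys \<ge> s + 2"
    by (cases xs) auto
  have *: "(\<lambda>ys. cup (Suc s) f f' (x # ys)) = cup s (\<lambda>ys. f (x # ys)) f'"
    by (simp add: cup_def fun_eq_iff)
  show ?case
    unfolding xs face_sum_Cons * Suc.IH[OF len]
    by (simp add: cup_def face_sum_Cons algebra_simps)
qed

text \<open>The prism operator \<open>f \<mapsto> \<Sum>\<^sub>i (-1)\<^sup>i f(\<alpha>x\<^sub>0,\<dots>,\<alpha>x\<^sub>i,x\<^sub>i,\<dots>,x\<^sub>s)\<close>.\<close>
fun prism :: "('g \<Rightarrow> 'g) \<Rightarrow> ('g list \<Rightarrow> 'k::comm_ring_1) \<Rightarrow> 'g list \<Rightarrow> 'k" where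
  "prism \<alpha> f [] = 0"
| "prism \<alpha> f (x # xs) = f (\<alpha> x # x # xs) - prism \<alpha> (\<lambda>ys. f (\<alpha> x # ys)) xs"

lemma prism_diff: "prism \<alpha> (\<lambda>xs. f xs - h xs) xs = prism \<alpha> f xs - prism \<alpha> h xs"
  by (induction xs arbitrary: f h) (simp_all add: algebra_simps)

text \<open>The prism is a chain homotopy between the identity and the map induced by
  \<open>\<alpha>\<close>. The induction applies the claim for the tail to \<open>f\<close> with
  \<open>\<alpha> x\<close> put in front.\<close>

lemma prism_homotopy:
  "face_sum (prism \<alpha> f) xs + prism \<alpha> (face_sum f) xs = f xs - f (map \<alpha> xs)"
proof (induction xs arbitrary: f)
  case (Cons x xs)
  show ?case
    using Cons.IH[of "\<lambda>ys. f (\<alpha> x # ys)"]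
    by (simp add: face_sum_Cons face_sum_diff prism_diff algebra_simps)
qed simp

lemma prism_cong:
  assumes "\<And>ys. set ys \<subseteq> set xs \<union> \<alpha> ` set xs \<Longrightarrow> length ys = Suc (length xs) \<Longrightarrow> f ys = h ys"
  shows "prism \<alpha> f xs = prism \<alpha> h xs"
  using assms
proof (induction xs arbitrary: f h)
  case (Cons x xs)
  have "prism \<alpha> (\<lambda>ys. f (\<alpha> x # ys)) xs = prism \<alpha> (\<lambda>ys. h (\<alpha> x # ys)) xs"
    by (intro Cons.IH Cons.prems) auto
  moreover have "f (\<alpha> x # x # xs) = h (\<alpha> x # x # xs)"
    by (intro Cons.prems) auto
  ultimately show ?case by simp
qed simp

lemma prism_zero: "prism \<alpha> (\<lambda>xs. 0) xs = 0"
  by (induction xs) simp_all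

text \<open>Applied with \<open>\<phi>\<close> a translation by an element of \<open>M\<close>, it
  makes prisms of invariant cochains invariant.\<close>

lemma prism_map:
  assumes "\<And>x. x \<in> set xs \<Longrightarrow> \<alpha> (\<phi> x) = \<phi> (\<alpha> x)"
  shows "prism \<alpha> f (map \<phi> xs) = prism \<alpha> (\<lambda>ys. f (map \<phi> ys)) xs"
  using assms by (induction xs arbitrary: f) simp_all

section \<open>Scalar multiples, additive subgroups and cosets\<close>

definition scal :: "'k \<Rightarrow> ('a \<Rightarrow> 'k::comm_ring_1) \<Rightarrow> 'a \<Rightarrow> 'k" where
  "scal c f = (\<lambda>x. c * f x)"

lemma scal_apply [simp]: "scal c f x = c * f x"
  by (simp add: scal_def)

lemma scal_simps [simp]:
  "scal 1 f = f" "scal 0 f = 0" "scal c 0 = 0" "scal (- c) f = - scal c f" "scal c (- f) = - scal c f"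
  "scal c (scal d f) = scal (c * d) f"
  by (simp_all add: fun_eq_iff)

lemma scal_right_distrib: "scal c (f + h) = scal c f + scal c h"
  and scal_right_diff: "scal c (f - h) = scal c f - scal c h"
  and scal_left_distrib: "scal (c + d) f = scal c f + scal d f"
  by (simp_all add: fun_eq_iff algebra_simps)

lemma sum_fun_apply: "(\<Sum>i\<in>A. F i) x = (\<Sum>i\<in>A. F i x)"
  by (induction A rule: infinite_finite_induct) simp_all

lemma scal_sum: "scal c (\<Sum>i\<in>A. F i) = (\<Sum>i\<in>A. scal c (F i))"
  by (simp add: fun_eq_iff sum_fun_apply sum_distrib_left)

text \<open>Cohomology classes and elements of a page are cosets \<open>w +o B\<close> of such sets
  inside a type of functions.\<close>

definition add_subgroup :: "'a::ab_group_add set \<Rightarrow> bool" where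
  "add_subgroup B \<longleftrightarrow> 0 \<in> B \<and> (\<forall>a\<in>B. \<forall>b\<in>B. a - b \<in> B)"

lemma add_subgroupD:
  assumes "add_subgroup B"
  shows "0 \<in> B" "a \<in> B \<Longrightarrow> b \<in> B \<Longrightarrow> a - b \<in> B" "a \<in> B \<Longrightarrow> - a \<in> B"
    "a \<in> B \<Longrightarrow> b \<in> B \<Longrightarrow> a + b \<in> B"
proof -
  show *: "0 \<in> B" "\<And>a b. a \<in> B \<Longrightarrow> b \<in> B \<Longrightarrow> a - b \<in> B"
    using assms by (auto simp: add_subgroup_def)
  show **: "- a \<in> B" if "a \<in> B" for a
    using *(2)[OF *(1) that] by simp
  show "a + b \<in> B" if "a \<in> B" "b \<in> B"
    using *(2)[OF that(1) **[OF that(2)]] by simp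
qed

lemma add_subgroup_plus:
  assumes "add_subgroup A" "add_subgroup B"
  shows "add_subgroup (A + B)"
  unfolding add_subgroup_def
proof (intro conjI ballI)
  show "0 \<in> A + B"
    using assms by (metis add_subgroupD(1) add_0 set_plus_intro)
next
  fix x y assume "x \<in> A + B" "y \<in> A + B"
  then obtain a b a' b' where "x = a + b" "y = a' + b'" "a \<in> A" "b \<in> B" "a' \<in> A" "b' \<in> B"
    by (auto elim!: set_plus_elim)
  then have "x - y = (a - a') + (b - b')" "a - a' \<in> A" "b - b' \<in> B"
    using assms by (auto simp: add_subgroupD)
  then show "x - y \<in> A + B" by auto
qed

lemma elt_set_plus_iff: "x \<in> w +o B \<longleftrightarrow> x - w \<in> B" for w :: "'a::ab_group_add"
  by (metis add_diff_cancel_left' elt_set_plus_def set_minus_plus set_plus_intro2)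

lemma coset_eqI:
  assumes "add_subgroup B" "w - w' \<in> B"
  shows "w +o B = w' +o B"
proof -
  have "x - w \<in> B \<longleftrightarrow> x - w' \<in> B" for x
    using add_subgroupD(4)[OF assms(1), of "x - w" "w - w'"]
      add_subgroupD(2)[OF assms(1), of "x - w'" "w - w'"] assms(2) by auto
  then show ?thesis by (auto simp: elt_set_plus_iff)
qed

text \<open>Products of classes, the Bockstein, \<open>E2_bar\<close>, \<open>lhs_diff\<close> and
  \<open>lhs_scale\<close> are all given as a set of representatives plus a subgroup. This evaluates
  such a sum once the representatives are known to lie in one coset.\<close>

lemma coset_plus_subgroup:
  assumes "add_subgroup B" "S \<noteq> {}" "\<And>x. x \<in> S \<Longrightarrow> x - w \<in> B"
  shows "S + B = w +o B"
proof (intro equalityI subsetI)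
  fix x assume "x \<in> S + B"
  then obtain s b where sb: "x = s + b" "s \<in> S" "b \<in> B"
    by (auto elim!: set_plus_elim)
  then have "x - w = (s - w) + b" by simp
  with assms(3)[OF sb(2)] sb(3) show "x \<in> w +o B"
    by (simp only: elt_set_plus_iff add_subgroupD(4)[OF assms(1)])
next
  fix x assume "x \<in> w +o B"
  moreover obtain s where s: "s \<in> S" using assms(2) by auto
  ultimately have "x - w - (s - w) \<in> B"
    using assms(3)[OF s] by (simp only: elt_set_plus_iff add_subgroupD(2)[OF assms(1)])
  then have "x = s + (x - s)" "x - s \<in> B" by simp_all
  then show "x \<in> S + B" using s by (metis set_plus_intro)
qed

lemma self_in_coset: "add_subgroup B \<Longrightarrow> w \<in> w +o B"
  by (simp add: elt_set_plus_iff add_subgroupD)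

section \<open>Cochains\<close>

lemma restr_apply: "restr X f xs = (if set xs \<subseteq> X then f xs else 0)"
  by (simp add: restr_def)

lemma restr_linear:
  "restr X (f + h) = restr X f + restr X h" "restr X (f - h) = restr X f - restr X h"
  "restr X (- f) = - restr X f" "restr X 0 = 0" "restr X (scal c f) = scal c (restr X f)"
  for f h :: "'g list \<Rightarrow> 'k::comm_ring_1"
  by (auto simp: restr_def fun_eq_iff)

lemma face_sum_restr:
  assumes "set xs \<subseteq> X"
  shows "face_sum (restr X f) xs = face_sum f xs"
  using assms by (intro face_sum_cong) (auto simp: restr_apply)

lemma cobd_restr: "M \<subseteq> X \<Longrightarrow> restr M (cobd X f) = cobd M (restr M f)"
  by (auto simp: fun_eq_iff cobd_face_sum restr_apply face_sum_restr)

lemma cobd_linear: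
  fixes f h :: "'g list \<Rightarrow> 'k::comm_ring_1"
  shows "cobd X (f + h) = cobd X f + cobd X h" "cobd X (f - h) = cobd X f - cobd X h"
    "cobd X (- f) = - cobd X f" "cobd X (0 :: 'g list \<Rightarrow> 'k) = 0"
    "cobd X (scal c f) = scal c (cobd X f)"
proof -
  have add: "cobd X (f + h) = cobd X f + cobd X h" for f h :: "'g list \<Rightarrow> 'k"
    by (simp add: cobd_face_sum fun_eq_iff restr_apply face_sum_add plus_fun_def)
  have scal: "cobd X (scal c f) = scal c (cobd X f)" for c and f :: "'g list \<Rightarrow> 'k"
    by (simp add: cobd_face_sum fun_eq_iff restr_apply face_sum_mult scal_def)
  have minus: "cobd X (- f) = - cobd X f" for f :: "'g list \<Rightarrow> 'k" using scal[of "-1" f] by simp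
  show "cobd X (f + h) = cobd X f + cobd X h" "cobd X (scal c f) = scal c (cobd X f)"
    "cobd X (- f) = - cobd X f" by (fact add scal minus)+
  show "cobd X (0 :: 'g list \<Rightarrow> 'k) = 0" using scal[of 0 0] by simp
  show "cobd X (f - h) = cobd X f - cobd X h" using add[of f "- h"] by (simp add: minus)
qed

lemma cobd_sum: "cobd X (sum F A) = (\<Sum>i\<in>A. cobd X (F i))"
  by (induction A rule: infinite_finite_induct)
     (simp_all only: sum.infinite sum.empty sum.insert not_False_eq_True cobd_linear)

lemma cobd_cobd: "cobd X (cobd X f) = 0"
proof
  fix xs
  show "cobd X (cobd X f) xs = 0 xs"
    by (cases "set xs \<subseteq> X")
       (simp_all add: cobd_face_sum[of X "cobd X f"] restr_apply cobd_face_sum face_sum_restr face_sum_face_sum)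
qed

lemma cochainsI:
  assumes "\<And>xs. f xs \<noteq> 0 \<Longrightarrow> length xs = Suc s" "\<And>xs. f xs \<noteq> 0 \<Longrightarrow> set xs \<subseteq> X"
    and "\<And>m xs. m \<in> M \<Longrightarrow> set xs \<subseteq> X \<Longrightarrow> f (map (\<lambda>x. m \<otimes>\<^bsub>G\<^esub> x) xs) = f xs"
  shows "f \<in> cochains G M X s"
  using assms by (auto simp: cochains_def)

lemma cochainsD:
  assumes "f \<in> cochains G M X s"
  shows "length xs \<noteq> Suc s \<Longrightarrow> f xs = 0" "\<not> set xs \<subseteq> X \<Longrightarrow> f xs = 0"
    "m \<in> M \<Longrightarrow> set xs \<subseteq> X \<Longrightarrow> f (map (\<lambda>x. m \<otimes>\<^bsub>G\<^esub> x) xs) = f xs"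
  using assms unfolding cochains_def by blast+

lemma cochains_zero [simp]: "0 \<in> cochains G M X s"
  by (simp add: cochains_def)

lemma cochains_add: "f \<in> cochains G M X s \<Longrightarrow> h \<in> cochains G M X s \<Longrightarrow> f + h \<in> cochains G M X s"
  for f :: "_ \<Rightarrow> 'k::comm_ring_1"
  by (rule cochainsI) (use cochainsD[of f G M X s] cochainsD[of h G M X s] in \<open>force+\<close>)

lemma cochains_scal: "f \<in> cochains G M X s \<Longrightarrow> scal c f \<in> cochains G M X s"
  by (rule cochainsI) (use cochainsD[of f G M X s] in \<open>force+\<close>)

lemma cochains_minus: "f \<in> cochains G M X s \<Longrightarrow> - f \<in> cochains G M X s"
  for f :: "_ \<Rightarrow> 'k::comm_ring_1"
  using cochains_scal[of f G M X s "-1"] by simp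

lemma cochains_diff: "f \<in> cochains G M X s \<Longrightarrow> h \<in> cochains G M X s \<Longrightarrow> f - h \<in> cochains G M X s"
  for f :: "_ \<Rightarrow> 'k::comm_ring_1"
  using cochains_add[of f G M X s "- h"] by (simp add: cochains_minus)

lemma cochains_sum: "(\<And>i. i \<in> A \<Longrightarrow> F i \<in> cochains G M X s) \<Longrightarrow> sum F A \<in> cochains G M X s"
  for F :: "_ \<Rightarrow> _ \<Rightarrow> 'k::comm_ring_1"
  by (induction A rule: infinite_finite_induct) (simp_all add: cochains_add)

lemmas cochains_intros = cochains_zero cochains_add cochains_minus cochains_diff cochains_scal cochains_sum

lemma cobd_cochains:
  assumes "\<And>m x. m \<in> M \<Longrightarrow> x \<in> X \<Longrightarrow> m \<otimes>\<^bsub>G\<^esub> x \<in> X" and f: "f \<in> cochains G M X s"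
  shows "cobd X f \<in> cochains G M X (Suc s)"
proof (rule cochainsI)
  fix xs assume nz: "cobd X f xs \<noteq> 0"
  then show "set xs \<subseteq> X" by (auto simp: cobd_face_sum restr_apply split: if_splits)
  show "length xs = Suc (Suc s)"
  proof (rule ccontr)
    assume "length xs \<noteq> Suc (Suc s)"
    then have "face_sum f xs = face_sum (\<lambda>xs. 0 * f xs) xs"
      by (intro face_sum_cong) (simp add: cochainsD(1)[OF f])
    then show False
      using nz unfolding face_sum_mult by (auto simp: cobd_face_sum restr_apply split: if_splits)
  qed
next
  fix m xs assume m: "m \<in> M" and xs: "set xs \<subseteq> X"
  have "face_sum f (map (\<lambda>x. m \<otimes>\<^bsub>G\<^esub> x) xs) = face_sum f xs"
    unfolding face_sum_map[symmetric]
    by (rule face_sum_cong) (use m xs cochainsD(3)[OF f] in blast)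
  then show "cobd X f (map (\<lambda>x. m \<otimes>\<^bsub>G\<^esub> x) xs) = cobd X f xs"
    using m xs assms(1) by (auto simp: cobd_face_sum restr_apply)
qed

section \<open>Cup products of cochains\<close>

lemma cup_cochains:
  assumes f: "f \<in> cochains G M X s" and f': "f' \<in> cochains G M X s'"
  shows "cup s f f' \<in> cochains G M X (s + s')"
proof (rule cochainsI)
  fix xs assume nz: "cup s f f' xs \<noteq> 0"
  then have "f (take (Suc s) xs) \<noteq> 0" "f' (drop s xs) \<noteq> 0"
    by (auto simp: cup_def)
  then have *: "length (take (Suc s) xs) = Suc s" "length (drop s xs) = Suc s'"
    "set (take (Suc s) xs) \<subseteq> X" "set (drop s xs) \<subseteq> X"
    using cochainsD(1,2)[OF f] cochainsD(1,2)[OF f'] by blast+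
  then show "length xs = Suc (s + s')" by auto
  have "set xs \<subseteq> set (take (Suc s) xs) \<union> set (drop s xs)"
    by (metis Un_mono append_take_drop_id set_append set_take_subset_set_take lessI less_or_eq_imp_le subset_refl)
  then show "set xs \<subseteq> X" using * by blast
next
  fix m xs assume "m \<in> M" "set xs \<subseteq> X"
  then show "cup s f f' (map (\<lambda>x. m \<otimes>\<^bsub>G\<^esub> x) xs) = cup s f f' xs"
    using cochainsD(3)[OF f, of m "take (Suc s) xs"] cochainsD(3)[OF f', of m "drop s xs"]
    by (simp add: cup_def take_map drop_map set_take_subset set_drop_subset subset_trans)
       (metis set_take_subset set_drop_subset subset_trans)
qed

lemma cup_linear:
  "cup s (f + h) f' = cup s f f' + cup s h f'" "cup s (f - h) f' = cup s f f' - cup s h f'"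
  "cup s (- f) f' = - cup s f f'" "cup s 0 f' = 0" "cup s (scal c f) f' = scal c (cup s f f')"
  "cup s f (f' + h') = cup s f f' + cup s f h'" "cup s f (f' - h') = cup s f f' - cup s f h'"
  "cup s f (- f') = - cup s f f'" "cup s f 0 = 0" "cup s f (scal c f') = scal c (cup s f f')"
  by (simp_all add: cup_def fun_eq_iff algebra_simps)

lemma cup_sum_right: "cup s f (sum F A) = (\<Sum>i\<in>A. cup s f (F i))"
  by (simp add: cup_def fun_eq_iff sum_fun_apply sum_distrib_left)

lemma cup_assoc: "cup (s + s') (cup s f f') f'' = cup s f (cup s' f' f'')"
proof
  fix xs :: "'a list"
  have "drop s (take (Suc (s + s')) xs) = take (Suc s') (drop s xs)"
    by (simp add: drop_take)
  then show "cup (s + s') (cup s f f') f'' xs = cup s f (cup s' f' f'') xs"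
    by (simp add: cup_def min_def mult.assoc add.commute)
qed

text \<open>On tuples over \<open>X\<close> of the right length this is \<open>face_sum_cup\<close>.
  Elsewhere both sides vanish, being cochains of the same degree.\<close>

lemma cobd_cup:
  assumes st: "\<And>m x. m \<in> M \<Longrightarrow> x \<in> X \<Longrightarrow> m \<otimes>\<^bsub>G\<^esub> x \<in> X"
    and f: "f \<in> cochains G M X s" and f': "f' \<in> cochains G M X s'"
  shows "cobd X (cup s f f') = cup (Suc s) (cobd X f) f' + scal ((-1) ^ s) (cup s f (cobd X f'))"
    (is "?l = ?r")
proof
  have l: "?l \<in> cochains G M X (Suc (s + s'))"
    by (intro cobd_cochains cup_cochains assms)
  have r: "?r \<in> cochains G M X (Suc (s + s'))"
    using cup_cochains[OF cobd_cochains[OF st f] f'] cup_cochains[OF f cobd_cochains[OF st f']]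
    by (intro cochains_intros) simp_all
  fix xs
  show "?l xs = ?r xs"
  proof (cases "set xs \<subseteq> X \<and> length xs = Suc (Suc (s + s'))")
    case True
    moreover from this have "set (take (Suc (Suc s)) xs) \<subseteq> X" "set (drop s xs) \<subseteq> X"
      by (meson order_trans set_take_subset set_drop_subset)+
    ultimately show ?thesis
      using face_sum_cup[of s xs f f'] by (simp add: cobd_face_sum restr_apply cup_def)
  next
    case False
    then show ?thesis using cochainsD(1,2)[OF l] cochainsD(1,2)[OF r] by metis
  qed
qed

text \<open>The unit of the cup product. For \<open>X = M\<close> its class is
  \<open>cohom_one\<close>.\<close>

definition unit_cochain :: "'g set \<Rightarrow> 'g list \<Rightarrow> 'k::comm_ring_1" where
  "unit_cochain X = restr X (\<lambda>xs. if length xs = Suc 0 then 1 else 0)"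

lemma unit_cochain_cochains:
  assumes "\<And>m x. m \<in> M \<Longrightarrow> x \<in> X \<Longrightarrow> m \<otimes>\<^bsub>G\<^esub> x \<in> X"
  shows "unit_cochain X \<in> cochains G M X 0"
  by (rule cochainsI) (use assms in \<open>auto simp: unit_cochain_def restr_apply split: if_splits\<close>)

lemma cobd_unit_cochain: "cobd X (unit_cochain X :: 'g list \<Rightarrow> 'k::comm_ring_1) = 0"
proof
  fix xs :: "'g list"
  have "face_sum (\<lambda>xs. if length xs = Suc 0 then 1 else 0 :: 'k) xs = 0"
    \<comment> \<open>The rule splits by length 0, 1 or at least 2. Only lists of length 2 have
      faces of length 1, and their two faces cancel.\<close>
    by (cases xs rule: remdups_adj.cases) (simp_all add: face_sum_def)
  then show "cobd X (unit_cochain X) xs = (0 :: 'g list \<Rightarrow> 'k) xs"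
    by (simp add: unit_cochain_def cobd_face_sum restr_apply face_sum_restr)
qed

lemma cup_unit_left:
  assumes "f \<in> cochains G M X s"
  shows "cup 0 (unit_cochain X) f = f"
proof
  fix xs
  show "cup 0 (unit_cochain X) f xs = f xs"
    using cochainsD(1,2)[OF assms, of xs]
    by (cases xs) (auto simp: cup_def unit_cochain_def restr_apply)
qed

lemma cup_unit_right:
  assumes "f \<in> cochains G M X s"
  shows "cup s f (unit_cochain X) = f"
proof
  fix xs
  show "cup s f (unit_cochain X) xs = f xs"
  proof (cases "set xs \<subseteq> X \<and> length xs = Suc s")
    case True
    then show ?thesis
      using set_drop_subset[of s xs] by (auto simp: cup_def unit_cochain_def restr_apply)
  next
    case False
    then show ?thesis
      using cochainsD(1,2)[OF assms, of xs] cochainsD(1,2)[OF cup_cochains[OF assms], of _ 0 xs]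
      by (auto simp: cup_def unit_cochain_def restr_apply)
  qed
qed

section \<open>Cup products modulo coboundaries\<close>

lemma coboundaries_add_subgroup:
  "add_subgroup (coboundaries G M X s :: ('g list \<Rightarrow> 'k::comm_ring_1) set)"
proof (cases s)
  case (Suc t)
  show ?thesis
    unfolding add_subgroup_def
  proof (intro conjI ballI)
    show "(0 :: 'g list \<Rightarrow> 'k) \<in> coboundaries G M X s"
      unfolding Suc coboundaries.simps by (rule image_eqI[of _ _ 0]) (simp_all add: cobd_linear)
  next
    fix a b :: "'g list \<Rightarrow> 'k"
    assume "a \<in> coboundaries G M X s" "b \<in> coboundaries G M X s"
    then obtain a' b' where "a = cobd X a'" "b = cobd X b'" "a' \<in> cochains G M X t" "b' \<in> cochains G M X t"
      by (auto simp: Suc)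
    then show "a - b \<in> coboundaries G M X s"
      unfolding Suc coboundaries.simps
      by (intro image_eqI[of _ _ "a' - b'"]) (simp_all add: cobd_linear cochains_diff)
  qed
qed (simp add: add_subgroup_def)

lemmas coboundaries_closed = add_subgroupD[OF coboundaries_add_subgroup]

lemma coboundaries_scal: "f \<in> coboundaries G M X s \<Longrightarrow> scal c f \<in> coboundaries G M X s"
proof (cases s)
  case (Suc t)
  assume "f \<in> coboundaries G M X s"
  then obtain h where "f = cobd X h" "h \<in> cochains G M X t" by (auto simp: Suc)
  then show ?thesis
    unfolding Suc coboundaries.simps
    by (intro image_eqI[of _ _ "scal c h"]) (simp_all add: cobd_linear cochains_scal)
qed simp

text \<open>If \<open>b\<close> is the coboundary of \<open>c\<close>, the Leibniz rule and
  \<open>cobd X f = 0\<close> make \<open>cup s b f\<close> the coboundary of the product of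
  \<open>c\<close> and \<open>f\<close>.\<close>

lemma cup_coboundary_left:
  assumes st: "\<And>m x. m \<in> M \<Longrightarrow> x \<in> X \<Longrightarrow> m \<otimes>\<^bsub>G\<^esub> x \<in> X"
    and b: "b \<in> coboundaries G M X s" and f: "f \<in> cocycles G M X s'"
  shows "cup s b f \<in> coboundaries G M X (s + s')"
proof (cases s)
  case 0
  then show ?thesis using b by (simp add: cup_linear coboundaries_closed)
next
  case (Suc t)
  then obtain c where c: "b = cobd X c" "c \<in> cochains G M X t" using b by auto
  have "cup s b f = cobd X (cup t c f)"
    using f c Suc by (subst cobd_cup[where G = G and M = M and s' = s'])
      (simp_all add: st cocycles_def cup_linear)
  then show ?thesis
    using cup_cochains[OF c(2), of f s'] f by (auto simp: Suc cocycles_def)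
qed

text \<open>Here the Leibniz rule produces a sign \<open>(-1) ^ s\<close>, which is removed by
  writing 1 as its square.\<close>

lemma cup_coboundary_right:
  assumes st: "\<And>m x. m \<in> M \<Longrightarrow> x \<in> X \<Longrightarrow> m \<otimes>\<^bsub>G\<^esub> x \<in> X"
    and b: "b \<in> coboundaries G M X s'" and f: "f \<in> cocycles G M X s"
  shows "cup s f b \<in> coboundaries G M X (s + s')"
proof (cases s')
  case 0
  then show ?thesis using b by (simp add: cup_linear coboundaries_closed)
next
  case (Suc t)
  then obtain c where c: "b = cobd X c" "c \<in> cochains G M X t" using b by auto
  have "cup s f b = scal ((-1) ^ s * (-1) ^ s) (cup s f b)"
    by (simp flip: power_mult_distrib)
  also have "\<dots> = scal ((-1) ^ s) (cobd X (cup s f c))"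
    using f c Suc by (subst cobd_cup[where G = G and M = M and s' = t])
      (simp_all add: st cocycles_def cup_linear)
  finally show ?thesis
    using coboundaries_scal[of "cobd X (cup s f c)" G M X "Suc (s + t)"] cup_cochains[OF _ c(2), of f s] f
    by (simp add: Suc cocycles_def)
qed

text \<open>Well-definedness of the product on classes: expand in the deviations
  \<open>a - f\<close> and \<open>a' - f'\<close>. Each of the three error terms has a coboundary as
  one factor and a cocycle as the other.\<close>

lemma cup_coset_diff:
  assumes st: "\<And>m x. m \<in> M \<Longrightarrow> x \<in> X \<Longrightarrow> m \<otimes>\<^bsub>G\<^esub> x \<in> X"
    and f: "f \<in> cocycles G M X s" and f': "f' \<in> cocycles G M X s'"
    and a: "a \<in> f +o coboundaries G M X s" and a': "a' \<in> f' +o coboundaries G M X s'"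
  shows "cup s a a' - cup s f f' \<in> coboundaries G M X (s + s')"
proof -
  have b: "a - f \<in> coboundaries G M X s" "a' - f' \<in> coboundaries G M X s'"
    using a a' by (simp_all only: elt_set_plus_iff)
  have "cup s (a - f) (a' - f') \<in> coboundaries G M X (s + s')"
  proof (cases s')
    case 0
    then show ?thesis using b by (simp add: cup_linear coboundaries_closed)
  next
    case (Suc t)
    then obtain c where "a' - f' = cobd X c" "c \<in> cochains G M X t" using b by auto
    then have "a' - f' \<in> cocycles G M X s'"
      using Suc cobd_cochains[of M X G c t] st by (simp add: cocycles_def cobd_cobd)
    then show ?thesis by (intro cup_coboundary_left st b)
  qed
  moreover have "cup s (a - f) f' \<in> coboundaries G M X (s + s')"
    "cup s f (a' - f') \<in> coboundaries G M X (s + s')"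
    using cup_coboundary_left[OF st b(1) f'] cup_coboundary_right[OF st b(2) f] by blast+
  moreover have "cup s a a' - cup s f f' = cup s (a - f) (a' - f') + cup s (a - f) f' + cup s f (a' - f')"
    by (simp add: cup_linear algebra_simps)
  ultimately show ?thesis by (simp only: coboundaries_closed(4))
qed

lemma cohom_cup_coset:
  assumes st: "\<And>m x. m \<in> M \<Longrightarrow> x \<in> M \<Longrightarrow> m \<otimes>\<^bsub>G\<^esub> x \<in> M"
    and f: "f \<in> cocycles G M M s" and f': "f' \<in> cocycles G M M s'"
  shows "cohom_cup G M s s' (f +o coboundaries G M M s) (f' +o coboundaries G M M s') =
    cup s f f' +o coboundaries G M M (s + s')"
  unfolding cohom_cup_def
  using self_in_coset[OF coboundaries_add_subgroup] cup_coset_diff[OF st f f']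
  by (intro coset_plus_subgroup coboundaries_add_subgroup) blast+

text \<open>Both products in the theorem have a factor of even horizontal degree, where the product
  of classes is the cup product up to sign.\<close>

lemma E2_cup_coset:
  assumes st: "\<And>m x. m \<in> M \<Longrightarrow> x \<in> M \<Longrightarrow> m \<otimes>\<^bsub>G\<^esub> x \<in> M"
    and f: "f \<in> cocycles G M M s" and f': "f' \<in> cocycles G M M s'" and ev: "even r \<or> even r'"
  shows "E2_cup G M g r s r' s' (f +o coboundaries G M M s) (f' +o coboundaries G M M s') =
    scal ((-1) ^ (r' * s)) (cup s f f') +o coboundaries G M M (s + s')"
proof -
  have eq: "E2_cup G M g r s r' s' u v =
      {scal ((-1) ^ (r' * s)) (cup s f f') | f f'. f \<in> u \<and> f' \<in> v} + coboundaries G M M (s + s')"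
    for u v :: "('a list \<Rightarrow> 'c) set"
    using ev by (simp add: E2_cup_def scal_def)
  show ?thesis
    unfolding eq
  proof (intro coset_plus_subgroup coboundaries_add_subgroup)
    show "{scal ((-1) ^ (r' * s)) (cup s fa f'a) |fa f'a. fa \<in> f +o coboundaries G M M s \<and>
        f'a \<in> f' +o coboundaries G M M s'} \<noteq> {}"
      using self_in_coset[OF coboundaries_add_subgroup] by blast
  qed (use cup_coset_diff[OF st f f'] in
      \<open>auto simp flip: scal_right_diff intro!: coboundaries_scal\<close>)
qed

lemma restr_cup: "restr M (cup s f f') = cup s (restr M f) (restr M f')"
proof
  fix xs :: "'a list"
  have "set xs \<subseteq> set (take (Suc s) xs) \<union> set (drop s xs)"
    by (metis Un_mono append_take_drop_id set_append set_take_subset_set_take lessI less_or_eq_imp_le subset_refl)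
  then have "set xs \<subseteq> M \<longleftrightarrow> set (take (Suc s) xs) \<subseteq> M \<and> set (drop s xs) \<subseteq> M"
    using set_take_subset[of "Suc s" xs] set_drop_subset[of s xs] by blast
  then show "restr M (cup s f f') xs = cup s (restr M f) (restr M f') xs"
    by (auto simp: restr_apply cup_def)
qed

section \<open>The group action on cochains\<close>

lemma act_linear:
  fixes f f' :: "'g list \<Rightarrow> 'k::comm_ring_1"
  shows "act G h (f + f') = act G h f + act G h f'" "act G h (f - f') = act G h f - act G h f'"
    "act G h (- f) = - act G h f" "act G h (0 :: 'g list \<Rightarrow> 'k) = 0"
    "act G h (scal c f) = scal c (act G h f)"
  by (simp_all add: act_def fun_eq_iff restr_apply)

lemma act_sum: "act G h (\<Sum>i\<in>A. F i) = (\<Sum>i\<in>A. act G h (F i))"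
  for F :: "'i \<Rightarrow> 'g list \<Rightarrow> 'k::comm_ring_1"
  by (simp add: act_def fun_eq_iff restr_apply sum_fun_apply)

lemma act_cup: "act G h (cup s f f') = cup s (act G h f) (act G h f')"
proof -
  let ?\<phi> = "map (\<lambda>x. inv\<^bsub>G\<^esub> h \<otimes>\<^bsub>G\<^esub> x)"
  have "(\<lambda>xs. cup s f f' (?\<phi> xs)) = cup s (\<lambda>xs. f (?\<phi> xs)) (\<lambda>xs. f' (?\<phi> xs))"
    by (simp add: cup_def take_map drop_map)
  then show ?thesis by (simp add: act_def restr_cup)
qed

section \<open>The Lyndon-Hochschild-Serre spectral sequence\<close>

text \<open>Products with \<open>x \<in> E\<^sub>2\<^bsup>0,1\<^esup>\<close> and with \<open>\<gamma>\<^sub>2 \<in> E\<^sub>2\<^bsup>2,0\<^esup>\<close> lift to the total complex.\<close>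
definition cup_tot :: "('g list \<Rightarrow> 'k::comm_ring_1) \<Rightarrow> (nat \<Rightarrow> 'g list \<Rightarrow> 'k) \<Rightarrow> nat \<Rightarrow> 'g list \<Rightarrow> 'k" where
  "cup_tot x w = (\<lambda>r. scal ((-1) ^ r) (cup 1 x (w r)))"

fun shift2 :: "(nat \<Rightarrow> 'a::zero) \<Rightarrow> nat \<Rightarrow> 'a" where
  "shift2 w 0 = 0"
| "shift2 w (Suc 0) = 0"
| "shift2 w (Suc (Suc r)) = w r"

text \<open>By \<open>g_pow\<close>, the power \<open>order (G Mod M)\<close> of \<open>g\<close>
  acts trivially on \<open>M\<close>-invariant cochains, so that the differences and norms in
  \<open>hdiff\<close> compose to zero.\<close>

locale cyclic_extension = group G for G (structure) +
  fixes M g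
  assumes normal: "M \<lhd> G" and g: "g \<in> carrier G" and g_pow: "g [^] order (G Mod M) \<in> M"
begin

abbreviation "Co \<equiv> cochains G M (carrier G)"
abbreviation "\<delta> \<equiv> cobd (carrier G)"
abbreviation "D \<equiv> tdiff G M g"

lemma subgroup_M: "subgroup M G"
  by (rule normal_imp_subgroup[OF normal])

lemma M_carrier: "m \<in> M \<Longrightarrow> m \<in> carrier G"
  by (rule subgroup.mem_carrier[OF subgroup_M])

lemma M_subset: "M \<subseteq> carrier G"
  using M_carrier by blast

lemma M_closed: "m \<in> M \<Longrightarrow> x \<in> M \<Longrightarrow> m \<otimes> x \<in> M" "m \<in> M \<Longrightarrow> inv m \<in> M" "\<one> \<in> M"
  by (simp_all add: subgroup.m_closed[OF subgroup_M] subgroup.m_inv_closed[OF subgroup_M]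
      subgroup.one_closed[OF subgroup_M])

lemma stable: "m \<in> M \<Longrightarrow> x \<in> carrier G \<Longrightarrow> m \<otimes> x \<in> carrier G"
  using M_carrier by simp

lemma restr_cochains:
  assumes f: "f \<in> Co s"
  shows "restr M f \<in> cochains G M M s"
proof (rule cochainsI)
  fix m xs assume "m \<in> M" "set xs \<subseteq> M"
  then show "restr M f (map (\<lambda>x. m \<otimes> x) xs) = restr M f xs"
    using M_closed(1) M_subset cochainsD(3)[OF f, of m xs] by (auto simp: restr_apply)
qed (use cochainsD(1)[OF f] in \<open>auto simp: restr_apply split: if_splits\<close>)

lemma restr_coboundaries:
  assumes "f \<in> coboundaries G M (carrier G) s"
  shows "restr M f \<in> coboundaries G M M s"
  using assms by (cases s) (auto simp: restr_linear cobd_restr[OF M_subset] intro!: imageI restr_cochains)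

lemma restr_cocycles: "f \<in> Co s \<Longrightarrow> \<delta> f = 0 \<Longrightarrow> restr M f \<in> cocycles G M M s"
  by (simp add: cocycles_def restr_cochains cobd_restr[OF M_subset, symmetric] restr_linear)

lemma coboundary_Co: "f \<in> Co s \<Longrightarrow> \<delta> f \<in> Co (Suc s)"
  by (rule cobd_cochains[OF stable])

lemma act_act:
  assumes "h \<in> carrier G" "k \<in> carrier G"
  shows "act G h (act G k f) = act G (h \<otimes> k) f"
proof
  fix xs
  have "f (map (\<lambda>x. inv k \<otimes> (inv h \<otimes> x)) xs) = f (map (\<lambda>x. inv (h \<otimes> k) \<otimes> x) xs)"
    if "set xs \<subseteq> carrier G"
    using assms that by (intro arg_cong[of _ _ f]) (auto simp: inv_mult_group m_assoc)
  then show "act G h (act G k f) xs = act G (h \<otimes> k) f xs"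
    using assms by (auto simp: act_def restr_apply image_subset_iff comp_def)
qed

lemma act_M: "h \<in> M \<Longrightarrow> f \<in> Co s \<Longrightarrow> act G h f = f"
  using cochainsD(2,3)[of f G M "carrier G" s] M_closed(2)[of h]
  by (auto simp: act_def fun_eq_iff restr_apply)

text \<open>Normality of \<open>M\<close> preserves invariance: \<open>inv h \<otimes> m\<close>
  equals \<open>(inv h \<otimes> m \<otimes> h) \<otimes> inv h\<close>, whose bracket lies in
  \<open>M\<close>.\<close>

lemma act_Co:
  assumes h: "h \<in> carrier G" and f: "f \<in> Co s"
  shows "act G h f \<in> Co s"
proof (rule cochainsI)
  fix m xs assume m: "m \<in> M" and xs: "set xs \<subseteq> carrier G"
  have m': "inv h \<otimes> m \<otimes> h \<in> M"
    using normal.inv_op_closed1[OF normal h m] .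
  have "inv h \<otimes> (m \<otimes> x) = (inv h \<otimes> m \<otimes> h) \<otimes> (inv h \<otimes> x)" if "x \<in> set xs" for x
  proof -
    have c: "x \<in> carrier G" "m \<in> carrier G" using xs m that M_carrier by auto
    then have "(inv h \<otimes> m \<otimes> h) \<otimes> (inv h \<otimes> x) = inv h \<otimes> m \<otimes> (h \<otimes> (inv h \<otimes> x))"
      using h by (simp add: m_assoc)
    also have "h \<otimes> (inv h \<otimes> x) = x" using h c by (simp flip: m_assoc)
    finally show ?thesis using h c by (simp add: m_assoc)
  qed
  then have "f (map (\<lambda>x. inv h \<otimes> (m \<otimes> x)) xs) =
      f (map (\<lambda>x. (inv h \<otimes> m \<otimes> h) \<otimes> x) (map (\<lambda>x. inv h \<otimes> x) xs))"
    by (intro arg_cong[of _ _ f]) simp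
  also have "\<dots> = f (map (\<lambda>x. inv h \<otimes> x) xs)"
    using m' xs h by (intro cochainsD(3)[OF f]) auto
  finally show "act G h f (map (\<lambda>x. m \<otimes> x) xs) = act G h f xs"
    using m xs M_carrier by (auto simp: act_def restr_apply comp_def)
next
  fix xs assume "act G h f xs \<noteq> 0"
  then have *: "f (map (\<lambda>x. inv h \<otimes> x) xs) \<noteq> 0" "set xs \<subseteq> carrier G"
    by (auto simp: act_def restr_apply split: if_splits)
  then show "set xs \<subseteq> carrier G" "length xs = Suc s"
    using cochainsD(1)[OF f, of "map (\<lambda>x. inv h \<otimes> x) xs"] by auto
qed

lemma act_cobd: "h \<in> carrier G \<Longrightarrow> act G h (\<delta> f) = \<delta> (act G h f)"
proof
  fix xs assume h: "h \<in> carrier G"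
  then show "act G h (\<delta> f) xs = \<delta> (act G h f) xs"
    by (auto simp: act_def cobd_face_sum restr_apply face_sum_restr image_subset_iff face_sum_map)
qed

lemma act_pow_Suc: "act G g (act G (g [^] (i::nat)) f) = act G (g [^] Suc i) f"
  by (simp only: act_act[OF g nat_pow_closed[OF g]] nat_pow_Suc2[OF g])

lemma act_pow_fixed:
  assumes "act G g f = f" "f \<in> Co s"
  shows "act G (g [^] (i::nat)) f = f"
proof (induction i)
  case 0
  then show ?case using act_M[OF M_closed(3) assms(2)] by simp
next
  case (Suc i)
  then show ?case using assms(1) by (metis act_pow_Suc)
qed

lemma hdiff_linear:
  fixes f f' :: "'a list \<Rightarrow> 'k::comm_ring_1"
  shows "hdiff G M g r (f + f') = hdiff G M g r f + hdiff G M g r f'"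
    "hdiff G M g r (f - f') = hdiff G M g r f - hdiff G M g r f'"
    "hdiff G M g r (- f) = - hdiff G M g r f" "hdiff G M g r (0 :: 'a list \<Rightarrow> 'k) = 0"
    "hdiff G M g r (scal c f) = scal c (hdiff G M g r f)"
  by (simp_all add: hdiff_def act_linear scal_right_diff scal_sum sum.distrib sum_subtractf sum_negf)

lemma hdiff_Co: "f \<in> Co s \<Longrightarrow> hdiff G M g r f \<in> Co s"
  by (simp add: hdiff_def cochains_diff cochains_sum act_Co g)

lemma hdiff_cobd: "hdiff G M g r (\<delta> f) = \<delta> (hdiff G M g r f)"
  by (simp add: hdiff_def act_cobd g cobd_linear cobd_sum)

text \<open>In either order, the composite of \<sigma> - 1 and the norm telescopes to a difference
  of translates of \<open>f\<close> by two elements of \<open>M\<close>, a power of \<open>g\<close>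
  and \<open>\<one>\<close>.\<close>

lemma hdiff_hdiff:
  assumes "f \<in> Co s"
  shows "hdiff G M g (Suc r) (hdiff G M g r f) = 0"
proof -
  have pow: "act G (g [^] i) (act G g f) = act G (g [^] Suc i) f" for i :: nat
    by (simp add: act_act g)
  have "(\<Sum>i<order (G Mod M). act G (g [^] Suc i) f - act G (g [^] i) f) = 0"
    by (subst sum_lessThan_telescope) (use act_M[OF g_pow assms] act_M[OF M_closed(3) assms] in simp)
  then show ?thesis
    unfolding hdiff_def
    by (simp add: act_linear act_sum pow act_pow_Suc sum_subtractf del: nat_pow_Suc)
qed

section \<open>The total differential and its filtration\<close>

lemma D_0: "D w 0 = \<delta> (w 0)"
  and D_Suc: "D w (Suc t) = hdiff G M g t (w t) + scal ((-1) ^ Suc t) (\<delta> (w (Suc t)))"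
  by (simp_all add: tdiff_def fun_eq_iff)

lemma D_linear:
  fixes w w' :: "nat \<Rightarrow> 'a list \<Rightarrow> 'k::comm_ring_1"
  shows "D (w + w') = D w + D w'" "D (w - w') = D w - D w'" "D (- w) = - D w"
    "D (0 :: nat \<Rightarrow> 'a list \<Rightarrow> 'k) = 0" "D (\<lambda>r. scal c (w r)) = (\<lambda>r. scal c (D w r))"
proof -
  have *: "P = Q" if "P 0 = Q 0" "\<And>t. P (Suc t) = Q (Suc t)" for P Q :: "nat \<Rightarrow> 'a list \<Rightarrow> 'k"
    using that by (metis ext not0_implies_Suc)
  show "D (w + w') = D w + D w'" "D (w - w') = D w - D w'" "D (- w) = - D w"
    "D (0 :: nat \<Rightarrow> 'a list \<Rightarrow> 'k) = 0" "D (\<lambda>r. scal c (w r)) = (\<lambda>r. scal c (D w r))"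
    by (rule *; simp add: D_0 D_Suc cobd_linear hdiff_linear scal_right_distrib scal_right_diff mult.commute)+
qed

lemma D_tot: "w \<in> tot G M k \<Longrightarrow> D w \<in> tot G M (Suc k)"
  unfolding tot_def
proof (intro CollectI conjI allI impI)
  assume w: "w \<in> {w. (\<forall>r\<le>k. w r \<in> Co (k - r)) \<and> (\<forall>r>k. w r = 0)}"
  have \<delta>: "\<delta> (w r) \<in> Co (Suc k - r)" for r
  proof (cases "r \<le> k")
    case True
    then show ?thesis using w coboundary_Co[of "w r" "k - r"] by (simp add: Suc_diff_le)
  qed (use w in \<open>simp add: cobd_linear\<close>)
  fix r
  {
    assume "r \<le> Suc k"
    then show "D w r \<in> Co (Suc k - r)"
      using w \<delta>[of r] by (cases r) (auto simp: D_0 D_Suc intro!: cochains_intros hdiff_Co)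
  next
    assume "r > Suc k"
    then show "D w r = 0"
      using w by (cases r) (auto simp: D_Suc hdiff_linear cobd_linear)
  }
qed

text \<open>\<open>hdiff\<close> and \<open>\<delta>\<close> commute and each squares to zero; the
  column sign in \<open>tdiff\<close> cancels the mixed terms.\<close>

lemma D_D:
  assumes "w \<in> tot G M k"
  shows "D (D w) = 0"
proof
  fix r
  have w: "\<exists>s. w t \<in> Co s" for t
    using assms cochains_zero by (cases "t \<le> k") (auto simp: tot_def)
  show "D (D w) r = 0 r"
  proof (cases r)
    case (Suc t)
    show ?thesis
    proof (cases t)
      case (Suc t')
      then show ?thesis
        using hdiff_hdiff w[of t'] \<open>r = Suc t\<close>
        by (auto simp: D_Suc hdiff_linear hdiff_cobd cobd_linear cobd_cobd)
    qed (simp add: Suc D_0 D_Suc hdiff_linear hdiff_cobd cobd_linear cobd_cobd)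
  qed (simp add: D_0 cobd_cobd)
qed

lemma tot_linear:
  "0 \<in> tot G M k" "w \<in> tot G M k \<Longrightarrow> w' \<in> tot G M k \<Longrightarrow> w - w' \<in> tot G M k"
  "w \<in> tot G M k \<Longrightarrow> (\<lambda>r. scal c (w r)) \<in> tot G M k"
  by (auto simp: tot_def intro!: cochains_intros)

lemma filt_linear:
  "0 \<in> filt_cocycles G M g a b k"
  "w \<in> filt_cocycles G M g a b k \<Longrightarrow> w' \<in> filt_cocycles G M g a b k \<Longrightarrow> w - w' \<in> filt_cocycles G M g a b k"
  "w \<in> filt_cocycles G M g a b k \<Longrightarrow> (\<lambda>r. scal c (w r)) \<in> filt_cocycles G M g a b k"
  by (auto simp: filt_cocycles_def tot_linear D_linear)

text \<open>The bound \<open>c\<close> is arbitrary because \<open>D (D w) = 0\<close>.\<close>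

lemma filt_D: "w \<in> filt_cocycles G M g a b k \<Longrightarrow> D w \<in> filt_cocycles G M g b c (Suc k)"
  by (auto simp: filt_cocycles_def D_tot D_D)

lemma filt_mono:
  "w \<in> filt_cocycles G M g a b k \<Longrightarrow> a' \<le> a \<Longrightarrow> b' \<le> b \<Longrightarrow> w \<in> filt_cocycles G M g a' b' k"
  by (auto simp: filt_cocycles_def)

lemma filt_add_subgroup: "add_subgroup (filt_cocycles G M g a b k)"
  by (simp add: add_subgroup_def filt_linear)

lemma lhs_B_add_subgroup:
  "add_subgroup (lhs_B G M g t r k :: (nat \<Rightarrow> 'a list \<Rightarrow> 'k::comm_ring_1) set)"
  unfolding lhs_B_def
proof (intro add_subgroup_plus filt_add_subgroup)
  show "add_subgroup (case k of 0 \<Rightarrow> {0 :: nat \<Rightarrow> 'a list \<Rightarrow> 'k}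
      | Suc j \<Rightarrow> D ` filt_cocycles G M g (Suc r - t) r j)"
  proof (cases k)
    case (Suc j)
    have "(0 :: nat \<Rightarrow> 'a list \<Rightarrow> 'k) \<in> D ` filt_cocycles G M g (Suc r - t) r j"
      by (rule image_eqI[of _ _ 0]) (simp_all add: D_linear filt_linear)
    moreover have "D a - D b \<in> D ` filt_cocycles G M g (Suc r - t) r j"
      if "a \<in> filt_cocycles G M g (Suc r - t) r j" "b \<in> filt_cocycles G M g (Suc r - t) r j"
      for a b :: "nat \<Rightarrow> 'a list \<Rightarrow> 'k"
      using that by (intro image_eqI[of _ _ "a - b"]) (simp_all add: D_linear filt_linear)
    ultimately show ?thesis by (auto simp: Suc add_subgroup_def)
  qed (simp add: add_subgroup_def)
qed

lemmas lhs_B_closed = add_subgroupD[OF lhs_B_add_subgroup]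

lemma lhs_B_I:
  assumes "w \<in> filt_cocycles G M g (Suc r) (r + t) k"
  shows "w \<in> lhs_B G M g t r k"
proof -
  have "0 \<in> (case k of 0 \<Rightarrow> {0} | Suc j \<Rightarrow> D ` filt_cocycles G M g (Suc r - t) r j)"
  proof (cases k)
    case (Suc j)
    then show ?thesis
      by (auto intro!: image_eqI[of _ _ 0] simp: D_linear filt_linear)
  qed simp
  then have "w + 0 \<in> lhs_B G M g t r k"
    unfolding lhs_B_def by (intro set_plus_intro assms)
  then show ?thesis by simp
qed

lemma lhs_B_D_I:
  assumes "z \<in> filt_cocycles G M g (Suc r - t) r k"
  shows "D z \<in> lhs_B G M g t r (Suc k)"
proof -
  have "0 + D z \<in> lhs_B G M g t r (Suc k)"
    unfolding lhs_B_def using assms by (intro set_plus_intro filt_linear) auto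
  then show ?thesis by simp
qed

lemma lhs_B_cases:
  assumes "b \<in> lhs_B G M g t r k"
  obtains w where "w \<in> filt_cocycles G M g (Suc r) (r + t) k" "b = w"
  | w z j where "w \<in> filt_cocycles G M g (Suc r) (r + t) k" "k = Suc j"
      "z \<in> filt_cocycles G M g (Suc r - t) r j" "b = w + D z"
  using assms by (cases k) (auto simp: lhs_B_def elim!: set_plus_elim)

section \<open>Comparison of cochains on the whole group with cochains on the subgroup\<close>

text \<open>Choose a representative of each coset \<open>M #> x\<close> and divide by it on the
  right. The quotient lies in \<open>M\<close>, and it is equivariant because the representative
  depends only on the coset.\<close>

lemma ex_retraction:
  "\<exists>\<rho>. (\<forall>x\<in>carrier G. \<rho> x \<in> M) \<and> (\<forall>m\<in>M. \<forall>x\<in>carrier G. \<rho> (m \<otimes> x) = m \<otimes> \<rho> x)"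
proof (intro exI conjI ballI)
  let ?rep = "\<lambda>x. SOME y. y \<in> M #> x"
  have rep: "\<exists>m\<in>M. ?rep x = m \<otimes> x" if "x \<in> carrier G" for x
  proof -
    have "?rep x \<in> M #> x"
      by (rule someI[of _ x]) (rule rcos_self[OF that subgroup_M])
    then show ?thesis by (auto simp: r_coset_def)
  qed
  {
    fix x assume x: "x \<in> carrier G"
    then obtain m where m: "m \<in> M" "?rep x = m \<otimes> x" using rep by blast
    have "x \<otimes> inv (m \<otimes> x) = inv m"
      using m(1) x M_carrier by (simp add: inv_mult_group flip: m_assoc)
    then show "x \<otimes> inv ?rep x \<in> M" using m M_closed by simp
  next
    fix m x assume m: "m \<in> M" and x: "x \<in> carrier G"
    have "M #> (m \<otimes> x) = M #> x"
      using m x M_carrier M_subset by (simp add: coset_join2 subgroup_M flip: coset_mult_assoc)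
    moreover have "?rep x \<in> carrier G" using rep[OF x] M_carrier x by force
    ultimately show "(m \<otimes> x) \<otimes> inv ?rep (m \<otimes> x) = m \<otimes> (x \<otimes> inv ?rep x)"
      using m x M_carrier by (simp add: m_assoc)
  }
qed

text \<open>Restriction to \<open>M\<close> is injective on cohomology. The prism of an equivariant
  retraction \<open>\<rho>\<close> onto \<open>M\<close> is a homotopy between a cocycle
  \<open>f\<close> and the pullback along \<open>\<rho>\<close> of its restriction.\<close>

lemma coboundary_if_restr_coboundary:
  assumes f: "f \<in> Co s" and cocycle: "\<delta> f = 0" and restr: "restr M f \<in> coboundaries G M M s"
  shows "f \<in> coboundaries G M (carrier G) s"
proof -
  obtain \<rho> where \<rho>: "\<And>x. x \<in> carrier G \<Longrightarrow> \<rho> x \<in> M"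
      "\<And>m x. m \<in> M \<Longrightarrow> x \<in> carrier G \<Longrightarrow> \<rho> (m \<otimes> x) = m \<otimes> \<rho> x"
    using ex_retraction by blast
  have face: "face_sum f xs = 0" if "set xs \<subseteq> carrier G" for xs
    using that fun_cong[OF cocycle, of xs] by (simp add: cobd_face_sum restr_apply)
  have homotopy: "f xs = face_sum (prism \<rho> f) xs + restr M f (map \<rho> xs)"
    if xs: "set xs \<subseteq> carrier G" for xs
  proof -
    have "prism \<rho> (face_sum f) xs = prism \<rho> (\<lambda>_. 0) xs"
      using xs \<rho>(1) M_subset by (intro prism_cong face) blast
    moreover have "restr M f (map \<rho> xs) = f (map \<rho> xs)"
      using xs \<rho>(1) by (auto simp: restr_apply)
    ultimately show ?thesis
      using prism_homotopy[of \<rho> f xs] by (simp add: prism_zero)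
  qed
  have prism_0: "prism \<rho> f xs = 0" if "length xs \<noteq> s" for xs
  proof -
    have "prism \<rho> f xs = prism \<rho> (\<lambda>_. 0) xs"
      using that by (intro prism_cong cochainsD(1)[OF f]) simp
    then show ?thesis by (simp add: prism_zero)
  qed
  show ?thesis
  proof (cases s)
    case 0
    \<comment> \<open>\<open>prism_0\<close> leaves only the empty list, where \<open>prism\<close>
      is 0 by definition.\<close>
    have "prism \<rho> f xs = 0" for xs
      using prism_0[of xs] 0 by (cases xs) simp_all
    then have "f xs = 0" if "set xs \<subseteq> carrier G" for xs
      using homotopy[OF that] restr 0 by (simp add: face_sum_def)
    then show ?thesis using 0 cochainsD(2)[OF f] by (auto simp: fun_eq_iff)
  next
    case (Suc t)
    then obtain c where c: "restr M f = cobd M c" "c \<in> cochains G M M t"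
      using restr by auto
    \<comment> \<open>By \<open>homotopy\<close>, a primitive of \<open>f\<close> is its prism plus
      the pullback of the primitive \<open>c\<close> on \<open>M\<close>.\<close>
    define h where "h = restr (carrier G) (\<lambda>xs. prism \<rho> f xs + c (map \<rho> xs))"
    have "h \<in> Co t"
    proof (rule cochainsI)
      fix xs assume nz: "h xs \<noteq> 0"
      then show "set xs \<subseteq> carrier G" by (auto simp: h_def restr_apply split: if_splits)
      show "length xs = Suc t"
      proof (rule ccontr)
        assume "length xs \<noteq> Suc t"
        then show False
          using nz prism_0[of xs] cochainsD(1)[OF c(2), of "map \<rho> xs"] Suc
          by (auto simp: h_def restr_apply split: if_splits)
      qed
    next
      fix m xs assume m: "m \<in> M" and xs: "set xs \<subseteq> carrier G"
      have "prism \<rho> f (map (\<lambda>x. m \<otimes> x) xs) = prism \<rho> (\<lambda>ys. f (map (\<lambda>x. m \<otimes> x) ys)) xs"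
        using m xs \<rho>(2) by (intro prism_map) auto
      also have "\<dots> = prism \<rho> f xs"
        using m xs \<rho>(1) M_subset by (intro prism_cong cochainsD(3)[OF f]) blast+
      finally have "prism \<rho> f (map (\<lambda>x. m \<otimes> x) xs) = prism \<rho> f xs" .
      moreover have "map \<rho> (map (\<lambda>x. m \<otimes> x) xs) = map (\<lambda>x. m \<otimes> x) (map \<rho> xs)"
        using m xs \<rho>(2) by auto
      moreover have "c (map (\<lambda>x. m \<otimes> x) (map \<rho> xs)) = c (map \<rho> xs)"
        using m xs \<rho>(1) by (intro cochainsD(3)[OF c(2)]) auto
      moreover have "set (map (\<lambda>x. m \<otimes> x) xs) \<subseteq> carrier G"
        using m xs M_carrier by auto
      ultimately show "h (map (\<lambda>x. m \<otimes> x) xs) = h xs"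
        using xs by (simp only: h_def restr_apply if_True)
    qed
    moreover have "f = \<delta> h"
    proof
      fix xs show "f xs = \<delta> h xs"
      proof (cases "set xs \<subseteq> carrier G")
        case True
        moreover have "set (map \<rho> xs) \<subseteq> M" using True \<rho>(1) by auto
        ultimately show ?thesis
          using homotopy[OF True] unfolding c(1)
          by (simp add: h_def cobd_face_sum restr_apply face_sum_restr face_sum_add face_sum_map)
      qed (simp add: cochainsD(2)[OF f] cobd_face_sum restr_apply)
    qed
    ultimately show ?thesis by (simp add: Suc)
  qed
qed

text \<open>Nothing lies below column \<open>r\<close>, so column \<open>r\<close> of
  \<open>D w\<close> is \<open>\<delta> (w r)\<close> up to sign; membership in \<open>lhs_Z\<close>
  makes it vanish.\<close>

lemma lhs_Z_D:
  assumes "w \<in> lhs_Z G M g 2 r (r + s)"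
  shows "w r \<in> Co s" "\<delta> (w r) = 0" "w \<in> tot G M (r + s)" "restr M (w r) \<in> cocycles G M M s"
proof -
  have w: "w \<in> tot G M (r + s)" "\<And>i. i < r \<Longrightarrow> w i = 0" "\<And>i. i < r + 2 \<Longrightarrow> D w i = 0"
    using assms by (auto simp: lhs_Z_def filt_cocycles_def)
  show 1: "w r \<in> Co s" using w(1) by (auto simp: tot_def dest!: spec[of _ r])
  have "scal ((-1) ^ r) (\<delta> (w r)) = 0"
    using w(2)[of "r - 1"] w(3)[of r] by (cases r) (simp_all add: D_0 D_Suc hdiff_linear)
  then have "scal ((-1) ^ r) (scal ((-1) ^ r) (\<delta> (w r))) = 0" by (simp only: scal_simps)
  then show 2: "\<delta> (w r) = 0" by (simp flip: power_mult_distrib)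
  show "w \<in> tot G M (r + s)" by (fact w)
  show "restr M (w r) \<in> cocycles G M M s" by (rule restr_cocycles[OF 1 2])
qed

definition single :: "nat \<Rightarrow> ('a list \<Rightarrow> 'k::comm_ring_1) \<Rightarrow> nat \<Rightarrow> 'a list \<Rightarrow> 'k" where
  "single r f = (\<lambda>i. if i = r then f else 0)"

lemma single_apply: "single r f i = (if i = r then f else 0)"
  by (simp add: single_def)

lemma single_tot: "f \<in> Co s \<Longrightarrow> single r f \<in> tot G M (r + s)"
  by (auto simp: single_def tot_def)

lemma D_single: "D (single r f) i =
    (if i = r then scal ((-1) ^ r) (\<delta> f) else if i = Suc r then hdiff G M g r f else 0)"
  by (cases i) (auto simp: D_0 D_Suc single_def hdiff_linear cobd_linear)

text \<open>An element of \<open>E_2\<close> is determined by the class of its leading component on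
  \<open>M\<close>. If \<open>v r\<close> is \<open>\<delta> c\<close>, subtracting the total
  differential of \<open>c\<close> placed in column \<open>r\<close> pushes \<open>v\<close> into
  the next filtration step, which lies in \<open>lhs_B\<close>.\<close>

lemma lhs_B_if_restr_coboundary:
  assumes v: "v \<in> lhs_Z G M g 2 r (r + s)" and cob: "restr M (v r) \<in> coboundaries G M M s"
  shows "v \<in> lhs_B G M g 2 r (r + s)"
proof -
  note vD = lhs_Z_D[OF v]
  have filt: "v \<in> filt_cocycles G M g r (r + 2) (r + s)" using v by (simp add: lhs_Z_def)
  have *: "v \<in> lhs_B G M g 2 r (r + s)" if "v r = 0"
    using filt that by (intro lhs_B_I) (auto simp: filt_cocycles_def less_Suc_eq)
  have "v r \<in> coboundaries G M (carrier G) s"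
    by (intro coboundary_if_restr_coboundary vD cob)
  then consider "v r = 0" | t c where "s = Suc t" "v r = \<delta> c" "c \<in> Co t"
    by (cases s) auto
  then show ?thesis
  proof cases
    case 2
    \<comment> \<open>The sign cancels the one that \<open>tdiff\<close> puts on the vertical
      differential of column \<open>r\<close>.\<close>
    define z where "z = single r (scal ((-1) ^ r) c)"
    have Dz: "D z r = v r" "\<And>i. i < r \<Longrightarrow> D z i = 0"
      by (simp_all add: z_def D_single cobd_linear 2 flip: power_mult_distrib)
    have z: "z \<in> filt_cocycles G M g (Suc r - 2) r (r + t)"
      using single_tot[OF cochains_scal[OF 2(3)], of r] Dz(2)
      by (auto simp: filt_cocycles_def z_def single_def)
    have "v - D z \<in> filt_cocycles G M g (Suc r) (r + 2) (r + s)"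
      using filt filt_D[OF z, of 0] D_D[of z "r + t"] z Dz 2(1)
      by (auto simp: filt_cocycles_def less_Suc_eq D_linear tot_linear)
    then have "v - D z \<in> lhs_B G M g 2 r (r + s)"
      by (rule lhs_B_I)
    moreover have "D z \<in> lhs_B G M g 2 r (r + s)"
      using lhs_B_D_I[OF z] 2(1) by simp
    ultimately have "(v - D z) + D z \<in> lhs_B G M g 2 r (r + s)"
      by (rule lhs_B_closed(4))
    then show ?thesis by simp
  qed (rule *)
qed

section \<open>Bar classes, differentials and products on the second page\<close>

lemma E2_bar_coset:
  assumes w: "w \<in> lhs_Z G M g 2 r (r + s)"
    and u: "u = restr M (w r) +o coboundaries G M M s"
  shows "E2_bar G M g r s u = w +o lhs_B G M g 2 r (r + s)"
  unfolding E2_bar_def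
proof (intro coset_plus_subgroup lhs_B_add_subgroup)
  show "{w \<in> lhs_Z G M g 2 r (r + s). restr M (w r) \<in> u} \<noteq> {}"
    using w self_in_coset[OF coboundaries_add_subgroup] u by blast
  fix w' assume w': "w' \<in> {w \<in> lhs_Z G M g 2 r (r + s). restr M (w r) \<in> u}"
  then have "w' - w \<in> lhs_Z G M g 2 r (r + s)"
    using w by (simp add: lhs_Z_def filt_linear)
  moreover have "restr M ((w' - w) r) \<in> coboundaries G M M s"
    using w' unfolding u by (simp add: elt_set_plus_iff restr_linear)
  ultimately show "w' - w \<in> lhs_B G M g 2 r (r + s)"
    by (rule lhs_B_if_restr_coboundary)
qed

text \<open>\<open>D\<close> maps \<open>lhs_B\<close> to \<open>lhs_B\<close> two columns further:
  it kills the boundaries, and images of elements of filtration \<open>Suc r\<close> are boundaries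
  there since \<open>Suc (r + 2) - 2 = Suc r\<close>.\<close>

lemma lhs_diff_coset:
  assumes w: "w \<in> lhs_Z G M g 2 r (r + s)"
  shows "lhs_diff G M g 2 r s (w +o lhs_B G M g 2 r (r + s)) =
    D w +o lhs_B G M g 2 (r + 2) (Suc (r + s))"
  unfolding lhs_diff_def
proof (intro coset_plus_subgroup lhs_B_add_subgroup)
  show "D ` (w +o lhs_B G M g 2 r (r + s)) \<noteq> {}"
    using self_in_coset[OF lhs_B_add_subgroup] by blast
  fix x assume "x \<in> D ` (w +o lhs_B G M g 2 r (r + s))"
  then obtain w' where w': "x = D w'" "w' - w \<in> lhs_B G M g 2 r (r + s)"
    by (auto simp only: image_iff elt_set_plus_iff Bex_def)
  have Df: "D f \<in> lhs_B G M g 2 (r + 2) (Suc (r + s))"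
    if "f \<in> filt_cocycles G M g (Suc r) (r + 2) (r + s)" for f
    using that by (intro lhs_B_D_I) simp
  from w'(2) have "D (w' - w) \<in> lhs_B G M g 2 (r + 2) (Suc (r + s))"
  proof (cases rule: lhs_B_cases)
    case (2 f z j)
    then show ?thesis using Df[of f] D_D[of z j] by (simp add: D_linear filt_cocycles_def)
  qed (use Df in simp)
  then show "x - D w \<in> lhs_B G M g 2 (r + 2) (Suc (r + s))"
    by (simp add: w' D_linear)
qed

lemma lhs_scale_coset:
  "lhs_scale G M g 2 r s c (w +o lhs_B G M g 2 r (r + s)) =
    (\<lambda>i. scal c (w i)) +o lhs_B G M g 2 r (r + s)"
proof -
  have eq: "lhs_scale G M g 2 r s c U = (\<lambda>w i. scal c (w i)) ` U + lhs_B G M g 2 r (r + s)"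
    for U by (simp add: lhs_scale_def scal_def)
  have B: "(\<lambda>i. scal c (b i)) \<in> lhs_B G M g 2 r k" if "b \<in> lhs_B G M g 2 r k" for b k
    using that
  proof (cases rule: lhs_B_cases)
    case 1
    then show ?thesis by (simp add: lhs_B_I filt_linear)
  next
    case (2 f z j)
    have "(\<lambda>i. scal c (b i)) = (\<lambda>i. scal c (f i)) + D (\<lambda>i. scal c (z i))"
      by (simp add: 2 D_linear scal_right_distrib fun_eq_iff algebra_simps)
    moreover have "D (\<lambda>i. scal c (z i)) \<in> lhs_B G M g 2 r k"
      unfolding 2 by (intro lhs_B_D_I filt_linear 2)
    moreover have "(\<lambda>i. scal c (f i)) \<in> lhs_B G M g 2 r k"
      by (intro lhs_B_I filt_linear 2)
    ultimately show ?thesis by (simp only: lhs_B_closed(4))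
  qed
  show ?thesis
    unfolding eq
  proof (intro coset_plus_subgroup lhs_B_add_subgroup)
    show "(\<lambda>w i. scal c (w i)) ` (w +o lhs_B G M g 2 r (r + s)) \<noteq> {}"
      using self_in_coset[OF lhs_B_add_subgroup] by blast
    fix x assume "x \<in> (\<lambda>w i. scal c (w i)) ` (w +o lhs_B G M g 2 r (r + s))"
    then obtain w' where w': "x = (\<lambda>i. scal c (w' i))" "w' - w \<in> lhs_B G M g 2 r (r + s)"
      by (auto simp only: image_iff elt_set_plus_iff Bex_def)
    have "(\<lambda>i. scal c (w' i)) - (\<lambda>i. scal c (w i)) = (\<lambda>i. scal c ((w' - w) i))"
      by (simp add: fun_eq_iff algebra_simps)
    then show "x - (\<lambda>i. scal c (w i)) \<in> lhs_B G M g 2 r (r + s)"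
      using B[OF w'(2)] unfolding w'(1) by (simp only:)
  qed
qed

lemma cohom_eq_coset:
  assumes "u \<in> cohom G M s" "f \<in> u"
  shows "u = f +o coboundaries G M M s"
proof -
  obtain f' where f': "u = f' +o coboundaries G M M s"
    using assms(1) by (auto simp: cohom_def)
  then have "f' - f \<in> coboundaries G M M s"
    using assms(2) coboundaries_closed(3)[of "f - f'"] by (simp add: elt_set_plus_iff)
  then show ?thesis
    unfolding f' by (rule coset_eqI[OF coboundaries_add_subgroup])
qed

lemma coset_in_cohom: "f \<in> cocycles G M M s \<Longrightarrow> f +o coboundaries G M M s \<in> cohom G M s"
  by (auto simp: cohom_def)

lemma E2_bar_coset_D:
  assumes eq: "w +o lhs_B G M g 2 r (r + s) = E2_bar G M g r s u" and u: "u \<in> cohom G M s"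
  obtains w' where "w' \<in> lhs_Z G M g 2 r (r + s)" "u = restr M (w' r) +o coboundaries G M M s"
    "w' - w \<in> lhs_B G M g 2 r (r + s)"
proof -
  have "w \<in> E2_bar G M g r s u"
    using self_in_coset[OF lhs_B_add_subgroup] eq by blast
  then obtain w' b where w': "w = w' + b" "w' \<in> lhs_Z G M g 2 r (r + s)" "restr M (w' r) \<in> u"
      "b \<in> lhs_B G M g 2 r (r + s)"
    by (auto simp: E2_bar_def elim!: set_plus_elim)
  have "u = restr M (w' r) +o coboundaries G M M s"
    by (rule cohom_eq_coset[OF u w'(3)])
  moreover have "w' - w \<in> lhs_B G M g 2 r (r + s)"
    using lhs_B_closed(3)[OF w'(4)] w'(1) by simp
  ultimately show ?thesis using that w'(2) by blast
qed

text \<open>\<open>E2_mult\<close> is a definite description over all cohomology classes with the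
  given bars. The last premise therefore asks for the same value at all lifts \<open>v\<close>,
  \<open>v'\<close> that agree with \<open>w\<close>, \<open>w'\<close> modulo
  \<open>lhs_B\<close>.\<close>

lemma E2_mult_eqI:
  assumes w: "w \<in> lhs_Z G M g 2 r (r + s)" and w': "w' \<in> lhs_Z G M g 2 r' (r' + s')"
    and *: "\<And>v v'. v \<in> lhs_Z G M g 2 r (r + s) \<Longrightarrow> v - w \<in> lhs_B G M g 2 r (r + s) \<Longrightarrow>
      v' \<in> lhs_Z G M g 2 r' (r' + s') \<Longrightarrow> v' - w' \<in> lhs_B G M g 2 r' (r' + s') \<Longrightarrow>
      E2_bar G M g (r + r') (s + s') (E2_cup G M g r s r' s'
        (restr M (v r) +o coboundaries G M M s) (restr M (v' r') +o coboundaries G M M s')) = W"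
  shows "E2_mult G M g r s r' s' (w +o lhs_B G M g 2 r (r + s)) (w' +o lhs_B G M g 2 r' (r' + s')) = W"
  unfolding E2_mult_def
proof (rule the_equality)
  show "\<exists>u\<in>cohom G M s. \<exists>v\<in>cohom G M s'.
       w +o lhs_B G M g 2 r (r + s) = E2_bar G M g r s u \<and>
       w' +o lhs_B G M g 2 r' (r' + s') = E2_bar G M g r' s' v \<and>
       W = E2_bar G M g (r + r') (s + s') (E2_cup G M g r s r' s' u v)"
  proof (intro bexI conjI)
    show "W = E2_bar G M g (r + r') (s + s') (E2_cup G M g r s r' s'
        (restr M (w r) +o coboundaries G M M s) (restr M (w' r') +o coboundaries G M M s'))"
      using *[OF w _ w'] by (simp add: lhs_B_closed)
  qed (simp_all add: E2_bar_coset[OF w refl] E2_bar_coset[OF w' refl] coset_in_cohom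
      lhs_Z_D(4)[OF w] lhs_Z_D(4)[OF w'])
next
  fix V
  assume "\<exists>u\<in>cohom G M s. \<exists>v\<in>cohom G M s'.
       w +o lhs_B G M g 2 r (r + s) = E2_bar G M g r s u \<and>
       w' +o lhs_B G M g 2 r' (r' + s') = E2_bar G M g r' s' v \<and>
       V = E2_bar G M g (r + r') (s + s') (E2_cup G M g r s r' s' u v)"
  then obtain u v where uv: "u \<in> cohom G M s" "v \<in> cohom G M s'"
       "w +o lhs_B G M g 2 r (r + s) = E2_bar G M g r s u"
       "w' +o lhs_B G M g 2 r' (r' + s') = E2_bar G M g r' s' v"
       "V = E2_bar G M g (r + r') (s + s') (E2_cup G M g r s r' s' u v)"
    by blast
  obtain x where "x \<in> lhs_Z G M g 2 r (r + s)" "u = restr M (x r) +o coboundaries G M M s"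
    "x - w \<in> lhs_B G M g 2 r (r + s)" by (rule E2_bar_coset_D[OF uv(3,1)])
  moreover obtain y where "y \<in> lhs_Z G M g 2 r' (r' + s')" "v = restr M (y r') +o coboundaries G M M s'"
    "y - w' \<in> lhs_B G M g 2 r' (r' + s')" by (rule E2_bar_coset_D[OF uv(4,2)])
  ultimately show "V = W" using * uv(5) by blast
qed

section \<open>Multiplication by classes in bidegrees (0,1) and (2,0)\<close>

lemma hdiff_cup_fixed:
  assumes "x \<in> Co s" "act G g x = x"
  shows "hdiff G M g t (cup s x f) = cup s x (hdiff G M g t f)"
  using assms by (simp add: hdiff_def act_cup act_pow_fixed[OF assms(2,1)] cup_linear cup_sum_right)

text \<open>\<open>\<delta>\<close> anticommutes with the product by a cocycle of degree 1, while
  \<open>hdiff\<close> commutes with it and raises the column. The column sign in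
  \<open>cup_tot\<close> makes both parts anticommute.\<close>

lemma D_cup_tot:
  assumes x: "x \<in> Co 1" "\<delta> x = 0" "act G g x = x" and w: "w \<in> tot G M k"
  shows "D (cup_tot x w) = - cup_tot x (D w)"
proof -
  have \<delta>: "\<delta> (cup (Suc 0) x (w r)) = - cup (Suc 0) x (\<delta> (w r))" for r
  proof -
    obtain s where "w r \<in> Co s"
      using w cochains_zero by (cases "r \<le> k") (auto simp: tot_def)
    then show ?thesis
      using x by (subst cobd_cup[OF stable, where s' = s]) (simp_all add: cup_linear)
  qed
  show ?thesis
  proof
    fix r show "D (cup_tot x w) r = (- cup_tot x (D w)) r"
      by (cases r) (simp_all add: cup_tot_def D_0 D_Suc \<delta> cobd_linear hdiff_linear
          hdiff_cup_fixed[OF x(1,3), simplified] cup_linear scal_right_distrib scal_right_diff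
          flip: power_mult_distrib)
  qed
qed

lemma cup_tot_filt:
  assumes x: "x \<in> Co 1" "\<delta> x = 0" "act G g x = x" and w: "w \<in> filt_cocycles G M g a b k"
  shows "cup_tot x w \<in> filt_cocycles G M g a b (Suc k)"
proof -
  have "cup_tot x w r \<in> Co (Suc k - r)" if "r \<le> Suc k" for r
  proof (cases "r \<le> k")
    case True
    then have "w r \<in> Co (k - r)" using w by (auto simp: filt_cocycles_def tot_def)
    from cup_cochains[OF x(1) this] show ?thesis
      using True by (simp add: cup_tot_def cochains_scal Suc_diff_le)
  qed (use w in \<open>simp add: cup_tot_def cup_linear filt_cocycles_def tot_def\<close>)
  moreover have "cup_tot x w r = 0" if "w r = 0" for r
    using that by (simp add: cup_tot_def cup_linear)
  moreover have "D (cup_tot x w) = - cup_tot x (D w)"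
    using w by (intro D_cup_tot x) (auto simp: filt_cocycles_def)
  then have "D (cup_tot x w) r = 0" if "D w r = 0" for r
    using that by (simp add: cup_tot_def cup_linear)
  ultimately show ?thesis
    using w by (auto simp: filt_cocycles_def tot_def)
qed

lemma cup_tot_linear: "cup_tot x (w + w') = cup_tot x w + cup_tot x w'"
    "cup_tot x (w - w') = cup_tot x w - cup_tot x w'" "cup_tot x (- w) = - cup_tot x w"
  by (simp_all add: cup_tot_def cup_linear fun_eq_iff algebra_simps)

lemma cup_tot_lhs_B:
  assumes x: "x \<in> Co 1" "\<delta> x = 0" "act G g x = x" and b: "b \<in> lhs_B G M g t r k"
  shows "cup_tot x b \<in> lhs_B G M g t r (Suc k)"
  using b
proof (cases rule: lhs_B_cases)
  case 1
  then show ?thesis using cup_tot_filt[OF x] by (auto intro: lhs_B_I)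
next
  case (2 f z j)
  have "cup_tot x (D z) = - D (cup_tot x z)"
    using 2 by (subst D_cup_tot[OF x]) (auto simp: filt_cocycles_def)
  then have "cup_tot x b = cup_tot x f - D (cup_tot x z)"
    by (simp add: 2 cup_tot_linear)
  then show ?thesis
    using cup_tot_filt[OF x 2(1)] cup_tot_filt[OF x 2(3)] 2(2)
    by (simp add: lhs_B_closed(2) lhs_B_I lhs_B_D_I)
qed

text \<open>Both \<open>hdiff\<close> and the sign of the vertical differential depend only on the
  parity of the column.\<close>

lemma D_shift2: "D (shift2 w) = shift2 (D w)"
proof
  fix r show "D (shift2 w) r = shift2 (D w) r"
  proof (cases "(w, r)" rule: shift2.cases)
    case (3 w' t)
    then show ?thesis by (cases t) (simp_all add: D_0 D_Suc hdiff_linear hdiff_def act_linear)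
  qed (simp_all add: D_0 D_Suc hdiff_linear cobd_linear)
qed

lemma shift2_filt:
  assumes "w \<in> filt_cocycles G M g a b k"
  shows "shift2 w \<in> filt_cocycles G M g (a + 2) (b + 2) (k + 2)"
proof -
  have 1: "shift2 v r = 0" if "\<forall>r<a. v r = 0" "r < a + 2" for r a v
    using that by (cases "(v, r)" rule: shift2.cases) auto
  have 2: "shift2 w r \<in> Co (k + 2 - r)" if "r \<le> k + 2" for r
    using that assms by (cases "(w, r)" rule: shift2.cases) (auto simp: filt_cocycles_def tot_def)
  have 3: "shift2 w r = 0" if "r > k + 2" for r
    using that assms by (cases "(w, r)" rule: shift2.cases) (auto simp: filt_cocycles_def tot_def)
  show ?thesis
    using assms 1[of a w] 1[of b "D w"] 2 3 by (simp add: filt_cocycles_def tot_def D_shift2)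
qed

lemma shift2_linear: "shift2 (w + w') = shift2 w + shift2 w'" "shift2 (w - w') = shift2 w - shift2 w'"
  for w w' :: "nat \<Rightarrow> 'g list \<Rightarrow> 'k::comm_ring_1"
proof -
  have "shift2 (w + w') r = (shift2 w + shift2 w') r \<and> shift2 (w - w') r = (shift2 w - shift2 w') r" for r
    by (cases "(w, r)" rule: shift2.cases) auto
  then show "shift2 (w + w') = shift2 w + shift2 w'" "shift2 (w - w') = shift2 w - shift2 w'"
    by auto
qed

lemma shift2_lhs_B:
  assumes b: "b \<in> lhs_B G M g 2 r k"
  shows "shift2 b \<in> lhs_B G M g 2 (r + 2) (k + 2)"
  using b
proof (cases rule: lhs_B_cases)
  case 1
  then show ?thesis using shift2_filt[OF 1(1)] by (auto intro: lhs_B_I)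
next
  case (2 f z j)
  have "D (shift2 z) \<in> lhs_B G M g 2 (r + 2) (Suc (j + 2))"
    by (intro lhs_B_D_I filt_mono[OF shift2_filt[OF 2(3)]]) auto
  moreover have "shift2 f \<in> lhs_B G M g 2 (r + 2) (k + 2)"
    using shift2_filt[OF 2(1)] by (intro lhs_B_I) simp
  ultimately show ?thesis
    using 2(2,4) by (simp add: shift2_linear D_shift2 lhs_B_closed(4))
qed

text \<open>In column 0 the boundaries in \<open>lhs_B\<close> contribute only vertical
  coboundaries, so an element of that column of \<open>E_2\<close> determines its class on
  \<open>M\<close>.\<close>

lemma lhs_B_0_restr:
  assumes "b \<in> lhs_B G M g 2 0 k"
  shows "restr M (b 0) \<in> coboundaries G M M k"
  using assms
proof (cases rule: lhs_B_cases)
  case 1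
  then show ?thesis by (simp add: filt_cocycles_def restr_linear coboundaries_closed)
next
  case (2 f z j)
  then have "z 0 \<in> Co j" "f 0 = 0" by (auto simp: filt_cocycles_def tot_def)
  then have "restr M (b 0) = restr M (\<delta> (z 0))" "\<delta> (z 0) \<in> coboundaries G M (carrier G) k"
    using 2 by (auto simp: D_0)
  then show ?thesis using restr_coboundaries by simp
qed

lemma single_lhs_Z:
  assumes "f \<in> Co s" "\<delta> f = 0" "hdiff G M g r f = 0"
  shows "single r f \<in> lhs_Z G M g 2 r (r + s)"
  using assms single_tot[OF assms(1), of r]
  by (auto simp: lhs_Z_def filt_cocycles_def D_single) (simp add: single_def)

text \<open>The sign \<open>(-1) ^ (1 * 1)\<close> of the product formula is the sign of
  \<open>cup_tot\<close> in column 1. Independence of the lifts follows from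
  \<open>lhs_B_0_restr\<close> and \<open>cup_tot_lhs_B\<close>.\<close>

lemma E2_mult_cup_tot:
  assumes x: "x \<in> Co 1" "\<delta> x = 0" "act G g x = x" and w: "w \<in> lhs_Z G M g 2 1 (1 + s)"
  shows "E2_mult G M g 0 1 1 s (E2_bar G M g 0 1 (restr M x +o coboundaries G M M 1))
      (w +o lhs_B G M g 2 1 (1 + s)) = cup_tot x w +o lhs_B G M g 2 1 (1 + (1 + s))"
proof -
  have cZ: "cup_tot x v \<in> lhs_Z G M g 2 1 (1 + (1 + s))" if "v \<in> lhs_Z G M g 2 1 (1 + s)" for v
    using cup_tot_filt[OF x] that by (simp add: lhs_Z_def)
  have Z: "single 0 x \<in> lhs_Z G M g 2 0 (0 + 1)"
    using x by (intro single_lhs_Z) (simp_all add: hdiff_def)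
  have bar: "E2_bar G M g 0 1 (restr M x +o coboundaries G M M 1) = single 0 x +o lhs_B G M g 2 0 (0 + 1)"
    by (rule E2_bar_coset[OF Z]) (simp add: single_def)
  show ?thesis
    unfolding bar
  proof (rule E2_mult_eqI[OF Z w])
    fix v v'
    assume v: "v \<in> lhs_Z G M g 2 0 (0 + 1)" "v - single 0 x \<in> lhs_B G M g 2 0 (0 + 1)"
      and v': "v' \<in> lhs_Z G M g 2 1 (1 + s)" "v' - w \<in> lhs_B G M g 2 1 (1 + s)"
    have "restr M (v 0) +o coboundaries G M M 1 = restr M x +o coboundaries G M M 1"
      using lhs_B_0_restr[OF v(2)]
      by (intro coset_eqI coboundaries_add_subgroup) (simp add: restr_linear single_def)
    then have "E2_cup G M g 0 1 1 s (restr M (v 0) +o coboundaries G M M 1)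
        (restr M (v' 1) +o coboundaries G M M s) =
        scal ((-1) ^ (1 * 1)) (cup 1 (restr M x) (restr M (v' 1))) +o coboundaries G M M (1 + s)"
      using E2_cup_coset[OF M_closed(1) restr_cocycles[OF x(1,2)] lhs_Z_D(4)[OF v'(1)]] by simp
    also have "scal ((-1) ^ (1 * 1)) (cup 1 (restr M x) (restr M (v' 1))) = restr M (cup_tot x v' 1)"
      by (simp add: cup_tot_def restr_linear restr_cup)
    finally have "E2_bar G M g (0 + 1) (1 + s) (E2_cup G M g 0 1 1 s
        (restr M (v 0) +o coboundaries G M M 1) (restr M (v' 1) +o coboundaries G M M s)) =
        cup_tot x v' +o lhs_B G M g 2 1 (1 + (1 + s))"
      using E2_bar_coset[OF cZ[OF v'(1)] refl] by simp
    also have "\<dots> = cup_tot x w +o lhs_B G M g 2 1 (1 + (1 + s))"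
      using cup_tot_lhs_B[OF x v'(2)]
      by (intro coset_eqI lhs_B_add_subgroup) (simp add: cup_tot_linear)
    finally show "E2_bar G M g (0 + 1) (1 + s) (E2_cup G M g 0 1 1 s
        (restr M (v 0) +o coboundaries G M M 1) (restr M (v' 1) +o coboundaries G M M s)) =
        cup_tot x w +o lhs_B G M g 2 1 (1 + (1 + s))" .
  qed
qed

text \<open>Evaluating \<open>\<delta> f = 0\<close> at the pair of \<open>inv h \<otimes> a\<close>
  and \<open>a\<close> shows that a cocycle of degree 0 does not change under translation.\<close>

lemma act_cocycle_0:
  assumes f: "f \<in> Co 0" "\<delta> f = 0" and h: "h \<in> carrier G"
  shows "act G h f = f"
proof
  fix xs show "act G h f xs = f xs"
  proof (cases "set xs \<subseteq> carrier G \<and> length xs = Suc 0")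
    case True
    then obtain a where a: "xs = [a]" "a \<in> carrier G" by (cases xs) auto
    have "f [a] - f [inv h \<otimes> a] = 0"
      using fun_cong[OF f(2), of "[inv h \<otimes> a, a]"] a h
      by (simp add: cobd_face_sum restr_apply face_sum_Cons)
    then show ?thesis using a by (simp add: act_def restr_apply)
  next
    case False
    then show ?thesis
      using cochainsD(1,2)[OF f(1)] by (auto simp: act_def restr_apply)
  qed
qed

text \<open>A boundary in bidegree (2,0) is the norm of a cocycle of degree 0. Such a cocycle is
  fixed by the action, so its norm is a multiple by the order of the quotient, which is 0 in the
  coefficients.\<close>

lemma lhs_B_2_0:
  assumes q: "of_nat (order (G Mod M)) = (0 :: 'k::comm_ring_1)"
    and "b \<in> (lhs_B G M g 2 2 2 :: (nat \<Rightarrow> 'a list \<Rightarrow> 'k) set)"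
  shows "b 2 = 0"
  using assms(2)
proof (cases rule: lhs_B_cases)
  case 1
  then show ?thesis by (simp add: filt_cocycles_def)
next
  case (2 f z j)
  then have z: "z 0 = 0" "z 1 \<in> Co 0" "z 2 = 0" "D z 1 = 0" "f 2 = 0"
    by (auto simp: filt_cocycles_def tot_def)
  have D: "D z 1 = hdiff G M g 0 (z 0) + scal ((-1) ^ 1) (\<delta> (z 1))"
    "D z 2 = hdiff G M g 1 (z 1) + scal ((-1) ^ 2) (\<delta> (z 2))"
    using D_Suc[of z 0] D_Suc[of z 1] by (simp_all add: numeral_2_eq_2)
  have "\<delta> (z 1) = 0"
    using D(1) z by (simp add: hdiff_linear)
  then have "hdiff G M g 1 (z 1) = (\<Sum>i<order (G Mod M). z 1)"
    using z(2) g by (simp add: hdiff_def act_cocycle_0)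
  also have "\<dots> = 0"
    using q by (simp add: fun_eq_iff sum_fun_apply)
  finally show ?thesis
    using D(2) z unfolding 2(4) by (simp add: cobd_linear)
qed

lemma act_unit_cochain: "h \<in> carrier G \<Longrightarrow> act G h (unit_cochain (carrier G)) = unit_cochain (carrier G)"
  by (auto simp: act_def unit_cochain_def restr_apply fun_eq_iff)

lemma restr_unit_cochain: "restr M (unit_cochain (carrier G)) = unit_cochain M"
  using M_subset by (auto simp: unit_cochain_def restr_apply fun_eq_iff)

text \<open>By \<open>lhs_B_2_0\<close> every lift of the bar of 1 has exactly the unit cochain as
  leading component, and the sign \<open>(-1) ^ (2 * s)\<close> is 1. Multiplication is thus the
  shift by two columns.\<close>

lemma E2_mult_shift2:
  fixes w :: "nat \<Rightarrow> 'a list \<Rightarrow> 'k::comm_ring_1"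
  assumes q: "of_nat (order (G Mod M)) = (0 :: 'k)" and w: "w \<in> lhs_Z G M g 2 1 (1 + s)"
  shows "E2_mult G M g 1 s 2 0 (w +o lhs_B G M g 2 1 (1 + s)) (E2_bar G M g 2 0 (cohom_one G M)) =
    shift2 w +o lhs_B G M g 2 3 (3 + s)"
proof -
  let ?one = "unit_cochain (carrier G) :: 'a list \<Rightarrow> 'k"
  have sZ: "shift2 v \<in> lhs_Z G M g 2 3 (3 + s)" if "v \<in> lhs_Z G M g 2 1 (1 + s)"
    for v :: "nat \<Rightarrow> 'a list \<Rightarrow> 'k"
    using shift2_filt[of v 1 3 "1 + s"] that by (simp add: lhs_Z_def eval_nat_numeral)
  have one: "?one \<in> Co 0" "\<delta> ?one = 0"
    by (simp_all add: unit_cochain_cochains stable cobd_unit_cochain)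
  have Z: "single 2 ?one \<in> lhs_Z G M g 2 2 (2 + 0)"
    using one by (intro single_lhs_Z) (simp_all add: hdiff_def act_unit_cochain g)
  have bar: "E2_bar G M g 2 0 (cohom_one G M) = single 2 ?one +o lhs_B G M g 2 2 (2 + 0)"
    by (rule E2_bar_coset[OF Z])
       (simp add: single_apply cohom_one_def restr_unit_cochain flip: unit_cochain_def)
  show ?thesis
    unfolding bar
  proof (rule E2_mult_eqI[OF w Z])
    fix v v' :: "nat \<Rightarrow> 'a list \<Rightarrow> 'k"
    assume v: "v \<in> lhs_Z G M g 2 1 (1 + s)" "v - w \<in> lhs_B G M g 2 1 (1 + s)"
      and v': "v' \<in> lhs_Z G M g 2 2 (2 + 0)" "v' - single 2 ?one \<in> lhs_B G M g 2 2 (2 + 0)"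
    have "(v' - single 2 ?one) 2 = 0"
      using lhs_B_2_0[OF q, of "v' - single 2 ?one"] v'(2) by simp
    then have v'2: "v' 2 = ?one" by (simp add: single_apply)
    have "E2_cup G M g 1 s 2 0 (restr M (v 1) +o coboundaries G M M s)
        (restr M (v' 2) +o coboundaries G M M 0) =
        scal ((-1) ^ (2 * s)) (cup s (restr M (v 1)) (restr M (v' 2))) +o coboundaries G M M (s + 0)"
      by (rule E2_cup_coset[OF M_closed(1) lhs_Z_D(4)[OF v(1)] lhs_Z_D(4)[OF v'(1)]]) simp_all
    also have "cup s (restr M (v 1)) (restr M (v' 2)) = restr M (v 1)"
      using restr_cochains[OF lhs_Z_D(1)[OF v(1)]]
      by (simp add: v'2 restr_unit_cochain cup_unit_right)
    finally have "E2_cup G M g 1 s 2 0 (restr M (v 1) +o coboundaries G M M s)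
        (restr M (v' 2) +o coboundaries G M M 0) = restr M (shift2 v 3) +o coboundaries G M M s"
      by (simp add: numeral_3_eq_3)
    then have "E2_bar G M g (1 + 2) (s + 0) (E2_cup G M g 1 s 2 0
        (restr M (v 1) +o coboundaries G M M s) (restr M (v' 2) +o coboundaries G M M 0)) =
        shift2 v +o lhs_B G M g 2 3 (3 + s)"
      using E2_bar_coset[OF sZ[OF v(1)] refl] by (simp add: numeral_3_eq_3)
    also have "\<dots> = shift2 w +o lhs_B G M g 2 3 (3 + s)"
      using shift2_lhs_B[OF v(2)]
      by (intro coset_eqI lhs_B_add_subgroup) (simp add: shift2_linear eval_nat_numeral)
    finally show "E2_bar G M g (1 + 2) (s + 0) (E2_cup G M g 1 s 2 0
        (restr M (v 1) +o coboundaries G M M s) (restr M (v' 2) +o coboundaries G M M 0)) =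
        shift2 w +o lhs_B G M g 2 3 (3 + s)" .
  qed
qed

text \<open>Column 2 of \<open>D w\<close> is the norm of \<open>f\<close> plus
  \<open>\<delta> h\<close>, so \<open>h\<close> corrects \<open>f\<close> to an element of
  \<open>lhs_Z\<close>. What survives in column 3 represents the second differential.\<close>

lemma E2_bar_1_norm:
  assumes f: "f \<in> Co (Suc s)" "\<delta> f = 0" and h: "h \<in> Co s"
    and norm: "(\<Sum>i<order (G Mod M). act G (g [^] i) f) + \<delta> h = 0"
  defines "w \<equiv> single 1 f + single 2 h"
  shows "w \<in> lhs_Z G M g 2 1 (1 + Suc s)" "D w = single 3 (act G g h - h)"
    "E2_bar G M g 1 (Suc s) (restr M f +o coboundaries G M M (Suc s)) =
      w +o lhs_B G M g 2 1 (1 + Suc s)"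
proof -
  have tot: "w \<in> tot G M (1 + Suc s)"
    using f(1) h by (auto simp: w_def tot_def single_def)
  have "D w r = single 3 (act G g h - h) r" for r
    using f norm by (auto simp: w_def D_linear D_single single_apply hdiff_def)
  then show D: "D w = single 3 (act G g h - h)" by (rule ext)
  show Z: "w \<in> lhs_Z G M g 2 1 (1 + Suc s)"
    using tot by (simp add: lhs_Z_def filt_cocycles_def D) (simp add: w_def single_def)
  show "E2_bar G M g 1 (Suc s) (restr M f +o coboundaries G M M (Suc s)) =
      w +o lhs_B G M g 2 1 (1 + Suc s)"
    by (rule E2_bar_coset[OF Z]) (simp add: w_def single_def)
qed

end

lemma diff_diff_commute: "a - b - c = a - c - b" for a :: "'a::ab_group_add"
  by (simp add: algebra_simps)

section \<open>Powers of degree-two cocycles\<close>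

text \<open>The homotopy is \<open>h(x\<^sub>0,\<dots>,x\<^sub>s) = f(x\<^sub>0,\<dots>,x\<^sub>s) x(x\<^sub>0,x\<^sub>s)\<close>, with \<open>\<delta>h = (-1)\<^sup>s f \<smile> x - x \<smile> f\<close>.\<close>
lemma cup_commute_1:
  assumes st: "\<And>m x. m \<in> M \<Longrightarrow> x \<in> X \<Longrightarrow> m \<otimes>\<^bsub>G\<^esub> x \<in> X"
    and f: "f \<in> cochains G M X s" "cobd X f = 0"
    and x: "x \<in> cochains G M X 1" "cobd X x = 0"
  shows "cup s f x - scal ((-1) ^ s) (cup 1 x f) \<in> coboundaries G M X (Suc s)"
proof -
  define h where "h = (\<lambda>xs. f xs * x [hd xs, last xs])"
  have h: "h \<in> cochains G M X s"
  proof (rule cochainsI)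
    fix m xs assume m: "m \<in> M" and xs: "set xs \<subseteq> X"
    show "h (map (\<lambda>x. m \<otimes>\<^bsub>G\<^esub> x) xs) = h xs"
    proof (cases "xs = []")
      case False
      then have "x (map (\<lambda>x. m \<otimes>\<^bsub>G\<^esub> x) [hd xs, last xs]) = x [hd xs, last xs]"
        using m xs by (intro cochainsD(3)[OF x(1)]) auto
      then show ?thesis
        using cochainsD(3)[OF f(1) m xs] False by (simp add: h_def hd_map last_map)
    qed simp
  qed (use cochainsD(1,2)[OF f(1)] in \<open>metis h_def mult_zero_left\<close>)+
  have additive: "x [b, c] = x [a, c] - x [a, b]" if "a \<in> X" "b \<in> X" "c \<in> X" for a b c
    using fun_cong[OF x(2), of "[a, b, c]"] that
    by (simp add: cobd_face_sum restr_apply face_sum_Cons algebra_simps)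
  have "cobd X h = scal ((-1) ^ s) (cup s f x) - cup 1 x f" (is "_ = ?r")
  proof
    fix xs
    have lr: "cobd X h \<in> cochains G M X (Suc s)" "?r \<in> cochains G M X (Suc s)"
      using cup_cochains[OF f(1) x(1)] cup_cochains[OF x(1) f(1)]
      by (auto intro!: cobd_cochains st h cochains_intros)
    show "cobd X h xs = ?r xs"
    proof (cases "set xs \<subseteq> X \<and> length xs = Suc (Suc s)")
      case True
      then have X: "set xs \<subseteq> X" and len: "length xs = Suc (Suc s)" by auto
      have nth: "xs ! i \<in> X" if "i < Suc (Suc s)" for i
        using that X len by (metis nth_mem subsetD)
      define x0 where "x0 = x [xs ! 0, xs ! Suc s]"
      define xa where "xa = x [xs ! 0, xs ! 1]"
      define xb where "xb = x [xs ! s, xs ! Suc s]"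
      \<comment> \<open>Omitting an inner vertex leaves the first and last vertex alone. At the two
        ends, additivity of \<open>x\<close> along edges subtracts \<open>xa\<close> or
        \<open>xb\<close>.\<close>
      have face: "h (take i xs @ drop (Suc i) xs) = f (take i xs @ drop (Suc i) xs) *
          (x0 - (if i = 0 then xa else 0) - (if i = Suc s then xb else 0))" if "i < Suc (Suc s)" for i
      proof -
        let ?ys = "take i xs @ drop (Suc i) xs"
        have ys: "?ys \<noteq> []" using that len by auto
        have hd: "hd ?ys = (if i = 0 then xs ! 1 else xs ! 0)"
          using that len ys by (cases i) (auto simp: hd_conv_nth nth_append)
        have last: "last ?ys = (if i = Suc s then xs ! s else xs ! Suc s)"
          using that len ys by (auto simp: last_conv_nth nth_append min_def)
        have aa: "x [a, a] = 0" if "a \<in> X" for a using additive[of a a a] that by simp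
        have "x [hd ?ys, last ?ys] = x0 - (if i = 0 then xa else 0) - (if i = Suc s then xb else 0)"
          unfolding hd last x0_def xa_def xb_def
          using additive[OF nth nth nth, of 0 1 "Suc s"] additive[OF nth nth nth, of 0 s "Suc s"]
            aa[OF nth, of 0] aa[OF nth, of "Suc s"]
          by (cases s) auto
        then show ?thesis by (simp add: h_def)
      qed
      have "cobd X h xs = (\<Sum>i<Suc (Suc s). (-1) ^ i * (f (take i xs @ drop (Suc i) xs) *
          (x0 - (if i = 0 then xa else 0) - (if i = Suc s then xb else 0))))"
        unfolding cobd_face_sum restr_apply face_sum_def len using X
        by (auto intro!: sum.cong simp del: sum.lessThan_Suc simp: face)
      also have "\<dots> = (\<Sum>i<Suc (Suc s). x0 * ((-1) ^ i * f (take i xs @ drop (Suc i) xs)) -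
          (if i = 0 then (-1) ^ i * (f (take i xs @ drop (Suc i) xs) * xa) else 0) -
          (if i = Suc s then (-1) ^ i * (f (take i xs @ drop (Suc i) xs) * xb) else 0))"
        by (intro sum.cong) (simp_all add: algebra_simps)
      also have "\<dots> = x0 * face_sum f xs - f (drop 1 xs) * xa - (-1) ^ Suc s * f (take (Suc s) xs) * xb"
        unfolding face_sum_def len sum_subtractf
        using len by (simp add: sum_distrib_left mult.assoc del: sum.lessThan_Suc power_Suc)
      \<comment> \<open>The common factor \<open>x0\<close> multiplies a vanishing face sum; the two
        end faces that remain are the two cup products.\<close>
      also have "face_sum f xs = 0"
        using fun_cong[OF f(2), of xs] X by (simp add: cobd_face_sum restr_apply)
      also have "x0 * 0 - f (drop 1 xs) * xa - (-1) ^ Suc s * f (take (Suc s) xs) * xb = ?r xs"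
      proof -
        have "take (Suc 1) xs = [xs ! 0, xs ! 1]" "drop s xs = [xs ! s, xs ! Suc s]"
          using len by (auto simp: list_eq_iff_nth_eq nth_Cons' less_Suc_eq numeral_2_eq_2)
        then show ?thesis by (simp add: cup_def xa_def xb_def)
      qed
      finally show ?thesis .
    qed (use cochainsD(1,2)[OF lr(1), of xs] cochainsD(1,2)[OF lr(2), of xs] in metis)
  qed
  then have "cup s f x - scal ((-1) ^ s) (cup 1 x f) = scal ((-1) ^ s) (cobd X h)"
    by (simp add: scal_right_diff flip: power_mult_distrib)
  then show ?thesis
    using coboundaries_scal[of "cobd X h" G M X "Suc s"] h by auto
qed

section \<open>Homotopies between powers, and the second differential\<close>

context cyclic_extension
begin

fun cpow :: "('a list \<Rightarrow> 'k::comm_ring_1) \<Rightarrow> nat \<Rightarrow> 'a list \<Rightarrow> 'k" where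
  "cpow A 0 = unit_cochain (carrier G)"
| "cpow A (Suc m) = cup (2 * m) (cpow A m) A"

text \<open>\<open>\<Sum>\<^sub>k B\<^sup>k e A\<^bsup>m-1-k\<^esup>\<close>, a homotopy between \<open>A\<^sup>m\<close> and \<open>B\<^sup>m\<close> when \<open>\<delta>e = B - A\<close>.\<close>
fun hpow :: "('a list \<Rightarrow> 'k::comm_ring_1) \<Rightarrow> ('a list \<Rightarrow> 'k) \<Rightarrow> ('a list \<Rightarrow> 'k) \<Rightarrow> nat \<Rightarrow> 'a list \<Rightarrow> 'k" where
  "hpow B A e 0 = 0"
| "hpow B A e (Suc m) = cup (2 * m) (cpow B m) e + cup (2 * m - 1) (hpow B A e m) A"

text \<open>\<open>\<Sum>\<^bsub>k+l+r=m-2\<^esub> C\<^sup>k e' B\<^sup>l e A\<^sup>r\<close>, which compares homotopies along \<open>A, B, C\<close> with one from \<open>A\<close> to \<open>C\<close>.\<close>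
fun hhpow :: "('a list \<Rightarrow> 'k::comm_ring_1) \<Rightarrow> ('a list \<Rightarrow> 'k) \<Rightarrow> ('a list \<Rightarrow> 'k) \<Rightarrow>
    ('a list \<Rightarrow> 'k) \<Rightarrow> ('a list \<Rightarrow> 'k) \<Rightarrow> nat \<Rightarrow> 'a list \<Rightarrow> 'k" where
  "hhpow C B A e' e 0 = 0"
| "hhpow C B A e' e (Suc m) =
    cup (2 * m - 1) (hpow C B e' m) e + cup (2 * m - 2) (hhpow C B A e' e m) A"

lemma cpow_Co: "A \<in> Co 2 \<Longrightarrow> cpow A m \<in> Co (2 * m)"
proof (induction m)
  case (Suc m)
  then show ?case using cup_cochains[of "cpow A m" G M "carrier G" "2 * m" A 2] by simp
qed (simp add: unit_cochain_cochains stable)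

lemma cobd_cpow: "A \<in> Co 2 \<Longrightarrow> \<delta> A = 0 \<Longrightarrow> \<delta> (cpow A m) = 0"
proof (induction m)
  case (Suc m)
  then show ?case
    using cobd_cup[OF stable cpow_Co[of A m], where f' = A and s' = 2]
    by (simp only: cpow.simps cup_linear scal_simps add_0)
qed (simp add: cobd_unit_cochain)

lemma hpow_Co:
  assumes "B \<in> Co 2" "A \<in> Co 2" "e \<in> Co 1"
  shows "hpow B A e (Suc m) \<in> Co (Suc (2 * m))"
proof (induction m)
  case 0
  then show ?case using assms(3) by (simp add: cup_linear cup_unit_left)
next
  case (Suc m)
  have "cup (2 * Suc m) (cpow B (Suc m)) e \<in> Co (2 * Suc m + 1)"
    by (intro cup_cochains cpow_Co assms)
  moreover have "cup (Suc (2 * m)) (hpow B A e (Suc m)) A \<in> Co (Suc (2 * m) + 2)"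
    by (intro cup_cochains Suc assms)
  ultimately show ?case
    unfolding hpow.simps(2)[of B A e "Suc m"] by (intro cochains_add) (simp_all del: hpow.simps cpow.simps)
qed

text \<open>With powers for \<open>cpow\<close>,
  \<open>B^(m+1) - A^(m+1) = B^m (B - A) + (B^m - A^m) A\<close>, and the two summands of
  \<open>hpow\<close> have these two terms as coboundaries.\<close>

lemma cobd_hpow:
  assumes B: "B \<in> Co 2" "\<delta> B = 0" and A: "A \<in> Co 2" "\<delta> A = 0" and e: "e \<in> Co 1" "\<delta> e = B - A"
  shows "\<delta> (hpow B A e m) = cpow B m - cpow A m"
proof (induction m)
  case 0
  show "\<delta> (hpow B A e 0) = cpow B 0 - cpow A 0" by (simp add: cobd_linear)
next
  case (Suc m)
  have 1: "\<delta> (cup (2 * m) (cpow B m) e) = cup (2 * m) (cpow B m) (B - A)"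
    using cobd_cup[OF stable cpow_Co[OF B(1), of m] e(1)] by (simp add: cobd_cpow B e cup_linear)
  \<comment> \<open>For \<open>m = 0\<close> the degree \<open>2 * m - 1\<close> is truncated to 0,
    but there the homotopy itself is 0.\<close>
  have 2: "\<delta> (cup (2 * m - 1) (hpow B A e m) A) = cup (2 * m) (cpow B m - cpow A m) A"
  proof (cases m)
    case 0
    then show ?thesis by (simp add: cup_linear cobd_linear)
  next
    case [simp]: (Suc k)
    have "\<delta> (cup (Suc (2 * k)) (hpow B A e m) A) = cup (Suc (Suc (2 * k))) (\<delta> (hpow B A e m)) A"
      using cobd_cup[OF stable hpow_Co[OF B(1) A(1) e(1), of k] A(1)]
      by (simp add: A cup_linear del: hpow.simps)
    moreover have "\<delta> (hpow B A e m) = cpow B m - cpow A m" by (rule Suc.IH)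
    ultimately show ?thesis by (simp del: hpow.simps cpow.simps)
  qed
  show "\<delta> (hpow B A e (Suc m)) = cpow B (Suc m) - cpow A (Suc m)"
    unfolding hpow.simps cpow.simps cobd_linear using 1 2 by (simp add: cup_linear)
qed

lemma hhpow_Co:
  assumes "C \<in> Co 2" "B \<in> Co 2" "A \<in> Co 2" "e' \<in> Co 1" "e \<in> Co 1"
  shows "hhpow C B A e' e (Suc m) \<in> Co (2 * m)"
proof (induction m)
  case 0
  show "hhpow C B A e' e (Suc 0) \<in> Co (2 * 0)" by (simp add: cup_linear)
next
  case (Suc m)
  have "cup (Suc (2 * m)) (hpow C B e' (Suc m)) e \<in> Co (Suc (2 * m) + 1)"
    by (intro cup_cochains hpow_Co assms)
  moreover have "cup (2 * m) (hhpow C B A e' e (Suc m)) A \<in> Co (2 * m + 2)"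
    by (intro cup_cochains Suc assms)
  ultimately show ?case
    unfolding hhpow.simps(2)[of C B A e' e "Suc m"]
    by (intro cochains_add) (simp_all del: hpow.simps hhpow.simps)
qed

text \<open>In the induction the product of \<open>hpow C B e' m\<close> with \<open>A\<close>
  cancels between the two summands of \<open>hhpow\<close>. On the right, the term
  \<open>C^m e'\<close> occurs in two of the homotopies with opposite signs.\<close>

lemma cobd_hhpow:
  assumes C: "C \<in> Co 2" "\<delta> C = 0" and B: "B \<in> Co 2" "\<delta> B = 0" and A: "A \<in> Co 2" "\<delta> A = 0"
    and e': "e' \<in> Co 1" "\<delta> e' = C - B" and e: "e \<in> Co 1" "\<delta> e = B - A"
  shows "\<delta> (hhpow C B A e' e m) = hpow C A (e + e') m - hpow B A e m - hpow C B e' m"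
proof (induction m)
  case 0
  show "\<delta> (hhpow C B A e' e 0) = hpow C A (e + e') 0 - hpow B A e 0 - hpow C B e' 0"
    by (simp add: cobd_linear)
next
  case (Suc m)
  have IH: "\<delta> (hhpow C B A e' e m) = hpow C A (e + e') m - hpow B A e m - hpow C B e' m"
    by (rule Suc.IH)
  show "\<delta> (hhpow C B A e' e (Suc m)) =
    hpow C A (e + e') (Suc m) - hpow B A e (Suc m) - hpow C B e' (Suc m)"
  proof (cases m)
    case 0
    then show ?thesis by (simp add: cobd_linear cup_linear)
  next
    case [simp]: (Suc k)
    have 1: "\<delta> (cup (2 * m - 1) (hpow C B e' m) e) =
        cup (2 * m) (cpow C m - cpow B m) e - cup (2 * m - 1) (hpow C B e' m) (B - A)"
      using cobd_cup[OF stable hpow_Co[OF C(1) B(1) e'(1), of k] e(1)]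
      by (simp add: cobd_hpow[OF C B e', of "Suc k"] e cup_linear del: hpow.simps cpow.simps)
    have 2: "\<delta> (cup (2 * m - 2) (hhpow C B A e' e m) A) = cup (2 * m - 1) (\<delta> (hhpow C B A e' e m)) A"
      using cobd_cup[OF stable hhpow_Co[OF C(1) B(1) A(1) e'(1) e(1), of k] A(1)]
      by (simp add: A cup_linear del: hhpow.simps)
    show ?thesis
      unfolding hhpow.simps(2) hpow.simps(2) cobd_linear 1 2 IH cup_linear
      by (simp add: algebra_simps del: hpow.simps hhpow.simps cpow.simps)
  qed
qed

lemma hpow_zero: "hpow B A 0 m = 0"
proof (induction m)
  case (Suc m)
  then have "hpow B A 0 m = 0" .
  then show "hpow B A 0 (Suc m) = 0" by (simp add: cup_linear)
qed simp

lemma act_cpow: "h \<in> carrier G \<Longrightarrow> act G h (cpow A m) = cpow (act G h A) m"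
  by (induction m) (simp_all add: act_unit_cochain act_cup)

lemma act_hpow: "h \<in> carrier G \<Longrightarrow> act G h (hpow B A e m) = hpow (act G h B) (act G h A) (act G h e) m"
  by (induction m) (simp_all add: act_linear act_cup act_cpow)

text \<open>Each of the \<open>Suc m\<close> summands \<open>Y^k x Y^(m-k)\<close> gives the same
  class. In the induction, \<open>cup_commute_1\<close> moves the \<open>x\<close> of the new
  summand to the front with sign \<open>(-1) ^ d\<close>, since powers of \<open>Y\<close> have even
  degree; the rest is the hypothesis times \<open>Y\<close>.\<close>

lemma cup_hpow_commute:
  fixes Y x u :: "'a list \<Rightarrow> 'k::comm_ring_1"
  assumes Y: "Y \<in> Co 2" "\<delta> Y = 0" and x: "x \<in> Co 1" "\<delta> x = 0" and u: "u \<in> Co d" "\<delta> u = 0"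
  shows "cup d u (hpow Y Y x (Suc m)) -
      scal ((-1) ^ d * of_nat (Suc m)) (cup 1 x (cup d u (cpow Y m)))
    \<in> coboundaries G M (carrier G) (d + 2 * m + 1)"
proof (induction m)
  case 0
  have "cup d u (hpow Y Y x (Suc 0)) = cup d u x" "cup d u (cpow Y 0) = u"
    using cup_unit_left[OF x(1)] cup_unit_right[OF u(1)] by (simp_all add: cup_linear)
  then have "cup d u (hpow Y Y x (Suc 0)) -
      scal ((-1) ^ d * of_nat (Suc 0)) (cup 1 x (cup d u (cpow Y 0))) =
      cup d u x - scal ((-1) ^ d) (cup 1 x u)" by simp
  then show "cup d u (hpow Y Y x (Suc 0)) -
      scal ((-1) ^ d * of_nat (Suc 0)) (cup 1 x (cup d u (cpow Y 0)))
    \<in> coboundaries G M (carrier G) (d + 2 * 0 + 1)"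
    using cup_commute_1[OF stable u x] by (simp only: mult_0_right add_0_right Suc_eq_plus1)
next
  case (Suc m)
  let ?B = "\<lambda>m. coboundaries G M (carrier G) (d + 2 * m + 1) :: ('a list \<Rightarrow> 'k) set"
  let ?H = "hpow Y Y x (Suc m)" and ?c = "(-1) ^ d :: 'k"
  have uY: "cup d u (cpow Y (Suc m)) \<in> Co (d + 2 * Suc m)"
    by (intro cup_cochains u cpow_Co Y)
  moreover have "\<delta> (cup d u (cpow Y (Suc m))) = 0"
    using cobd_cup[OF stable u(1) cpow_Co[OF Y(1), of "Suc m"]] cobd_cpow[OF Y, of "Suc m"] u(2)
    by (simp add: cup_linear del: cpow.simps)
  ultimately have "cup (d + 2 * Suc m) (cup d u (cpow Y (Suc m))) x -
      scal ((-1) ^ (d + 2 * Suc m)) (cup 1 x (cup d u (cpow Y (Suc m)))) \<in> ?B (Suc m)"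
    using cup_commute_1[OF stable _ _ x, of "cup d u (cpow Y (Suc m))" "d + 2 * Suc m"] by simp
  then have 1: "cup (d + 2 * Suc m) (cup d u (cpow Y (Suc m))) x -
      scal ?c (cup 1 x (cup d u (cpow Y (Suc m)))) \<in> ?B (Suc m)"
    by (simp add: power_add del: cpow.simps)
  let ?Z = "cup d u ?H - scal (?c * of_nat (Suc m)) (cup 1 x (cup d u (cpow Y m)))"
  have IH: "?Z \<in> ?B m" by (rule Suc.IH)
  have Yc: "Y \<in> cocycles G M (carrier G) 2" by (simp add: cocycles_def Y)
  have deg: "d + 2 * m + 1 + 2 = d + 2 * Suc m + 1" by simp
  have 2: "cup (d + 2 * m + 1) ?Z Y \<in> ?B (Suc m)"
    by (rule cup_coboundary_left[OF stable IH Yc, unfolded deg])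
  have 3: "cup (d + 2 * m + 1) (cup 1 x (cup d u (cpow Y m))) Y = cup 1 x (cup d u (cpow Y (Suc m)))"
    using cup_assoc[of 1 "d + 2 * m" x "cup d u (cpow Y m)" Y] cup_assoc[of d "2 * m" u "cpow Y m" Y]
    by simp
  have 4: "cup (d + 2 * m + 1) (cup d u ?H) Y = cup d u (cup (2 * Suc m - 1) ?H Y)"
    using cup_assoc[of d "Suc (2 * m)" u ?H Y] by simp
  have 5: "cup d u (hpow Y Y x (Suc (Suc m))) =
      cup (d + 2 * Suc m) (cup d u (cpow Y (Suc m))) x + cup (d + 2 * m + 1) (cup d u ?H) Y"
    unfolding hpow.simps(2)[of Y Y x "Suc m"] cup_linear(6) 4 cup_assoc ..
  have "cup d u (hpow Y Y x (Suc (Suc m))) -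
      scal (?c * of_nat (Suc (Suc m))) (cup 1 x (cup d u (cpow Y (Suc m)))) =
     (cup (d + 2 * Suc m) (cup d u (cpow Y (Suc m))) x - scal ?c (cup 1 x (cup d u (cpow Y (Suc m)))))
     + cup (d + 2 * m + 1) ?Z Y"
    unfolding 5 cup_linear(2) cup_linear(5) 3 of_nat_Suc[of "Suc m"] distrib_left scal_left_distrib
    by (simp only: mult_1_right diff_add_eq_diff_diff_swap add_diff_eq diff_add_eq)
       (rule diff_diff_commute)
  then show "cup d u (hpow Y Y x (Suc (Suc m))) -
      scal (?c * of_nat (Suc (Suc m))) (cup 1 x (cup d u (cpow Y (Suc m)))) \<in> ?B (Suc m)"
    using coboundaries_closed(4)[OF 1 2] by (simp only:)
qed

text \<open>With \<open>A\<^sub>j = Y + j X\<close> and \<open>E\<^sub>j\<close> the homotopy from \<open>(\<sigma>\<^sup>jY)\<^bsup>m+1\<^esup>\<close> to \<open>A\<^sub>j\<^bsup>m+1\<^esup>\<close>, the norm of \<open>u\<^sub>0 Y\<^bsup>m+1\<^esup>\<close> is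
  \<open>\<Sum>\<^sub>j u\<^sub>j A\<^sub>j\<^bsup>m+1\<^esup> - u\<^sub>j \<delta>E\<^sub>j\<close>, whose first part vanishes because its terms depend only on \<open>j\<close> modulo the
  characteristic \<open>p\<close> and \<open>p\<^sup>2\<close> divides the order of \<open>G/M\<close>.  Up to coboundaries and another such sum, \<open>\<sigma> - 1\<close> turns \<open>\<Sum>\<^sub>j u\<^sub>j E\<^sub>j\<close> into a telescoping sum.\<close>
lemma norm_homotopy:
  fixes x X Y :: "'a list \<Rightarrow> 'k::comm_ring_1" and u :: "'k \<Rightarrow> 'a list \<Rightarrow> 'k"
  assumes sums: "\<And>F :: 'k \<Rightarrow> 'a list \<Rightarrow> 'k. (\<Sum>j<order (G Mod M). F (of_nat j)) = 0"
    and q: "of_nat (order (G Mod M)) = (0 :: 'k)"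
    and X: "X \<in> Co 2" "\<delta> X = 0" "act G g X = X"
    and Y: "Y \<in> Co 2" "\<delta> Y = 0"
    and x: "x \<in> Co 1" "\<delta> x = 0"
    and e: "\<And>j. e j \<in> Co 1" "\<And>j. act G (g [^] j) Y = Y + scal (of_nat j) X - \<delta> (e j)"
      "\<And>j. act G g (e j) = e (Suc j) - e 1" "e 0 = 0" "e (order (G Mod M)) = x"
    and u: "\<And>c. u c \<in> Co d" "\<And>c. \<delta> (u c) = 0" "\<And>j::nat. act G (g [^] j) (u 0) = u (of_nat j)"
  shows "\<exists>h \<in> Co (d + 2 * m + 1).
    (\<Sum>j<order (G Mod M). act G (g [^] j) (cup d (u 0) (cpow Y (Suc m)))) + \<delta> h = 0 \<and>
    act G g h - h - scal (of_nat (Suc m)) (cup 1 x (cup d (u 0) (cpow Y m)))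
      \<in> coboundaries G M (carrier G) (d + 2 * m + 1)"
proof -
  define N where "N = order (G Mod M)"
  \<comment> \<open>The sign picked up when \<open>\<delta>\<close> passes a cocycle of degree
    \<open>d\<close>; the same factor in \<open>h\<close> undoes it.\<close>
  define \<epsilon> :: 'k where "\<epsilon> = (-1) ^ d"
  have \<epsilon>: "\<epsilon> * \<epsilon> = 1" by (simp add: \<epsilon>_def flip: power_mult_distrib)
  define A where "A = (\<lambda>c. Y + scal c X)"
  define Z where "Z = (\<lambda>j::nat. act G (g [^] j) Y)"
  define E where "E = (\<lambda>j. hpow (A (of_nat j)) (Z j) (e j) (Suc m))"
  define h where "h = scal \<epsilon> (\<Sum>j<N. cup d (u (of_nat j)) (E j))"
  have A: "A c \<in> Co 2" "\<delta> (A c) = 0" for c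
    using X Y by (simp_all add: A_def cochains_intros cobd_linear)
  have Z: "Z j \<in> Co 2" "\<delta> (Z j) = 0" for j
    using Y g by (simp_all add: Z_def act_Co act_linear flip: act_cobd)
  have AZ: "\<delta> (e j) = A (of_nat j) - Z j" for j
    by (simp add: A_def Z_def e(2))
  have E: "E j \<in> Co (2 * m + 1)" for j
    unfolding E_def using hpow_Co[OF A(1) Z(1) e(1)] by simp
  have \<delta>E: "\<delta> (E j) = cpow (A (of_nat j)) (Suc m) - cpow (Z j) (Suc m)" for j
    unfolding E_def by (rule cobd_hpow[OF A Z e(1) AZ])
  have \<delta>cup: "\<delta> (cup d (u c) f) = scal \<epsilon> (cup d (u c) (\<delta> f))" if "f \<in> Co s" for c f s
    using cobd_cup[OF stable u(1) that] by (simp add: u cup_linear \<epsilon>_def)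
  have h: "h \<in> Co (d + (2 * m + 1))"
    unfolding h_def by (intro cochains_scal cochains_sum cup_cochains u E)
  have act_u: "act G g (u (of_nat j)) = u (of_nat (Suc j))" for j
    using u(3)[of j] u(3)[of "Suc j"] act_pow_Suc[of j "u 0"] by simp
  have act_Z: "act G g (Z j) = Z (Suc j)" for j
    by (simp only: Z_def act_pow_Suc)
  have act_A: "act G g (A (of_nat j)) = A (of_nat (Suc j)) - \<delta> (e 1)" for j
    using e(2)[of 1] X(3) g by (simp add: A_def act_linear scal_left_distrib algebra_simps)

  \<comment> \<open>The norm has terms \<open>u_j Z_j^(m+1)\<close>, and \<open>\<delta>E\<close>
    replaces the power of \<open>Z j\<close> by that of \<open>A_j\<close> minus
    \<open>\<delta> (E j)\<close>.\<close>
  have "(\<Sum>j<N. act G (g [^] j) (cup d (u 0) (cpow Y (Suc m)))) =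
      (\<Sum>j<N. cup d (u (of_nat j)) (cpow (A (of_nat j)) (Suc m)) - cup d (u (of_nat j)) (\<delta> (E j)))"
    using g by (intro sum.cong) (simp_all add: act_cup act_cpow u(3) \<delta>E cup_linear Z_def del: cpow.simps)
  also have "\<dots> = - (\<Sum>j<N. cup d (u (of_nat j)) (\<delta> (E j)))"
    unfolding sum_subtractf N_def sums[of "\<lambda>c. cup d (u c) (cpow (A c) (Suc m))"] by simp
  also have "(\<Sum>j<N. cup d (u (of_nat j)) (\<delta> (E j))) = \<delta> h"
    unfolding h_def cobd_linear cobd_sum \<delta>cup[OF E] scal_sum scal_simps \<epsilon> ..
  finally have 1: "(\<Sum>j<N. act G (g [^] j) (cup d (u 0) (cpow Y (Suc m)))) + \<delta> h = 0"
    by (simp only: eq_neg_iff_add_eq_0)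

  \<comment> \<open>\<sigma> carries \<open>E j\<close> to a homotopy from the power of
    \<open>Z (Suc j)\<close> to that of \<open>A_(j+1) - \<delta> (e 1)\<close>, and
    \<open>P\<close> continues from there to the power of \<open>A_(j+1)\<close>. \<open>H\<close>
    compares this composite with \<open>E (Suc j)\<close>.\<close>
  define P where "P = (\<lambda>c. hpow (A c) (A c - \<delta> (e 1)) (e 1) (Suc m))"
  define H where "H = (\<lambda>j. hhpow (A (of_nat (Suc j))) (A (of_nat (Suc j)) - \<delta> (e 1)) (Z (Suc j))
    (e 1) (e (Suc j) - e 1) (Suc m))"
  have A1: "A c - \<delta> (e 1) \<in> Co 2" "\<delta> (A c - \<delta> (e 1)) = 0" for c
    using A coboundary_Co[OF e(1), of 1]
    by (simp_all add: cochains_diff cobd_linear cobd_cobd numeral_2_eq_2)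
  have H: "H j \<in> Co (2 * m)" for j
    unfolding H_def by (intro hhpow_Co A A1 Z e cochains_diff)
  have \<delta>H: "\<delta> (H j) = E (Suc j) - act G g (E j) - P (of_nat (Suc j))" for j
  proof -
    have "\<delta> (e 1) = A (of_nat (Suc j)) - (A (of_nat (Suc j)) - \<delta> (e 1))" by simp
    moreover have "\<delta> (e (Suc j) - e 1) = A (of_nat (Suc j)) - \<delta> (e 1) - Z (Suc j)"
      unfolding cobd_linear AZ[of "Suc j"] by (rule diff_diff_commute)
    ultimately have "\<delta> (H j) = hpow (A (of_nat (Suc j))) (Z (Suc j)) (e (Suc j) - e 1 + e 1) (Suc m)
        - hpow (A (of_nat (Suc j)) - \<delta> (e 1)) (Z (Suc j)) (e (Suc j) - e 1) (Suc m)
        - P (of_nat (Suc j))"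
      unfolding H_def P_def by (intro cobd_hhpow A A1 Z e cochains_diff)
    then show ?thesis
      unfolding E_def act_hpow[OF g] act_A act_Z e(3) by (simp only: diff_add_cancel)
  qed
  let ?T = "\<lambda>j. cup d (u (of_nat j)) (E j)"
  let ?S = "\<Sum>j<N. cup d (u (of_nat (Suc j))) (H j)"
  have "act G g h = scal \<epsilon> (\<Sum>j<N. cup d (u (of_nat (Suc j))) (act G g (E j)))"
    by (simp only: h_def act_linear act_sum act_cup act_u)
  also have "\<dots> = scal \<epsilon> (\<Sum>j<N. ?T (Suc j) - cup d (u (of_nat (Suc j))) (P (of_nat (Suc j))) -
      cup d (u (of_nat (Suc j))) (\<delta> (H j)))"
    by (intro arg_cong[of _ _ "scal \<epsilon>"] sum.cong) (simp_all only: \<delta>H cup_linear, simp)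
  also have "\<dots> = scal \<epsilon> (\<Sum>j<N. ?T (Suc j)) -
      scal \<epsilon> (\<Sum>j<N. cup d (u (of_nat (Suc j))) (P (of_nat (Suc j)))) -
      scal \<epsilon> (\<Sum>j<N. cup d (u (of_nat (Suc j))) (\<delta> (H j)))"
    by (simp only: sum_subtractf scal_right_diff)
  \<comment> \<open>These terms depend on \<open>j\<close> only through its image in the
    coefficients, so \<open>sums\<close> applies after translating the argument by 1.\<close>
  also have "(\<Sum>j<N. cup d (u (of_nat (Suc j))) (P (of_nat (Suc j)))) = 0"
    using sums[of "\<lambda>c. cup d (u (1 + c)) (P (1 + c))"] by (simp only: N_def of_nat_Suc)
  also have "scal \<epsilon> (\<Sum>j<N. cup d (u (of_nat (Suc j))) (\<delta> (H j))) = \<delta> ?S"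
    unfolding cobd_sum \<delta>cup[OF H] scal_sum ..
  finally have "act G g h = scal \<epsilon> (\<Sum>j<N. ?T (Suc j)) - \<delta> ?S"
    by (simp only: scal_simps diff_zero)
  then have "act G g h - h = scal \<epsilon> (\<Sum>j<N. ?T (Suc j) - ?T j) - \<delta> ?S"
    by (simp only: h_def sum_subtractf scal_right_diff diff_diff_commute)
  also have "(\<Sum>j<N. ?T (Suc j) - ?T j) = ?T N - ?T 0"
    by (rule sum_lessThan_telescope)
  also have "?T 0 = 0"
    unfolding E_def e(4) hpow_zero cup_linear ..
  \<comment> \<open>After a full period \<open>A_N\<close> and \<open>Z N\<close> are both
    \<open>Y\<close>, since \<open>N\<close> is 0 in the coefficients and \<open>g [^] N\<close>
    acts trivially, while \<open>e N\<close> is \<open>x\<close>.\<close>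
  also have "?T N = cup d (u 0) (hpow Y Y x (Suc m))"
    using q e(5) act_M[OF g_pow Y(1)] unfolding E_def N_def A_def Z_def by simp
  finally have 2: "act G g h - h = scal \<epsilon> (cup d (u 0) (hpow Y Y x (Suc m))) - \<delta> ?S"
    by (simp only: diff_zero)
  let ?B = "coboundaries G M (carrier G) (d + 2 * m + 1) :: ('a list \<Rightarrow> 'k) set"
  have "?S \<in> Co (d + 2 * m)"
    by (intro cochains_sum cup_cochains u H)
  then have "\<delta> ?S \<in> ?B"
    by (simp only: Suc_eq_plus1[symmetric] coboundaries.simps(2) imageI)
  moreover have "scal \<epsilon> (cup d (u 0) (hpow Y Y x (Suc m)) -
      scal (\<epsilon> * of_nat (Suc m)) (cup 1 x (cup d (u 0) (cpow Y m)))) \<in> ?B"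
    unfolding \<epsilon>_def by (intro coboundaries_scal cup_hpow_commute Y x u)
  ultimately have 3: "scal \<epsilon> (cup d (u 0) (hpow Y Y x (Suc m)) -
      scal (\<epsilon> * of_nat (Suc m)) (cup 1 x (cup d (u 0) (cpow Y m)))) - \<delta> ?S \<in> ?B"
    by (intro coboundaries_closed(2))
  have 4: "act G g h - h - scal (of_nat (Suc m)) (cup 1 x (cup d (u 0) (cpow Y m))) =
      scal \<epsilon> (cup d (u 0) (hpow Y Y x (Suc m)) -
        scal (\<epsilon> * of_nat (Suc m)) (cup 1 x (cup d (u 0) (cpow Y m)))) - \<delta> ?S"
    unfolding 2 scal_right_diff scal_simps mult.assoc[symmetric] \<epsilon> mult_1 by (rule diff_diff_commute)
  show ?thesis
    using 1 3[folded 4] h unfolding N_def by (intro bexI[of _ h] conjI) (simp_all only: add.assoc)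
qed

text \<open>Both sides are cosets of one \<open>lhs_B\<close> in column 3, so it suffices to compare
  leading components on \<open>M\<close>; \<open>norm_homotopy\<close> does this. Assumption
  \<open>dm\<close> makes \<open>d + 2 * m\<close> positive, which leaves a degree for the
  correction of the second bar class.\<close>

lemma d2_formula:
  fixes x X Y :: "'a list \<Rightarrow> 'k::comm_ring_1" and u :: "'k \<Rightarrow> 'a list \<Rightarrow> 'k"
  assumes sums: "\<And>F :: 'k \<Rightarrow> 'a list \<Rightarrow> 'k. (\<Sum>j<order (G Mod M). F (of_nat j)) = 0"
    and q: "of_nat (order (G Mod M)) = (0 :: 'k)"
    and X: "X \<in> Co 2" "\<delta> X = 0" "act G g X = X"
    and Y: "Y \<in> Co 2" "\<delta> Y = 0"
    and x: "x \<in> Co 1" "\<delta> x = 0" "act G g x = x"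
    and e: "\<And>j. e j \<in> Co 1" "\<And>j. act G (g [^] j) Y = Y + scal (of_nat j) X - \<delta> (e j)"
      "\<And>j. act G g (e j) = e (Suc j) - e 1" "e 0 = 0" "e (order (G Mod M)) = x"
    and u: "\<And>c. u c \<in> Co d" "\<And>c. \<delta> (u c) = 0" "\<And>j::nat. act G (g [^] j) (u 0) = u (of_nat j)"
    and dm: "0 < d \<or> 0 < m"
  defines "\<phi> \<equiv> \<lambda>m. restr M (cup d (u 0) (cpow Y m)) +o coboundaries G M M (d + 2 * m)"
  shows "lhs_diff G M g 2 1 (d + 2 * Suc m) (E2_bar G M g 1 (d + 2 * Suc m) (\<phi> (Suc m))) =
    lhs_scale G M g 2 3 (d + 2 * m + 1) (- of_nat (Suc m))
      (E2_mult G M g 1 (d + 2 * m + 1) 2 0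
        (E2_mult G M g 0 1 1 (d + 2 * m) (E2_bar G M g 0 1 (restr M x +o coboundaries G M M 1))
          (E2_bar G M g 1 (d + 2 * m) (\<phi> m)))
        (E2_bar G M g 2 0 (cohom_one G M)))"
proof -
  note hom = norm_homotopy[OF sums q X Y x(1,2) e u]
  have f: "cup d (u 0) (cpow Y k) \<in> Co (d + 2 * k)" "\<delta> (cup d (u 0) (cpow Y k)) = 0" for k
    using cup_cochains[OF u(1) cpow_Co[OF Y(1)]] cobd_cup[OF stable u(1) cpow_Co[OF Y(1)]]
    by (simp_all add: u cobd_cpow[OF Y] cup_linear)
  obtain h where h: "h \<in> Co (d + 2 * m + 1)"
      "(\<Sum>j<order (G Mod M). act G (g [^] j) (cup d (u 0) (cpow Y (Suc m)))) + \<delta> h = 0"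
      "act G g h - h - scal (of_nat (Suc m)) (cup 1 x (cup d (u 0) (cpow Y m)))
        \<in> coboundaries G M (carrier G) (d + 2 * m + 1)"
    using hom by blast
  define w where "w = single 1 (cup d (u 0) (cpow Y (Suc m))) + single 2 h"
  have eq: "Suc (d + 2 * m + 1) = d + 2 * Suc m" by simp
  note w = E2_bar_1_norm[OF f(1)[of "Suc m", folded eq] f(2) h(1,2), folded w_def, unfolded eq]
  obtain s where s: "d + 2 * m = Suc s" using dm by (cases "d + 2 * m") auto
  \<comment> \<open>For \<open>m = 0\<close> the norm of \<open>u 0\<close> vanishes outright by
    \<open>sums\<close>; otherwise \<open>norm_homotopy\<close> for the smaller exponent supplies
    \<open>h'\<close>.\<close>
  have "\<exists>h'\<in>Co s. (\<Sum>j<order (G Mod M). act G (g [^] j) (cup d (u 0) (cpow Y m))) + \<delta> h' = 0"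
  proof (cases m)
    case 0
    have "(\<Sum>j<order (G Mod M). act G (g [^] j) (cup d (u 0) (cpow Y m))) =
        (\<Sum>j<order (G Mod M). u (of_nat j))"
      using g u(1) by (simp add: 0 act_cup act_unit_cochain u(3) cup_unit_right[OF u(1)])
    then show ?thesis
      using sums[of u] by (intro bexI[of _ 0]) (simp_all add: cobd_linear)
  next
    case (Suc k)
    then show ?thesis using hom[of k] s by auto
  qed
  then obtain h' where h': "h' \<in> Co s"
      "(\<Sum>j<order (G Mod M). act G (g [^] j) (cup d (u 0) (cpow Y m))) + \<delta> h' = 0"
    by blast
  define w' where "w' = single 1 (cup d (u 0) (cpow Y m)) + single 2 h'"
  note w' = E2_bar_1_norm[OF f(1)[of m, unfolded s] f(2) h', folded w'_def s]
  have w'1: "w' 1 = cup d (u 0) (cpow Y m)" by (simp add: w'_def single_apply)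
  define v where "v = (\<lambda>i. scal (- of_nat (Suc m)) (shift2 (cup_tot x w') i))"
  have cZ: "cup_tot x w' \<in> lhs_Z G M g 2 1 (1 + (d + 2 * m + 1))"
    using cup_tot_filt[OF x] w'(1) by (simp add: lhs_Z_def)
  have B: "lhs_B G M g 2 1 (1 + (1 + (d + 2 * m))) = (lhs_B G M g 2 1 (1 + (d + 2 * m + 1)) ::
      (nat \<Rightarrow> 'a list \<Rightarrow> 'k) set)" by simp
  have rhs: "lhs_scale G M g 2 3 (d + 2 * m + 1) (- of_nat (Suc m))
      (E2_mult G M g 1 (d + 2 * m + 1) 2 0
        (E2_mult G M g 0 1 1 (d + 2 * m) (E2_bar G M g 0 1 (restr M x +o coboundaries G M M 1))
          (E2_bar G M g 1 (d + 2 * m) (\<phi> m)))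
        (E2_bar G M g 2 0 (cohom_one G M))) = v +o lhs_B G M g 2 3 (3 + (d + 2 * m + 1))"
    unfolding \<phi>_def w'(3) E2_mult_cup_tot[OF x w'(1)] B E2_mult_shift2[OF q cZ] lhs_scale_coset v_def ..
  have Dw: "D w \<in> filt_cocycles G M g 3 5 (3 + (d + 2 * m + 1))"
    using filt_D[of w 1 3 "1 + (d + 2 * Suc m)" 5] w(1) by (simp add: lhs_Z_def eval_nat_numeral)
  have v: "v \<in> filt_cocycles G M g 3 5 (3 + (d + 2 * m + 1))"
    using shift2_filt[of "cup_tot x w'" 1 3 "1 + (d + 2 * m + 1)"] cZ
    unfolding v_def by (intro filt_linear) (simp add: lhs_Z_def eval_nat_numeral)
  \<comment> \<open>The minus sign of the scalar cancels against that of \<open>cup_tot\<close> in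
    column 1.\<close>
  have "v 3 = scal (of_nat (Suc m)) (cup 1 x (cup d (u 0) (cpow Y m)))"
    using w'1 by (simp add: v_def numeral_3_eq_3 cup_tot_def del: of_nat_Suc)
  then have "(D w - v) 3 \<in> coboundaries G M (carrier G) (d + 2 * m + 1)"
    using h(3) by (simp add: w(2) single_apply)
  then have "D w - v \<in> lhs_B G M g 2 3 (3 + (d + 2 * m + 1))"
    using Dw v by (intro lhs_B_if_restr_coboundary restr_coboundaries)
      (simp_all add: lhs_Z_def filt_linear)
  moreover have "lhs_diff G M g 2 1 (d + 2 * Suc m) (E2_bar G M g 1 (d + 2 * Suc m) (\<phi> (Suc m))) =
      D w +o lhs_B G M g 2 3 (3 + (d + 2 * m + 1))"
    unfolding \<phi>_def w(3) lhs_diff_coset[OF w(1)] by (simp add: eval_nat_numeral)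
  ultimately show ?thesis
    unfolding rhs by (simp add: coset_eqI lhs_B_add_subgroup)
qed

end

section \<open>Cochains of the Heisenberg group\<close>

lemma heis_M_iff: "q > 0 \<Longrightarrow> (t, j, k) \<in> heis_M q \<longleftrightarrow> t = 0 \<and> j \<in> {0..<int q} \<and> k \<in> {0..<int q}"
  by (auto simp: heis_M_def carrier_integer_mod_group)

lemma heis_M_subset: "q > 0 \<Longrightarrow> heis_M q \<subseteq> carrier (Heis q)"
  by (auto simp: heis_M_def carrier_integer_mod_group carrier_Heis)

lemma inv_Heis_M:
  assumes "q > 0" "(0, j, k) \<in> heis_M q"
  shows "inv\<^bsub>Heis q\<^esub> (0, j, k) = (0, (- j) mod int q, (- k) mod int q)"
proof -
  interpret group "Heis q" by (rule group_Heis) (fact assms(1))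
  have "(0, (- j) mod int q, (- k) mod int q) \<otimes>\<^bsub>Heis q\<^esub> (0, j, k) = \<one>\<^bsub>Heis q\<^esub>"
    by (simp add: Heis_mult one_Heis mod_add_left_eq)
  then show ?thesis
    using assms by (intro inv_equality) (auto simp: carrier_Heis heis_M_iff)
qed

lemma fst_Heis_mult: "fst (x \<otimes>\<^bsub>Heis q\<^esub> y) = (fst x + fst y) mod int q"
  by (cases x; cases y) (simp add: Heis_mult)

lemma heis_M_iff_fst: "q > 0 \<Longrightarrow> x \<in> heis_M q \<longleftrightarrow> x \<in> carrier (Heis q) \<and> fst x = 0"
  by (cases x) (auto simp: heis_M_iff carrier_Heis)

text \<open>\<open>heis_M q\<close> is the kernel of the first coordinate, which is additive modulo
  \<open>q\<close>.\<close>

lemma heis_M_normal: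
  assumes "q > 0"
  shows "heis_M q \<lhd> Heis q"
proof -
  interpret group "Heis q" by (rule group_Heis) (fact assms)
  have inv: "(fst x + fst (inv\<^bsub>Heis q\<^esub> x)) mod int q = 0" if "x \<in> carrier (Heis q)" for x
    using r_inv[OF that] by (simp flip: fst_Heis_mult add: one_Heis)
  have range: "fst x \<in> {0..<int q}" if "x \<in> carrier (Heis q)" for x
    using that assms by (auto simp: carrier_Heis)
  have "subgroup (heis_M q) (Heis q)"
  proof (rule subgroupI)
    show "heis_M q \<noteq> {}"
      using assms by (auto simp: heis_M_def carrier_integer_mod_group)
    fix a assume a: "a \<in> heis_M q"
    show "inv\<^bsub>Heis q\<^esub> a \<in> heis_M q"
      using a inv[of a] range[of "inv\<^bsub>Heis q\<^esub> a"] assms by (simp add: heis_M_iff_fst)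
    fix b assume "b \<in> heis_M q"
    with a show "a \<otimes>\<^bsub>Heis q\<^esub> b \<in> heis_M q"
      using assms by (simp add: heis_M_iff_fst fst_Heis_mult)
  qed (rule heis_M_subset[OF assms])
  moreover have "x \<otimes>\<^bsub>Heis q\<^esub> h \<otimes>\<^bsub>Heis q\<^esub> inv\<^bsub>Heis q\<^esub> x \<in> heis_M q"
    if "x \<in> carrier (Heis q)" "h \<in> heis_M q" for x h
    using that assms inv[of x] by (simp add: heis_M_iff_fst fst_Heis_mult mod_add_left_eq)
  ultimately show ?thesis by (simp add: normal_inv_iff)
qed

text \<open>Lagrange, with \<open>q ^ 3\<close> elements in the group and \<open>q ^ 2\<close> in
  the subgroup.\<close>

lemma order_Heis_Mod:
  assumes "q > 0"
  shows "order (Heis q Mod heis_M q) = q"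
proof -
  interpret group "Heis q" by (rule group_Heis) (fact assms)
  have "card (rcosets\<^bsub>Heis q\<^esub> heis_M q) * card (heis_M q) = order (Heis q)"
    using assms heis_M_normal[OF assms]
    by (intro lagrange_finite normal_imp_subgroup) (simp_all add: carrier_Heis)
  then have "card (rcosets\<^bsub>Heis q\<^esub> heis_M q) * (q * q) = q * (q * q)"
    using assms
    by (simp add: order_def carrier_Heis heis_M_def carrier_integer_mod_group card_cartesian_product)
  then show ?thesis using assms by (simp add: order_def FactGroup_def)
qed

lemma heis_sigma_pow:
  assumes "q > 1"
  shows "heis_sigma [^]\<^bsub>Heis q\<^esub> i = (int i mod int q, 0, 0)"
proof (induction i)
  case 0
  interpret group "Heis q" by (rule group_Heis) (use assms in simp)
  show ?case by (simp add: one_Heis)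
next
  case (Suc i)
  interpret group "Heis q" by (rule group_Heis) (use assms in simp)
  show ?case using Suc by (simp add: heis_sigma_def Heis_mult mod_simps add.commute)
qed

locale heis =
  fixes q :: nat
  assumes q: "q > 1"

sublocale heis \<subseteq> cyclic_extension "Heis q" "heis_M q" heis_sigma
proof -
  have q0: "q > 0" using q by simp
  show "cyclic_extension (Heis q) (heis_M q) heis_sigma"
  proof (intro cyclic_extension.intro cyclic_extension_axioms.intro)
    show "heis_sigma [^]\<^bsub>Heis q\<^esub> order (Heis q Mod heis_M q) \<in> heis_M q"
      using q by (simp add: order_Heis_Mod heis_sigma_pow heis_M_iff)
  qed (use q q0 in \<open>auto simp: group_Heis heis_M_normal heis_sigma_def carrier_Heis\<close>)
qed

context heis
begin

section \<open>Integral cochains and the action of \<sigma> on them\<close>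

lemma q_pos: "q > 0"
  using q by simp

text \<open>\<open>(t, j, k) = a\<^sup>J b\<^sup>L \<sigma>\<^sup>t\<close>, where \<open>L\<close> only matters modulo \<open>q\<close>.\<close>
definition J :: "heis_elt \<Rightarrow> int" where "J = (\<lambda>(t, j, k). j)"
definition L :: "heis_elt \<Rightarrow> int" where "L = (\<lambda>(t, j, k). k - t * j)"

lemma J_mult_M:
  assumes "m \<in> heis_M q"
  shows "[J (m \<otimes>\<^bsub>Heis q\<^esub> x) = J m + J x] (mod int q)"
  by (cases m; cases x) (simp add: J_def Heis_mult cong_def)

text \<open>Left multiplication by \<open>(0, j', k')\<close> adds \<open>k' + t * j'\<close> to the
  last coordinate; the correction \<open>- t * j\<close> in \<open>L\<close> removes the part
  \<open>t * j'\<close>.\<close>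

lemma L_mult_M:
  assumes "m \<in> heis_M q"
  shows "[L (m \<otimes>\<^bsub>Heis q\<^esub> x) = L m + L x] (mod int q)"
proof -
  obtain j' k' where m: "m = (0, j', k')" using assms q_pos by (cases m) (auto simp: heis_M_iff)
  obtain t j k where x: "x = (t, j, k)" by (cases x)
  have "[(k' + k + t * j') mod int q - t mod int q * ((j' + j) mod int q) =
      (k' + k + t * j') - t * (j' + j)] (mod int q)"
    by (intro cong_diff cong_mult) (simp_all add: cong_def)
  then show ?thesis by (simp add: m x L_def Heis_mult algebra_simps)
qed

text \<open>The product only lowers \<open>t\<close> by \<open>i\<close>, which \<open>L\<close>
  sees as a gain of \<open>i * j\<close>.\<close>

lemma inv_sigma_pow_mult:
  assumes "x \<in> carrier (Heis q)"
  shows "J (inv\<^bsub>Heis q\<^esub> (heis_sigma [^]\<^bsub>Heis q\<^esub> i) \<otimes>\<^bsub>Heis q\<^esub> x) = J x"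
    and "[L (inv\<^bsub>Heis q\<^esub> (heis_sigma [^]\<^bsub>Heis q\<^esub> i) \<otimes>\<^bsub>Heis q\<^esub> x) = L x + int i * J x] (mod int q)"
proof -
  have "inv\<^bsub>Heis q\<^esub> (int i mod int q, 0, 0) = ((- int i) mod int q, 0, 0)"
    using q_pos by (intro inv_equality) (simp_all add: Heis_mult one_Heis carrier_Heis mod_simps)
  moreover obtain t j k where x: "x = (t, j, k)" by (cases x)
  moreover have "j mod int q = j" "k mod int q = k"
    using assms q_pos by (auto simp: x carrier_Heis)
  ultimately have eq: "inv\<^bsub>Heis q\<^esub> (heis_sigma [^]\<^bsub>Heis q\<^esub> i) \<otimes>\<^bsub>Heis q\<^esub> x = ((t - int i) mod int q, j, k)"
    using q by (simp add: heis_sigma_pow Heis_mult mod_simps)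
  show "J (inv\<^bsub>Heis q\<^esub> (heis_sigma [^]\<^bsub>Heis q\<^esub> i) \<otimes>\<^bsub>Heis q\<^esub> x) = J x"
    unfolding eq by (simp add: J_def x)
  have "[k - (t - int i) mod int q * j = k - (t - int i) * j] (mod int q)"
    by (intro cong_diff cong_mult) (simp_all add: cong_def)
  then show "[L (inv\<^bsub>Heis q\<^esub> (heis_sigma [^]\<^bsub>Heis q\<^esub> i) \<otimes>\<^bsub>Heis q\<^esub> x) = L x + int i * J x] (mod int q)"
    unfolding eq by (simp add: J_def L_def x algebra_simps)
qed

text \<open>Taking residues makes the values depend on \<open>\<phi>\<close> modulo \<open>q\<close>
  only, hence truly \<open>M\<close>-invariant. The price is that the cocycle condition holds only
  modulo \<open>q\<close>.\<close>

definition lift1 :: "(heis_elt \<Rightarrow> int) \<Rightarrow> heis_elt list \<Rightarrow> int" where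
  "lift1 \<phi> = restr (carrier (Heis q))
     (\<lambda>xs. if length xs = 2 then (\<phi> (xs ! 1) - \<phi> (xs ! 0)) mod int q else 0)"

lemma lift1_Co:
  assumes "\<And>m x. m \<in> heis_M q \<Longrightarrow> [\<phi> (m \<otimes>\<^bsub>Heis q\<^esub> x) = \<phi> m + \<phi> x] (mod int q)"
  shows "lift1 \<phi> \<in> Co 1"
proof (rule cochainsI)
  fix m xs assume m: "m \<in> heis_M q" and xs: "set xs \<subseteq> carrier (Heis q)"
  have "[\<phi> (m \<otimes>\<^bsub>Heis q\<^esub> b) - \<phi> (m \<otimes>\<^bsub>Heis q\<^esub> a) = (\<phi> m + \<phi> b) - (\<phi> m + \<phi> a)] (mod int q)" for a b
    by (intro cong_diff assms m)
  moreover have "set (map (\<lambda>x. m \<otimes>\<^bsub>Heis q\<^esub> x) xs) \<subseteq> carrier (Heis q)"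
    unfolding set_map image_subset_iff using stable[OF m] xs by blast
  ultimately show "lift1 \<phi> (map (\<lambda>x. m \<otimes>\<^bsub>Heis q\<^esub> x) xs) = lift1 \<phi> xs"
    using xs by (simp add: lift1_def restr_apply cong_def del: set_map)
qed (auto simp: lift1_def restr_apply split: if_splits)

lemma cobd_lift1_dvd: "int q dvd cobd (carrier (Heis q)) (lift1 \<phi>) xs"
proof (cases "set xs \<subseteq> carrier (Heis q) \<and> length xs = 3")
  case True
  then obtain a b c where xs: "xs = [a, b, c]"
    by (auto simp: numeral_3_eq_3 length_Suc_conv)
  have "[(\<phi> c - \<phi> b) mod int q - ((\<phi> c - \<phi> a) mod int q - (\<phi> b - \<phi> a) mod int q) =
      (\<phi> c - \<phi> b) - ((\<phi> c - \<phi> a) - (\<phi> b - \<phi> a))] (mod int q)"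
    by (intro cong_diff) (simp_all add: cong_def)
  then show ?thesis
    using True by (simp add: xs cobd_face_sum restr_apply face_sum_Cons lift1_def cong_0_iff)
next
  case False
  have "lift1 \<phi> (take i xs @ drop (Suc i) xs) = 0" if "length xs \<noteq> 3" "i < length xs" for i
    using that by (auto simp: lift1_def restr_apply)
  then show ?thesis
    using False by (auto simp: cobd_face_sum restr_apply face_sum_def)
qed

lemma act_lift1:
  fixes i :: nat
  assumes "\<And>x. x \<in> carrier (Heis q) \<Longrightarrow>
    [\<phi> (inv\<^bsub>Heis q\<^esub> (heis_sigma [^]\<^bsub>Heis q\<^esub> i) \<otimes>\<^bsub>Heis q\<^esub> x) = \<psi> x] (mod int q)"
  shows "act (Heis q) (heis_sigma [^]\<^bsub>Heis q\<^esub> i) (lift1 \<phi>) = lift1 \<psi>"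
proof
  fix xs
  let ?s = "inv\<^bsub>Heis q\<^esub> (heis_sigma [^]\<^bsub>Heis q\<^esub> i)"
  have s: "?s \<in> carrier (Heis q)" using g by simp
  have "[\<phi> (?s \<otimes>\<^bsub>Heis q\<^esub> b) - \<phi> (?s \<otimes>\<^bsub>Heis q\<^esub> a) = \<psi> b - \<psi> a] (mod int q)"
    if "a \<in> carrier (Heis q)" "b \<in> carrier (Heis q)" for a b
    by (intro cong_diff assms that)
  note * = this
  show "act (Heis q) (heis_sigma [^]\<^bsub>Heis q\<^esub> i) (lift1 \<phi>) xs = lift1 \<psi> xs"
  proof (cases "set xs \<subseteq> carrier (Heis q) \<and> length xs = 2")
    case True
    then obtain a b where xs: "xs = [a, b]"
      by (auto simp: numeral_2_eq_2 length_Suc_conv)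
    then show ?thesis
      using True s *[of a b] by (simp add: lift1_def act_def restr_apply cong_def)
  qed (auto simp: lift1_def act_def restr_apply)
qed

text \<open>\<open>X'\<close> and \<open>Y'\<close> are the carry cocycles of \<open>x'\<close> and
  \<open>y'\<close>. The cochain \<open>e' i\<close> measures by how many multiples of
  \<open>q\<close> the translate of \<open>y'\<close> differs from \<open>y' + i x'\<close>.\<close>

definition "x' = lift1 J"
definition "y' = lift1 L"
definition "X' = (\<lambda>xs. cobd (carrier (Heis q)) x' xs div int q)"
definition "Y' = (\<lambda>xs. cobd (carrier (Heis q)) y' xs div int q)"
definition "e' (i::nat) = (\<lambda>xs. (y' + scal (int i) x' - act (Heis q) (heis_sigma [^]\<^bsub>Heis q\<^esub> i) y') xs div int q)"

lemma cochains_div: "f \<in> cochains G' M' X s \<Longrightarrow> (\<lambda>xs. f xs div (c::int)) \<in> cochains G' M' X s"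
  by (rule cochainsI) (use cochainsD[of f G' M' X s] in \<open>force+\<close>)

text \<open>Integral cochains have no torsion, so identities for \<open>X'\<close>,
  \<open>Y'\<close> and \<open>e'\<close> can be checked after multiplication by \<open>q\<close>,
  where they become identities for \<open>x'\<close> and \<open>y'\<close>.\<close>

lemma scal_q_cancel: "scal (int q) f = scal (int q) h \<Longrightarrow> f = h"
  using q by (auto simp: fun_eq_iff)

lemma integral_cochains:
  shows x'_Co: "x' \<in> Co 1" and y'_Co: "y' \<in> Co 1"
    and X'_Co: "X' \<in> Co 2" and Y'_Co: "Y' \<in> Co 2" and e'_Co: "e' i \<in> Co 1"
proof -
  show x: "x' \<in> Co 1" and y: "y' \<in> Co 1"
    unfolding x'_def y'_def by (intro lift1_Co J_mult_M L_mult_M; assumption)+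
  show "X' \<in> Co 2" "Y' \<in> Co 2"
    unfolding X'_def Y'_def numeral_2_eq_2
    by (intro cochains_div coboundary_Co x[simplified] y[simplified])+
  show "e' i \<in> Co 1"
    unfolding e'_def using g by (intro cochains_div cochains_intros act_Co x y) simp
qed

lemma q_X': "scal (int q) X' = \<delta> x'" and q_Y': "scal (int q) Y' = \<delta> y'"
  by (simp_all add: fun_eq_iff X'_def Y'_def x'_def y'_def cobd_lift1_dvd)

lemma act_x': "act (Heis q) (heis_sigma [^]\<^bsub>Heis q\<^esub> (i::nat)) x' = x'"
  unfolding x'_def by (rule act_lift1) (simp add: inv_sigma_pow_mult)

lemma act_y': "act (Heis q) (heis_sigma [^]\<^bsub>Heis q\<^esub> i) y' = lift1 (\<lambda>x. L x + int i * J x)"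
  unfolding y'_def by (rule act_lift1) (simp add: inv_sigma_pow_mult)

text \<open>The division in \<open>e'\<close> is exact: modulo \<open>q\<close> all residues may be
  dropped, and \<open>L + i J\<close> has the same differences on both sides.\<close>

lemma q_e': "scal (int q) (e' i) = y' + scal (int i) x' - act (Heis q) (heis_sigma [^]\<^bsub>Heis q\<^esub> i) y'"
proof -
  have "int q dvd (y' + scal (int i) x' - act (Heis q) (heis_sigma [^]\<^bsub>Heis q\<^esub> i) y') xs" for xs
  proof (cases "set xs \<subseteq> carrier (Heis q) \<and> length xs = 2")
    case True
    then obtain a b where xs: "xs = [a, b]"
      by (auto simp: numeral_2_eq_2 length_Suc_conv)
    have "[(L b - L a) mod int q + int i * ((J b - J a) mod int q) -
        (L b + int i * J b - (L a + int i * J a)) mod int q =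
        (L b - L a) + int i * (J b - J a) - (L b + int i * J b - (L a + int i * J a))] (mod int q)"
      by (intro cong_diff cong_add cong_mult) (simp_all add: cong_def)
    then show ?thesis
      using True unfolding act_y'
      by (simp add: xs x'_def y'_def lift1_def restr_apply cong_0_iff algebra_simps)
  next
    case False
    then show ?thesis unfolding act_y' by (auto simp: x'_def y'_def lift1_def restr_apply)
  qed
  then show ?thesis by (simp add: fun_eq_iff e'_def)
qed

lemma cobd_X': "\<delta> X' = 0" and cobd_Y': "\<delta> Y' = 0"
proof -
  have *: "scal (int q) (\<delta> X') = scal (int q) 0" "scal (int q) (\<delta> Y') = scal (int q) 0"
    by (simp_all only: cobd_linear(5)[symmetric] q_X' q_Y' cobd_cobd scal_simps)
  show "\<delta> X' = 0" "\<delta> Y' = 0" by (rule scal_q_cancel[OF *(1)] scal_q_cancel[OF *(2)])+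
qed

lemma act_X': "act (Heis q) (heis_sigma [^]\<^bsub>Heis q\<^esub> (i::nat)) X' = X'"
  by (rule scal_q_cancel)
     (simp only: act_linear(5)[symmetric] q_X' act_cobd[OF nat_pow_closed[OF g]] act_x')

lemma act_Y': "act (Heis q) (heis_sigma [^]\<^bsub>Heis q\<^esub> i) Y' = Y' + scal (int i) X' - \<delta> (e' i)"
proof (rule scal_q_cancel)
  have "act (Heis q) (heis_sigma [^]\<^bsub>Heis q\<^esub> i) y' = y' + scal (int i) x' - scal (int q) (e' i)"
    unfolding q_e' by simp
  then have "\<delta> (act (Heis q) (heis_sigma [^]\<^bsub>Heis q\<^esub> i) y') =
      \<delta> y' + scal (int i) (\<delta> x') - scal (int q) (\<delta> (e' i))"
    by (simp only: cobd_linear)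
  then show "scal (int q) (act (Heis q) (heis_sigma [^]\<^bsub>Heis q\<^esub> i) Y') =
      scal (int q) (Y' + scal (int i) X' - \<delta> (e' i))"
    unfolding act_linear(5)[symmetric] q_Y' act_cobd[OF nat_pow_closed[OF g]]
      scal_right_diff scal_right_distrib scal_simps(6) mult.commute[of "int q"]
    unfolding scal_simps(6)[symmetric] q_X' by simp
qed

text \<open>Apply \<sigma> to \<open>q_e'\<close> for \<open>i\<close>, and compare with
  \<open>q_e'\<close> for \<open>Suc i\<close> and for 1.\<close>

lemma act_e': "act (Heis q) heis_sigma (e' i) = e' (Suc i) - e' 1"
proof (rule scal_q_cancel)
  have "act (Heis q) heis_sigma x' = x'"
    using act_x'[of 1] g by simp
  moreover have "act (Heis q) heis_sigma y' = y' + x' - scal (int q) (e' 1)"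
    using q_e'[of 1] g by simp
  ultimately have "act (Heis q) heis_sigma (scal (int q) (e' i)) =
      (y' + x' - scal (int q) (e' 1)) + scal (int i) x' -
        act (Heis q) (heis_sigma [^]\<^bsub>Heis q\<^esub> Suc i) y'"
    unfolding q_e'[of i] act_linear act_pow_Suc by simp
  also have "\<dots> = scal (int q) (e' (Suc i)) - scal (int q) (e' 1)"
    unfolding q_e'[of "Suc i"] of_nat_Suc scal_left_distrib scal_simps(1) by (simp add: algebra_simps)
  finally show "scal (int q) (act (Heis q) heis_sigma (e' i)) = scal (int q) (e' (Suc i) - e' 1)"
    by (simp only: act_linear scal_right_diff)
qed

lemma e'_0: "e' 0 = 0"
proof (rule scal_q_cancel)
  show "scal (int q) (e' 0) = scal (int q) 0"
    unfolding q_e' using act_M[OF M_closed(3) y'_Co] by simp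
qed

text \<open>The \<open>q\<close>-th power of \<sigma> fixes \<open>y'\<close>, so
  \<open>q_e'\<close> reads \<open>q e' = q x'\<close>. This value after a full period is where the
  factor \<open>\<lambda>_1\<close> of the differential comes from.\<close>

lemma e'_q: "e' q = x'"
proof (rule scal_q_cancel)
  have "act (Heis q) (heis_sigma [^]\<^bsub>Heis q\<^esub> q) y' = y'"
    using g_pow act_M[OF _ y'_Co] q_pos by (simp add: order_Heis_Mod)
  then show "scal (int q) (e' q) = scal (int q) x'"
    unfolding q_e' by simp
qed

end

section \<open>Reduction of coefficients and low-degree facts\<close>

definition red :: "('a \<Rightarrow> int) \<Rightarrow> 'a \<Rightarrow> 'k::comm_ring_1" where
  "red f = (\<lambda>x. of_int (f x))"

lemma red_apply: "red f x = of_int (f x)"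
  by (simp add: red_def)

lemma red_linear: "red (f + h) = red f + red h" "red (f - h) = red f - red h" "red 0 = 0"
    "red (scal c f) = scal (of_int c) (red f)"
  by (simp_all add: fun_eq_iff red_apply)

lemma red_restr: "red (restr X f) = restr X (red f)"
  by (simp add: fun_eq_iff red_apply restr_apply)

lemma red_cobd: "red (cobd X f) = cobd X (red f)"
  by (simp add: fun_eq_iff red_apply restr_apply cobd_face_sum red_def face_sum_of_int)

lemma red_act: "red (act G h f) = act G h (red f)"
  by (simp add: fun_eq_iff red_apply restr_apply act_def)

lemma red_cochains: "f \<in> cochains G M X s \<Longrightarrow> red f \<in> cochains G M X s"
  by (rule cochainsI) (use cochainsD[of f G M X s] in \<open>force simp: red_apply\<close>)+

text \<open>The terms have period \<open>CHAR('k)\<close> in \<open>j\<close>, so the sum is one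
  period's sum times the power of the characteristic with exponent \<open>n - 1\<close>, which is 0
  in the ring because \<open>n \<ge> 2\<close>.\<close>

lemma sum_of_nat_CHAR_power:
  fixes F :: "'k::comm_ring_1 \<Rightarrow> 'a \<Rightarrow> 'k"
  assumes n: "n \<ge> 2"
  shows "(\<Sum>j<CHAR('k) ^ n. F (of_nat j)) = 0"
proof -
  let ?p = "CHAR('k)"
  obtain m where m: "n = Suc (Suc m)" by (metis add_2_eq_Suc le_Suc_ex[OF n])
  have shift: "(\<Sum>j\<in>{i * ?p..<i * ?p + ?p}. F (of_nat j)) = (\<Sum>j<?p. F (of_nat j))" for i
  proof -
    have "(\<Sum>j\<in>{0 + i * ?p..<?p + i * ?p}. F (of_nat j)) = (\<Sum>j\<in>{0..<?p}. F (of_nat (j + i * ?p)))"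
      by (rule sum.shift_bounds_nat_ivl)
    then show ?thesis by (simp add: add.commute atLeast0LessThan)
  qed
  have "(\<Sum>j<?p ^ n. F (of_nat j)) = (\<Sum>i<?p ^ Suc m. \<Sum>j\<in>{i * ?p..<i * ?p + ?p}. F (of_nat j))"
    using sum.nat_group[of "\<lambda>j. F (of_nat j)" ?p "?p ^ Suc m"] by (simp add: m mult.commute mult.assoc)
  moreover have "\<dots> = scal (of_nat (?p ^ Suc m)) (\<Sum>j<?p. F (of_nat j))"
    unfolding shift by (simp add: fun_eq_iff sum_fun_apply)
  moreover have "of_nat (?p ^ Suc m) = (0 :: 'k)"
    by simp
  ultimately show ?thesis by (simp only: scal_simps)
qed

context cyclic_extension
begin

text \<open>Translations act transitively on \<open>M\<close>, so a cochain of degree 0 is constant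
  and its coboundary vanishes. A class in degree 1 thus contains a single cochain.\<close>

lemma coboundaries_1: "coboundaries G M M 1 = {0 :: 'a list \<Rightarrow> 'k::comm_ring_1}"
proof -
  have "cobd M c = 0" if c: "c \<in> cochains G M M 0" for c :: "'a list \<Rightarrow> 'k"
  proof
    fix xs
    show "cobd M c xs = 0 xs"
    proof (cases "set xs \<subseteq> M \<and> length xs = 2")
      case True
      then obtain v w where xs: "xs = [v, w]" "v \<in> M" "w \<in> M"
        by (auto simp: numeral_2_eq_2 length_Suc_conv)
      then have "w \<otimes> inv v \<otimes> v = w"
        using M_carrier by (simp add: m_assoc)
      then have "c [w] = c [v]"
        using cochainsD(3)[OF c, of "w \<otimes> inv v" "[v]"] xs M_closed by simp
      then show ?thesis using xs by (simp add: cobd_face_sum restr_apply face_sum_Cons)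
    next
      case False
      have "cobd M c \<in> cochains G M M (Suc 0)"
        by (rule cobd_cochains[OF M_closed(1) c])
      then show ?thesis using False cochainsD(1,2)[of "cobd M c" G M M "Suc 0" xs] by auto
    qed
  qed
  moreover have "(0 :: 'a list \<Rightarrow> 'k) \<in> cobd M ` cochains G M M 0"
    by (rule image_eqI[of _ _ 0]) (simp_all add: cobd_linear)
  ultimately show ?thesis by auto
qed

lemma cohom_power_coset:
  assumes Y: "Y \<in> Co 2" "\<delta> Y = 0"
  shows "cohom_power G M 2 (restr M Y +o coboundaries G M M 2) i =
    restr M (cpow Y i) +o coboundaries G M M (2 * i)"
proof (induction i)
  case 0
  show ?case by (simp add: cohom_one_def restr_unit_cochain flip: unit_cochain_def)
next
  case (Suc i)
  then have IH: "cohom_power G M 2 (restr M Y +o coboundaries G M M 2) i =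
    restr M (cpow Y i) +o coboundaries G M M (2 * i)" .
  show "cohom_power G M 2 (restr M Y +o coboundaries G M M 2) (Suc i) =
    restr M (cpow Y (Suc i)) +o coboundaries G M M (2 * Suc i)"
    using cohom_cup_coset[OF M_closed(1) restr_cocycles[OF cpow_Co[OF Y(1)] cobd_cpow[OF Y]]
        restr_cocycles[OF Y], of i]
    by (simp add: IH restr_cup mult.commute)
qed

end

section \<open>Representatives of \<open>x_1\<close>, \<open>y_1\<close> and the Bockstein of
  \<open>y_1\<close>\<close>

context heis
begin

lemma M_cases:
  assumes "v \<in> heis_M q"
  obtains j k where "v = (0, j, k)" "0 \<le> j" "j < int q" "0 \<le> k" "k < int q"
  using assms q_pos by (cases v) (auto simp: heis_M_iff)

lemma hom_class_coset:
  "hom_class (Heis q) (heis_M q) (\<lambda>(t, j, k). of_int j) =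
    restr (heis_M q) (red x') +o coboundaries (Heis q) (heis_M q) (heis_M q) 1"
  "hom_class (Heis q) (heis_M q) (\<lambda>(t, j, k). of_int k) =
    restr (heis_M q) (red y') +o coboundaries (Heis q) (heis_M q) (heis_M q) 1"
proof -
  have eq: "inv\<^bsub>Heis q\<^esub> v \<otimes>\<^bsub>Heis q\<^esub> w = (0, (J w - J v) mod int q, (L w - L v) mod int q)"
    if v: "v \<in> heis_M q" and w: "w \<in> heis_M q" for v w
  proof -
    obtain j k j' k' where *: "v = (0, j, k)" "w = (0, j', k')"
      using v w by (metis M_cases)
    then show ?thesis
      using v by (simp add: inv_Heis_M[OF q_pos] Heis_mult J_def L_def mod_simps)
  qed
  have *: "restr (heis_M q) (\<lambda>xs. if length xs = 2 then \<theta> (inv\<^bsub>Heis q\<^esub> (xs ! 0) \<otimes>\<^bsub>Heis q\<^esub> xs ! 1) else 0) =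
      restr (heis_M q) (red (lift1 \<phi>))"
    if "\<And>v w. v \<in> heis_M q \<Longrightarrow> w \<in> heis_M q \<Longrightarrow>
      \<theta> (inv\<^bsub>Heis q\<^esub> v \<otimes>\<^bsub>Heis q\<^esub> w) = of_int ((\<phi> w - \<phi> v) mod int q)"
    for \<theta> :: "heis_elt \<Rightarrow> 'c::comm_ring_1" and \<phi>
  proof
    fix xs
    show "restr (heis_M q) (\<lambda>xs. if length xs = 2 then \<theta> (inv\<^bsub>Heis q\<^esub> (xs ! 0) \<otimes>\<^bsub>Heis q\<^esub> xs ! 1) else 0) xs =
      restr (heis_M q) (red (lift1 \<phi>)) xs"
    proof (cases "set xs \<subseteq> heis_M q \<and> length xs = 2")
      case True
      then obtain v w where "xs = [v, w]" "v \<in> heis_M q" "w \<in> heis_M q"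
        by (auto simp: numeral_2_eq_2 length_Suc_conv)
      then show ?thesis
        using that M_carrier by (simp add: restr_apply red_apply lift1_def)
    qed (use M_subset in \<open>auto simp: restr_apply red_apply lift1_def\<close>)
  qed
  show "hom_class (Heis q) (heis_M q) (\<lambda>(t, j, k). of_int j) =
      restr (heis_M q) (red x') +o coboundaries (Heis q) (heis_M q) (heis_M q) 1"
    unfolding hom_class_def x'_def by (simp only: *[of "\<lambda>(t, j, k). of_int j" J] eq prod.case)
  show "hom_class (Heis q) (heis_M q) (\<lambda>(t, j, k). of_int k) =
      restr (heis_M q) (red y') +o coboundaries (Heis q) (heis_M q) (heis_M q) 1"
    unfolding hom_class_def y'_def by (simp only: *[of "\<lambda>(t, j, k). of_int k" L] eq prod.case)
qed

text \<open>Modulo \<open>q\<close>, the cochain \<open>f\<close> is a homomorphism on \<open>M\<close>, so \<open>a\<close> and \<open>b\<close> determine it.\<close>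
lemma almost_cocycle_cong:
  assumes f: "f \<in> cochains (Heis q) (heis_M q) (heis_M q) 1"
    and dvd: "\<And>xs. int q dvd cobd (heis_M q) f xs"
    and v: "v \<in> heis_M q" and w: "w \<in> heis_M q"
  shows "[f [v, w] = f [\<one>\<^bsub>Heis q\<^esub>, heis_a] * (J w - J v) + f [\<one>\<^bsub>Heis q\<^esub>, heis_b] * (L w - L v)] (mod int q)"
proof -
  let ?F = "\<lambda>v. f [\<one>\<^bsub>Heis q\<^esub>, v]"
  have diff: "[f [v, w] = ?F w - ?F v] (mod int q)" if "v \<in> heis_M q" "w \<in> heis_M q" for v w
    using dvd[of "[\<one>\<^bsub>Heis q\<^esub>, v, w]"] that M_closed(3)
    by (simp add: cobd_face_sum restr_apply face_sum_Cons cong_iff_dvd_diff algebra_simps)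
  have add: "[?F (v \<otimes>\<^bsub>Heis q\<^esub> w) = ?F v + ?F w] (mod int q)" if "v \<in> heis_M q" "w \<in> heis_M q" for v w
  proof -
    have "f [v, v \<otimes>\<^bsub>Heis q\<^esub> w] = ?F w"
      using cochainsD(3)[OF f that(1), of "[\<one>\<^bsub>Heis q\<^esub>, w]"] that M_closed(3) M_carrier by simp
    then have "[?F w = ?F (v \<otimes>\<^bsub>Heis q\<^esub> w) - ?F v] (mod int q)"
      using diff[OF that(1) M_closed(1)[OF that]] by simp
    then show ?thesis by (simp add: cong_iff_dvd_diff dvd_diff_commute algebra_simps)
  qed
  have one: "[?F (0, 0, 0) = 0] (mod int q)"
    using add[OF M_closed(3) M_closed(3)] by (simp add: one_Heis Heis_mult cong_iff_dvd_diff)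
  have a: "[?F (0, int j, 0) = ?F heis_a * int j] (mod int q)" if "j < q" for j
    using that
  proof (induction j)
    case (Suc j)
    have "[?F ((0, int j, 0) \<otimes>\<^bsub>Heis q\<^esub> heis_a) = ?F (0, int j, 0) + ?F heis_a] (mod int q)"
      using Suc.prems q by (intro add) (auto simp: heis_a_def heis_M_iff)
    also have "(0, int j, 0) \<otimes>\<^bsub>Heis q\<^esub> heis_a = (0, int (Suc j), 0)"
      using Suc.prems by (simp add: heis_a_def Heis_mult)
    also have "[?F (0, int j, 0) + ?F heis_a = ?F heis_a * int j + ?F heis_a] (mod int q)"
      using Suc by (intro cong_add) auto
    finally show ?case by (simp add: algebra_simps)
  qed (use one in simp)
  have b: "[?F (0, 0, int j) = ?F heis_b * int j] (mod int q)" if "j < q" for j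
    using that
  proof (induction j)
    case (Suc j)
    have "[?F ((0, 0, int j) \<otimes>\<^bsub>Heis q\<^esub> heis_b) = ?F (0, 0, int j) + ?F heis_b] (mod int q)"
      using Suc.prems q by (intro add) (auto simp: heis_b_def heis_M_iff)
    also have "(0, 0, int j) \<otimes>\<^bsub>Heis q\<^esub> heis_b = (0, 0, int (Suc j))"
      using Suc.prems by (simp add: heis_b_def Heis_mult)
    also have "[?F (0, 0, int j) + ?F heis_b = ?F heis_b * int j + ?F heis_b] (mod int q)"
      using Suc by (intro cong_add) auto
    finally show ?case by (simp add: algebra_simps)
  qed (use one in simp)
  have F: "[?F v = ?F heis_a * J v + ?F heis_b * L v] (mod int q)" if v: "v \<in> heis_M q" for v
  proof -
    from v obtain j k where jk: "v = (0, j, k)" "0 \<le> j" "j < int q" "0 \<le> k" "k < int q"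
      by (rule M_cases)
    have "[?F ((0, j, 0) \<otimes>\<^bsub>Heis q\<^esub> (0, 0, k)) = ?F (0, j, 0) + ?F (0, 0, k)] (mod int q)"
      using jk q_pos by (intro add) (auto simp: heis_M_iff)
    also have "[?F (0, j, 0) + ?F (0, 0, k) = ?F heis_a * j + ?F heis_b * k] (mod int q)"
      using a[of "nat j"] b[of "nat k"] jk by (intro cong_add) auto
    also have "(0, j, 0) \<otimes>\<^bsub>Heis q\<^esub> (0, 0, k) = v"
      using jk by (simp add: Heis_mult)
    finally show ?thesis by (simp add: jk(1) J_def L_def)
  qed
  have "[f [v, w] = ?F w - ?F v] (mod int q)" by (rule diff[OF v w])
  also have "[?F w - ?F v = (?F heis_a * J w + ?F heis_b * L w) - (?F heis_a * J v + ?F heis_b * L v)] (mod int q)"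
    by (intro cong_diff F v w)
  finally show ?thesis by (simp add: algebra_simps)
qed

text \<open>By \<open>almost_cocycle_cong\<close> any admissible lift is
  \<open>\<alpha> x' + \<beta> y' - q \<epsilon>\<close> on \<open>M\<close>, so its coboundary
  divided by \<open>q\<close> is \<open>\<alpha> X' + \<beta> Y'\<close> minus a coboundary. In the
  coefficients \<alpha> is 0 and \<beta> is 1, so every lift gives the class of
  \<open>Y'\<close>.\<close>

lemma bockstein_y1:
  assumes pn: "p ^ n = q"
  shows "bockstein (Heis q) (heis_M q) p n 1
      (restr (heis_M q) (red y') +o coboundaries (Heis q) (heis_M q) (heis_M q) 1) =
    (restr (heis_M q) (red Y') +o coboundaries (Heis q) (heis_M q) (heis_M q) 2
      :: (heis_elt list \<Rightarrow> 'k::comm_ring_1) set)"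
proof -
  let ?M = "heis_M q" and ?B = "\<lambda>s. coboundaries (Heis q) (heis_M q) (heis_M q) s :: (heis_elt list \<Rightarrow> 'k) set"
  let ?S = "{red (\<lambda>xs. cobd ?M f xs div int q) :: _ \<Rightarrow> 'k | f. f \<in> cochains (Heis q) ?M ?M 1 \<and>
      (red f :: _ \<Rightarrow> 'k) \<in> restr ?M (red y') +o ?B 1 \<and> (\<forall>xs. int q dvd cobd ?M f xs)}"
  have eq: "bockstein (Heis q) ?M p n 1 (restr ?M (red y') +o ?B 1) = ?S + ?B 2"
    by (simp add: bockstein_def red_def pn numeral_2_eq_2)
  have MX: "cobd ?M (restr ?M x') = scal (int q) (restr ?M X')"
    and MY: "cobd ?M (restr ?M y') = scal (int q) (restr ?M Y')"
    by (simp_all only: cobd_restr[OF M_subset, symmetric] q_X'[symmetric] q_Y'[symmetric] restr_linear)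
  show ?thesis
    unfolding eq
  proof (intro coset_plus_subgroup coboundaries_add_subgroup)
    have "red (restr ?M y') \<in> restr ?M (red y') +o ?B 1"
      by (simp only: red_restr self_in_coset[OF coboundaries_add_subgroup])
    moreover have "\<forall>xs. int q dvd cobd ?M (restr ?M y') xs"
      by (simp add: MY)
    ultimately show "?S \<noteq> {}"
      using restr_cochains[OF y'_Co] by blast
    fix s assume "s \<in> ?S"
    then obtain f where s: "s = red (\<lambda>xs. cobd ?M f xs div int q)" and f: "f \<in> cochains (Heis q) ?M ?M 1"
      and "(red f :: _ \<Rightarrow> 'k) \<in> restr ?M (red y') +o ?B 1" and dvd: "\<And>xs. int q dvd cobd ?M f xs"
      by blast
    \<comment> \<open>There are no nonzero coboundaries in degree 1, so the reduction of
      \<open>f\<close> is fixed exactly.\<close>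
    then have red: "(red f :: _ \<Rightarrow> 'k) = restr ?M (red y')"
      unfolding coboundaries_1 by (simp add: elt_set_plus_iff)
    define \<alpha> where "\<alpha> = f [\<one>\<^bsub>Heis q\<^esub>, heis_a]"
    define \<beta> where "\<beta> = f [\<one>\<^bsub>Heis q\<^esub>, heis_b]"
    have ab: "heis_a \<in> ?M" "heis_b \<in> ?M" "(0, 0, 0) \<in> ?M"
      using q by (auto simp: heis_a_def heis_b_def heis_M_iff)
    \<comment> \<open>The reduction of \<open>y'\<close> takes the values 0 and 1 on the edges from
      the identity to \<open>heis_a\<close> and \<open>heis_b\<close>.\<close>
    have \<alpha>: "of_int \<alpha> = (0 :: 'k)"
      using fun_cong[OF red, of "[\<one>\<^bsub>Heis q\<^esub>, heis_a]"] ab M_carrier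
      by (simp add: \<alpha>_def red_apply restr_apply y'_def lift1_def one_Heis) (simp add: L_def heis_a_def)
    have \<beta>: "of_int \<beta> = (1 :: 'k)"
      using fun_cong[OF red, of "[\<one>\<^bsub>Heis q\<^esub>, heis_b]"] ab M_carrier q
      by (simp add: \<beta>_def red_apply restr_apply y'_def lift1_def one_Heis) (simp add: L_def heis_b_def)
    define r where "r = scal \<alpha> (restr ?M x') + scal \<beta> (restr ?M y') - f"
    define \<epsilon> where "\<epsilon> = (\<lambda>xs. r xs div int q)"
    have r: "r \<in> cochains (Heis q) ?M ?M 1"
      unfolding r_def by (intro cochains_intros restr_cochains x'_Co y'_Co f)
    have \<epsilon>: "\<epsilon> \<in> cochains (Heis q) ?M ?M 1"
      unfolding \<epsilon>_def by (rule cochains_div[OF r])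
    have "int q dvd r xs" for xs
    proof (cases "set xs \<subseteq> ?M \<and> length xs = 2")
      case True
      then obtain v w where xs: "xs = [v, w]" "v \<in> ?M" "w \<in> ?M"
        by (auto simp: numeral_2_eq_2 length_Suc_conv)
      have "[\<alpha> * ((J w - J v) mod int q) + \<beta> * ((L w - L v) mod int q) - f [v, w] =
          \<alpha> * (J w - J v) + \<beta> * (L w - L v) - (\<alpha> * (J w - J v) + \<beta> * (L w - L v))] (mod int q)"
        unfolding \<alpha>_def \<beta>_def
        by (intro cong_diff cong_add cong_mult almost_cocycle_cong[OF f dvd] xs) (simp_all add: cong_def)
      then show ?thesis
        using xs M_carrier by (simp add: r_def x'_def y'_def lift1_def restr_apply cong_0_iff)
    next
      case False
      then have "r xs = 0"
        using cochainsD(1,2)[OF r, of xs] by (metis Suc_1)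
      then show ?thesis by simp
    qed
    then have "scal (int q) \<epsilon> = r" by (simp add: \<epsilon>_def fun_eq_iff)
    then have "f = scal \<alpha> (restr ?M x') + scal \<beta> (restr ?M y') - scal (int q) \<epsilon>"
      by (simp add: r_def)
    then have "cobd ?M f = scal (int q) (scal \<alpha> (restr ?M X') + scal \<beta> (restr ?M Y') - cobd ?M \<epsilon>)"
      by (simp add: cobd_linear MX MY scal_right_diff scal_right_distrib mult.commute)
    then have "(\<lambda>xs. cobd ?M f xs div int q) = scal \<alpha> (restr ?M X') + scal \<beta> (restr ?M Y') - cobd ?M \<epsilon>"
      using q by (simp add: fun_eq_iff)
    then have "s = restr ?M (red Y') - cobd ?M (red \<epsilon>)"
      unfolding s by (simp add: red_linear red_restr red_cobd \<alpha> \<beta>)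
    then have "s - restr ?M (red Y') = - cobd ?M (red \<epsilon>)" by simp
    moreover have "(red \<epsilon> :: _ \<Rightarrow> 'k) \<in> cochains (Heis q) ?M ?M 1"
      by (rule red_cochains[OF \<epsilon>])
    then have "cobd ?M (red \<epsilon>) \<in> ?B 2"
      by (simp add: numeral_2_eq_2)
    ultimately show "s - restr ?M (red Y') \<in> ?B 2"
      by (simp only: coboundaries_closed(3))
  qed
qed

section \<open>The differential for the Heisenberg group\<close>

text \<open>Reducing the integral identities supplies the hypotheses of \<open>d2_formula\<close>;
  in particular the coboundary \<open>q X'\<close> of \<open>x'\<close> reduces to 0.\<close>

lemma d2_heis:
  fixes u :: "'k::comm_ring_1 \<Rightarrow> heis_elt list \<Rightarrow> 'k"
  assumes q0: "of_nat q = (0 :: 'k)"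
    and sums: "\<And>F :: 'k \<Rightarrow> heis_elt list \<Rightarrow> 'k. (\<Sum>j<q. F (of_nat j)) = 0"
    and u: "\<And>c. u c \<in> Co d" "\<And>c. \<delta> (u c) = 0"
      "\<And>j::nat. act (Heis q) (heis_sigma [^]\<^bsub>Heis q\<^esub> j) (u 0) = u (of_nat j)"
    and dm: "0 < d \<or> 0 < m"
  defines "\<phi> \<equiv> \<lambda>m. restr (heis_M q) (cup d (u 0) (cpow (red Y') m)) +o
    coboundaries (Heis q) (heis_M q) (heis_M q) (d + 2 * m)"
  shows "lhs_diff (Heis q) (heis_M q) heis_sigma 2 1 (d + 2 * Suc m)
      (E2_bar (Heis q) (heis_M q) heis_sigma 1 (d + 2 * Suc m) (\<phi> (Suc m))) =
    lhs_scale (Heis q) (heis_M q) heis_sigma 2 3 (d + 2 * m + 1) (- of_nat (Suc m))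
      (E2_mult (Heis q) (heis_M q) heis_sigma 1 (d + 2 * m + 1) 2 0
        (E2_mult (Heis q) (heis_M q) heis_sigma 0 1 1 (d + 2 * m)
          (E2_bar (Heis q) (heis_M q) heis_sigma 0 1
            (restr (heis_M q) (red x') +o coboundaries (Heis q) (heis_M q) (heis_M q) 1))
          (E2_bar (Heis q) (heis_M q) heis_sigma 1 (d + 2 * m) (\<phi> m)))
        (E2_bar (Heis q) (heis_M q) heis_sigma 2 0 (cohom_one (Heis q) (heis_M q))))"
  unfolding \<phi>_def
proof (rule d2_formula[where X = "red X'" and e = "\<lambda>i. red (e' i)"])
  have [simp]: "order (Heis q Mod heis_M q) = q" by (rule order_Heis_Mod[OF q_pos])
  show "(\<Sum>j<order (Heis q Mod heis_M q). F (of_nat j)) = 0" for F :: "'k \<Rightarrow> heis_elt list \<Rightarrow> 'k"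
    by (simp add: sums)
  show "of_nat (order (Heis q Mod heis_M q)) = (0 :: 'k)" by (simp add: q0)
  show "red (X') \<in> Co 2" "red (Y') \<in> Co 2" "red (x') \<in> Co 1" "red (e' j) \<in> Co 1" for j
    by (intro red_cochains integral_cochains)+
  show "\<delta> (red X') = 0" "\<delta> (red Y') = 0"
    by (simp_all add: cobd_X' cobd_Y' red_linear flip: red_cobd)
  show "\<delta> (red x') = (0 :: _ \<Rightarrow> 'k)"
    unfolding red_cobd[symmetric] q_X'[symmetric] red_linear by (simp add: q0)
  show "act (Heis q) heis_sigma (red X') = red X'" "act (Heis q) heis_sigma (red x') = red x'"
    using act_X'[of 1] act_x'[of 1] g by (simp_all flip: red_act)
  show "act (Heis q) (heis_sigma [^]\<^bsub>Heis q\<^esub> j) (red Y') = red Y' + scal (of_nat j) (red X') - \<delta> (red (e' j))" for j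
    by (simp add: act_Y' red_linear flip: red_act red_cobd)
  show "act (Heis q) heis_sigma (red (e' j)) = red (e' (Suc j)) - red (e' 1)" for j
    by (simp only: act_e' red_linear flip: red_act)
  show "red (e' 0) = 0" "red (e' (order (Heis q Mod heis_M q))) = red x'"
    by (simp_all add: e'_0 e'_q red_linear)
qed (fact u dm)+

text \<open>The defect \<open>q e'\<close> of the integral identity reduces to 0.\<close>

lemma act_y'_red:
  assumes "of_nat q = (0 :: 'k::comm_ring_1)"
  shows "act (Heis q) (heis_sigma [^]\<^bsub>Heis q\<^esub> j) (red y' :: _ \<Rightarrow> 'k) = red y' + scal (of_nat j) (red x')"
proof -
  have "red (scal (int q) (e' j)) = (0 :: _ \<Rightarrow> 'k)"
    using assms by (simp add: red_linear)
  then have "red y' + scal (of_nat j) (red x') - act (Heis q) (heis_sigma [^]\<^bsub>Heis q\<^esub> j) (red y') = (0 :: _ \<Rightarrow> 'k)"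
    unfolding q_e' by (simp add: red_linear red_act)
  then show ?thesis by (simp only: right_minus_eq)
qed

end

theorem proposition5p3:
  fixes p n :: nat
  assumes "prime p" and "odd p" and "n \<ge> 2" and "CHAR('k::field) = p"
  shows "(\<forall>i. 2 \<le> i \<and> i \<le> p \<longrightarrow>
           heis_d2 p n 1 (2 * i - 1) (mu p n (2 * i) :: (nat \<Rightarrow> heis_elt list \<Rightarrow> 'k) set) =
           heis_scale p n 3 (2 * i - 2) (- of_nat (i - 1))
             (heis_mult p n 1 (2 * i - 2) 2 0
                (heis_mult p n 0 1 1 (2 * i - 3) (lambda1 p n) (mu p n (2 * i - 2)))
                (gamma2 p n))) \<and>
         (\<forall>i. 2 \<le> i \<and> i \<le> p - 1 \<longrightarrow>
           heis_d2 p n 1 (2 * i) (mu p n (2 * i + 1) :: (nat \<Rightarrow> heis_elt list \<Rightarrow> 'k) set) =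
           heis_scale p n 3 (2 * i - 1) (- of_nat i)
             (heis_mult p n 1 (2 * i - 1) 2 0
                (heis_mult p n 0 1 1 (2 * i - 2) (lambda1 p n) (mu p n (2 * i - 1)))
                (gamma2 p n)))"
proof -
  define q where "q = p ^ n"
  have "1 < p" using assms(1) by (rule prime_gt_1_nat)
  then have "1 < q" using assms(3) unfolding q_def by (intro one_less_power) auto
  then interpret heis q by unfold_locales
  have q0: "of_nat q = (0 :: 'k)"
    using assms(3,4) of_nat_CHAR[where 'a = 'k] by (simp add: q_def)
  have sums: "(\<Sum>j<q. F (of_nat j)) = 0" for F :: "'k \<Rightarrow> heis_elt list \<Rightarrow> 'k"
    using sum_of_nat_CHAR_power[OF assms(3), of F] assms(4) by (simp add: q_def)
  let ?B = "coboundaries (Heis q) (heis_M q) (heis_M q) :: nat \<Rightarrow> (heis_elt list \<Rightarrow> 'k) set"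
  let ?x = "red x' :: heis_elt list \<Rightarrow> 'k" and ?y = "red y' :: heis_elt list \<Rightarrow> 'k"
    and ?Y = "red Y' :: heis_elt list \<Rightarrow> 'k" and ?one = "unit_cochain (carrier (Heis q)) :: heis_elt list \<Rightarrow> 'k"
  have Co: "?x \<in> Co 1" "?y \<in> Co 1" "?Y \<in> Co 2"
    by (intro red_cochains integral_cochains)+
  have \<delta>: "\<delta> ?x = 0" "\<delta> ?y = 0" "\<delta> ?Y = 0"
    unfolding red_cobd[symmetric] q_X'[symmetric] q_Y'[symmetric] cobd_Y' red_linear
    by (simp_all add: q0)
  have x1: "heis_x1 p n = restr (heis_M q) ?x +o ?B 1"
    and y1: "heis_y1 p n = restr (heis_M q) ?y +o ?B 1"
    by (simp_all only: heis_x1_def heis_y1_def q_def[symmetric] hom_class_coset)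
  have y2: "heis_y2 p n = restr (heis_M q) ?Y +o ?B 2"
    unfolding heis_y2_def y1 q_def[symmetric] by (rule bockstein_y1) (simp add: q_def)
  have pow: "heis_y2_pow p n i = restr (heis_M q) (cpow ?Y i) +o ?B (2 * i)" for i
    unfolding heis_y2_pow_def y2 q_def[symmetric] by (rule cohom_power_coset[OF Co(3) \<delta>(3)])
  have even_class: "heis_y1_y2_pow p n i = restr (heis_M q) (cup 1 ?y (cpow ?Y i)) +o ?B (1 + 2 * i)" for i
    unfolding heis_y1_y2_pow_def y1 pow q_def[symmetric] restr_cup
    by (rule cohom_cup_coset[OF M_closed(1) restr_cocycles[OF Co(2) \<delta>(2)]
          restr_cocycles[OF cpow_Co[OF Co(3)] cobd_cpow[OF Co(3) \<delta>(3)]]])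
  \<comment> \<open>The unit factor brings the odd case into the same form as the even one, with
    \<open>d = 0\<close> in place of \<open>d = 1\<close>.\<close>
  have odd_class: "heis_y2_pow p n i = restr (heis_M q) (cup 0 ?one (cpow ?Y i)) +o ?B (0 + 2 * i)" for i
    unfolding pow cup_unit_left[OF cpow_Co[OF Co(3)]] by simp
  \<comment> \<open>For even index the family is \<open>u c = y + c x\<close>, along which \<sigma>
    moves \<open>y\<close>; for odd index, below, it is constantly the unit.\<close>
  have u: "?y + scal c ?x \<in> Co 1" "\<delta> (?y + scal c ?x) = 0"
    "act (Heis q) (heis_sigma [^]\<^bsub>Heis q\<^esub> j) (?y + scal 0 ?x) = ?y + scal (of_nat j) ?x" for c and j :: nat
    by (simp_all only: Co \<delta> cochains_intros cobd_linear scal_simps add_0_right act_y'_red[OF q0])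
  have v: "?one \<in> Co 0" "\<delta> ?one = 0"
    "act (Heis q) (heis_sigma [^]\<^bsub>Heis q\<^esub> j) ?one = ?one" for j :: nat
    using g by (simp_all add: unit_cochain_cochains stable cobd_unit_cochain act_unit_cochain)
  show ?thesis
  proof (intro conjI allI impI)
    fix i assume i: "2 \<le> i \<and> i \<le> p"
    \<comment> \<open>\<open>\<mu>_(2i)\<close> comes from \<open>y_1 y_2^(i-1)\<close>, so the
      exponent \<open>Suc m\<close> is \<open>i - 1\<close>.\<close>
    define m where "m = i - 2"
    have m: "2 * i - 1 = 1 + 2 * Suc m" "2 * i - 2 = 1 + 2 * m + 1" "2 * i - 3 = 1 + 2 * m" "i - 1 = Suc m"
      unfolding m_def using i by arith+
    have "mu p n (2 * i) = heis_bar p n 1 (2 * i - 1) (heis_y1_y2_pow p n (i - 1) :: (_ \<Rightarrow> 'k) set)"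
      by (simp add: mu_def)
    note mu = this[unfolded m]
    have mu': "mu p n (1 + 2 * m + 1) = heis_bar p n 1 (1 + 2 * m) (heis_y1_y2_pow p n m)"
      by (simp add: mu_def)
    show "heis_d2 p n 1 (2 * i - 1) (mu p n (2 * i) :: (nat \<Rightarrow> heis_elt list \<Rightarrow> 'k) set) =
           heis_scale p n 3 (2 * i - 2) (- of_nat (i - 1))
             (heis_mult p n 1 (2 * i - 2) 2 0
                (heis_mult p n 0 1 1 (2 * i - 3) (lambda1 p n) (mu p n (2 * i - 2)))
                (gamma2 p n))"
      unfolding m mu mu' lambda1_def gamma2_def x1 even_class q_def[symmetric]
      \<comment> \<open>The instance contains \<open>?y + scal 0 ?x\<close>, which has to be
        simplified to \<open>?y\<close>.\<close>
      using d2_heis[OF q0 sums u, of m] by (simp only: scal_simps add_0_right zero_less_one simp_thms)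
  next
    fix i assume i: "2 \<le> i \<and> i \<le> p - 1"
    define m where "m = i - 1"
    have m: "2 * i = 0 + 2 * Suc m" "2 * i - 1 = 0 + 2 * m + 1" "2 * i - 2 = 0 + 2 * m" "i = Suc m"
      unfolding m_def using i by arith+
    \<comment> \<open>With \<open>d = 0\<close> the degree condition of \<open>d2_heis\<close> rests
      on \<open>m\<close> alone, and it holds because \<open>2 \<le> i\<close>.\<close>
    have m0: "0 < m" using i by (simp add: m_def)
    have mu: "mu p n (2 * i + 1) = heis_bar p n 1 (0 + 2 * Suc m) (heis_y2_pow p n (Suc m))"
      "mu p n (0 + 2 * m + 1) = heis_bar p n 1 (0 + 2 * m) (heis_y2_pow p n m)"
      by (simp_all add: mu_def m(4))
    have "heis_d2 p n 1 (0 + 2 * Suc m) (mu p n (2 * i + 1) :: (nat \<Rightarrow> heis_elt list \<Rightarrow> 'k) set) =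
           heis_scale p n 3 (0 + 2 * m + 1) (- of_nat (Suc m))
             (heis_mult p n 1 (0 + 2 * m + 1) 2 0
                (heis_mult p n 0 1 1 (0 + 2 * m) (lambda1 p n) (mu p n (0 + 2 * m + 1)))
                (gamma2 p n))"
      unfolding mu lambda1_def gamma2_def x1 odd_class q_def[symmetric]
      by (rule d2_heis[OF q0 sums v disjI2[OF m0]])
    from this[folded m(1-3), folded m(4)]
    show "heis_d2 p n 1 (2 * i) (mu p n (2 * i + 1) :: (nat \<Rightarrow> heis_elt list \<Rightarrow> 'k) set) =
           heis_scale p n 3 (2 * i - 1) (- of_nat i)
             (heis_mult p n 1 (2 * i - 1) 2 0
                (heis_mult p n 0 1 1 (2 * i - 2) (lambda1 p n) (mu p n (2 * i - 1)))
                (gamma2 p n))"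
      .
  qed
qed

end
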